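(* Let $D\subset\mathbb{R}^3$ be the open unit ball, let $0=r_0<r_1<r_2<\dots<r_{N-1}<r_N=1$, and let $\gamma_1,\dots,\gamma_N>0$ with $\gamma_N=1$. Let $\gamma$ be the piecewise constant radially symmetric conductivity with $\gamma(x)=\gamma_j$ for $r_{j-1}\le|x|<r_j$, $j=1,\dots,N$. Then the eigenvalues of the Dirichlet-to-Neumann map $\Lambda_\gamma$ are given by $$\lambda_0=0,\qquad \lambda_l=l-\frac{2l+1}{1+C_{N-1}},\quad l>0,$$ where $$C_j=w_j\,\frac{\beta_l\gamma_{j+1}\rho_j+\gamma_j}{\gamma_{j+1}\rho_j-\gamma_j},\qquad \rho_1=1,\qquad \rho_j=\frac{C_{j-1}+w_j}{C_{j-1}-\beta_lw_j}\ \ (j\ge2),\qquad \beta_l=\frac{l+1}{l},\qquad w_j=r_j^{-(2l+1)}.$$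
   Context: The Dirichlet-to-Neumann map is $\Lambda_\gamma f=\gamma\,\partial u/\partial\nu|_{\partial D}$, where $u$ is the solution of $\nabla\cdot(\gamma\nabla u)=0$ in $D$, $u|_{\partial D}=f$, and $\nu$ is the outward unit normal. For radially symmetric $\gamma$ its eigenfunctions are the spherical harmonics $Y_l^m$ ($l\ge0$, $-l\le m\le l$) on the unit sphere $\partial D$, and $\lambda_l$ denotes the eigenvalue with $\Lambda_\gamma Y_l^m=\lambda_lY_l^m$, which does not depend on $m$. The quantities $C_j$, $\rho_j$, $w_j$ are computed recursively in $j$ for each fixed $l>0$. *)

theory Defs
  imports "HOL-Analysis.Analysis" "HOL-Computational_Algebra.Polynomial"
begin

section \<open>Spherical harmonics on the unit sphere of \<open>\<real>\<^sup>3\<close>\<close>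

text \<open>Rodrigues' formula: \<open>P\<^sub>l(z) = 1/(2\<^sup>l l!) (d/dz)\<^sup>l (z\<^sup>2 - 1)\<^sup>l\<close>.\<close>

definition legendre :: "nat \<Rightarrow> real poly" where
  "legendre l = smult (1 / (2 ^ l * fact l)) ((pderiv ^^ l) ([:-1, 0, 1:] ^ l))"

text \<open>
  The usual \<open>Y\<^sub>l\<^sup>m(\<theta>,\<phi>) = \<surd>((2l+1)/(4\<pi>) (l-m)!/(l+m)!) P\<^sub>l\<^sup>m(cos \<theta>) e\<^bsup>im\<phi>\<^esup>\<close> with
  \<open>P\<^sub>l\<^sup>m(z) = (-1)\<^sup>m (1-z\<^sup>2)\<^bsup>m/2\<^esup> (d/dz)\<^sup>m P\<^sub>l(z)\<close> for \<open>m \<ge> 0\<close>, and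
  \<open>Y\<^sub>l\<^bsup>-m\<^esup> = (-1)\<^sup>m cnj Y\<^sub>l\<^sup>m\<close>. It is written in Cartesian coordinates: at a point of the sphere,
  \<open>cos \<theta> = x\<^sub>3\<close> and \<open>(1-x\<^sub>3\<^sup>2)\<^bsup>m/2\<^esup> e\<^bsup>im\<phi>\<^esup> = (x\<^sub>1 + i x\<^sub>2)\<^sup>m\<close>.
  Only \<open>\<bar>m\<bar> \<le> l\<close> and \<open>norm x = 1\<close> are meaningful.
\<close>

definition sph_harm_nonneg :: "nat \<Rightarrow> nat \<Rightarrow> real ^ 3 \<Rightarrow> complex" where
  "sph_harm_nonneg l m x =
     of_real (sqrt ((2 * real l + 1) / (4 * pi) * (fact (l - m) / fact (l + m)))
       * (-1) ^ m * poly ((pderiv ^^ m) (legendre l)) (x $ 3))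
     * Complex (x $ 1) (x $ 2) ^ m"

definition sph_harm :: "nat \<Rightarrow> int \<Rightarrow> real ^ 3 \<Rightarrow> complex" where
  "sph_harm l m x =
     (if 0 \<le> m then sph_harm_nonneg l (nat m) x
      else (-1) ^ nat (- m) * cnj (sph_harm_nonneg l (nat (- m)) x))"

section \<open>The conductivity equation and the Dirichlet-to-Neumann map\<close>

abbreviation unit_ball :: "(real ^ 3) set" where
  "unit_ball \<equiv> ball 0 1"

text \<open>\<open>\<phi> \<in> C\<^sup>1\<^sub>c(D)\<close> with gradient \<open>d\<close>.\<close>

definition test_function :: "(real ^ 3) set \<Rightarrow> (real ^ 3 \<Rightarrow> real) \<Rightarrow> (real ^ 3 \<Rightarrow> real ^ 3) \<Rightarrow> bool" where
  "test_function D \<phi> d \<longleftrightarrow>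
     (\<forall>x. GDERIV \<phi> x :> d x) \<and> continuous_on UNIV d \<and>
     (\<exists>K. compact K \<and> K \<subseteq> D \<and> (\<forall>x. x \<notin> K \<longrightarrow> \<phi> x = 0))"

definition square_integrable_on :: "(real ^ 3) set \<Rightarrow> (real ^ 3 \<Rightarrow> complex ^ 3) \<Rightarrow> bool" where
  "square_integrable_on D G \<longleftrightarrow>
     G \<in> borel_measurable (lebesgue_on D) \<and> integrable (lebesgue_on D) (\<lambda>x. (norm (G x))\<^sup>2)"

definition weak_gradient :: "(real ^ 3) set \<Rightarrow> (real ^ 3 \<Rightarrow> complex) \<Rightarrow> (real ^ 3 \<Rightarrow> complex ^ 3) \<Rightarrow> bool" where
  "weak_gradient D u G \<longleftrightarrow>
     (\<forall>\<phi> d i. test_function D \<phi> d \<longrightarrow>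
        (LINT x|lebesgue_on D. u x * of_real (d x $ i)) =
        - (LINT x|lebesgue_on D. G x $ i * of_real (\<phi> x)))"

text \<open>
  \<open>u\<close> is an \<open>H\<^sup>1\<close> weak solution of \<open>\<nabla>\<cdot>(\<gamma>\<nabla>u) = 0\<close> in the unit ball, continuous up to the
  boundary, where it equals \<open>f\<close>. As \<open>\<gamma>\<close> may jump, the equation is meant in the weak sense. The
  boundary data considered here are continuous, so they are attained pointwise. The function
  \<open>u\<close> is unconstrained outside the closed ball.
\<close>

definition dirichlet_solution ::
  "(real ^ 3 \<Rightarrow> real) \<Rightarrow> (real ^ 3 \<Rightarrow> complex) \<Rightarrow> (real ^ 3 \<Rightarrow> complex) \<Rightarrow> bool" where
  "dirichlet_solution \<gamma> f u \<longleftrightarrow>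
     continuous_on (cball 0 1) u \<and>
     (\<forall>x \<in> sphere 0 1. u x = f x) \<and>
     (\<exists>G. square_integrable_on unit_ball G \<and> weak_gradient unit_ball u G \<and>
        (\<forall>\<phi> d. test_function unit_ball \<phi> d \<longrightarrow>
           (LINT x|lebesgue_on unit_ball.
              of_real (\<gamma> x) * (\<Sum>i\<in>UNIV. G x $ i * of_real (d x $ i))) = 0))"

text \<open>
  The outward unit normal of the unit sphere at \<open>x\<close> is \<open>x\<close> itself; the derivative is one-sided,
  taken from inside the ball.
\<close>

definition has_normal_derivative ::
  "(real ^ 3 \<Rightarrow> complex) \<Rightarrow> complex \<Rightarrow> real ^ 3 \<Rightarrow> bool" where
  "has_normal_derivative u d x \<longleftrightarrow>
     ((\<lambda>t. u (x + t *\<^sub>R x)) has_vector_derivative d) (at 0 within {-1..0})"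

text \<open>
  \<open>\<Lambda>\<^sub>\<gamma> f = g\<close> on the unit sphere. The Dirichlet problem must be solvable, and every
  solution must have conormal derivative \<open>g\<close>, so the relation is single-valued on the sphere.
\<close>

definition DN_map :: "(real ^ 3 \<Rightarrow> real) \<Rightarrow> (real ^ 3 \<Rightarrow> complex) \<Rightarrow> (real ^ 3 \<Rightarrow> complex) \<Rightarrow> bool" where
  "DN_map \<gamma> f g \<longleftrightarrow>
     (\<exists>u. dirichlet_solution \<gamma> f u) \<and>
     (\<forall>u. dirichlet_solution \<gamma> f u \<longrightarrow>
        (\<forall>x \<in> sphere 0 1. \<exists>d. has_normal_derivative u d x \<and> g x = of_real (\<gamma> x) * d))"

definition DN_eigenpair :: "(real ^ 3 \<Rightarrow> real) \<Rightarrow> real \<Rightarrow> (real ^ 3 \<Rightarrow> complex) \<Rightarrow> bool" where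
  "DN_eigenpair \<gamma> \<mu> f \<longleftrightarrow>
     (\<exists>x \<in> sphere 0 1. f x \<noteq> 0) \<and> DN_map \<gamma> f (\<lambda>x. of_real \<mu> * f x)"

section \<open>The recursion\<close>

definition beta :: "nat \<Rightarrow> real" where
  "beta l = (real l + 1) / real l"

definition w_coeff :: "(nat \<Rightarrow> real) \<Rightarrow> nat \<Rightarrow> nat \<Rightarrow> real" where
  "w_coeff r l j = r j powi (- (2 * int l + 1))"

text \<open>
  In layer \<open>j + 1\<close> the radial part of the solution is a multiple of
  \<open>C\<^sub>j s\<^sup>l + s\<^bsup>-(l+1)\<^esup>\<close>. The denominator \<open>\<gamma>\<^sub>j\<^sub>+\<^sub>1 \<rho>\<^sub>j - \<gamma>\<^sub>j\<close> may vanish (for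
  instance if \<open>\<gamma>\<^sub>1 = \<gamma>\<^sub>2\<close>): then the singular part is absent and \<open>C\<^sub>j = \<infinity>\<close>, which must not be
  replaced by the value \<open>0\<close> of a division by zero; correspondingly
  \<open>(C\<^sub>j + w)/(C\<^sub>j - \<beta>\<^sub>l w) = 1\<close> for \<open>C\<^sub>j = \<infinity>\<close>. The value \<open>C\<^sub>0 = \<infinity>\<close> (from \<open>r\<^sub>0 = 0\<close>)
  is used only for a ball with a single layer; \<open>\<rho>\<^sub>0\<close> is never used.
\<close>

fun rho_coeff :: "(nat \<Rightarrow> real) \<Rightarrow> (nat \<Rightarrow> real) \<Rightarrow> nat \<Rightarrow> nat \<Rightarrow> real"
  and C_coeff :: "(nat \<Rightarrow> real) \<Rightarrow> (nat \<Rightarrow> real) \<Rightarrow> nat \<Rightarrow> nat \<Rightarrow> ereal"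
where
  "rho_coeff r c l 0 = 1"
| "rho_coeff r c l (Suc 0) = 1"
| "rho_coeff r c l (Suc (Suc j)) =
     (case C_coeff r c l (Suc j) of
        ereal a \<Rightarrow> (a + w_coeff r l (Suc (Suc j))) / (a - beta l * w_coeff r l (Suc (Suc j)))
      | _ \<Rightarrow> 1)"
| "C_coeff r c l 0 = \<infinity>"
| "C_coeff r c l (Suc j) =
     (let \<rho> = rho_coeff r c l (Suc j) in
      if c (Suc (Suc j)) * \<rho> = c (Suc j) then \<infinity>
      else ereal (w_coeff r l (Suc j) *
             ((beta l * c (Suc (Suc j)) * \<rho> + c (Suc j)) / (c (Suc (Suc j)) * \<rho> - c (Suc j)))))"

text \<open>In \<^typ>\<open>ereal\<close> the fraction is \<open>0\<close> when \<open>C\<^bsub>N-1\<^esub> = \<infinity>\<close>.\<close>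

definition DN_eigenvalue :: "nat \<Rightarrow> (nat \<Rightarrow> real) \<Rightarrow> (nat \<Rightarrow> real) \<Rightarrow> nat \<Rightarrow> real" where
  "DN_eigenvalue N r c l =
     (if l = 0 then 0
      else real l - real_of_ereal (ereal (2 * real l + 1) / (1 + C_coeff r c l (N - 1))))"

end

theory Submission
  imports Defs
begin

text \<open>
  \<^bold>\<open>Existence.\<close> On the sphere a spherical harmonic is a linear combination of powers \<open>(a \<bullet> x)\<^sup>l\<close> with
  isotropic \<open>a \<in> \<complex>\<^sup>3\<close>, hence it has a homogeneous harmonic extension \<open>h\<close>. The solution is
  \<open>u(x) = Q(\<bar>x\<bar>) h(x)\<close> with \<open>Q(s) = A\<^sub>j + B\<^sub>j s\<^bsup>-(2l+1)\<^esup>\<close> in the \<open>j\<close>-th layer. Write \<open>\<kappa>(\<bar>x\<bar>) = \<gamma>(x)\<close> and let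
  \<open>P = \<kappa> (s Q' + l Q)\<close> be the flux. Both \<open>Q\<close> and \<open>P\<close> are Lipschitz, by the transmission conditions,
  and away from the interfaces \<open>s P' + (l + 1) P = l (l + 1) \<kappa> Q\<close>. Instead of Gauss' theorem on the layers,
  the weak equation uses two facts: the derivative of a compactly supported Lipschitz function along
  translations has integral zero, and so has, even after multiplication with a discontinuous radial function, the
  derivative of a smooth function along rotations. The first handles the radial and the second the tangential part of
  the gradient. The conormal derivative on the sphere is \<open>P(1) h\<close>, and \<open>A\<^sub>j, B\<^sub>j\<close> are related to the
  recursion by \<open>C\<^sub>j = A\<^sub>j\<^sub>+\<^sub>1 / B\<^sub>j\<^sub>+\<^sub>1\<close>.

  \<^bold>\<open>Uniqueness.\<close> The difference \<open>v\<close> of two solutions is continuous and vanishes on the sphere, so that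
  truncations of its mollifications are admissible test functions.
\<close>

section \<open>Integration by parts from invariance of Lebesgue measure\<close>

text \<open>\<open>DN_map\<close> quantifies over every solution, so one explicit solution does not
  determine it; uniqueness has to hold in the weak class of \<open>dirichlet_solution\<close>. There
  the difference of two solutions is only known to vanish pointwise on the sphere, not to be a limit
  of test functions; cutting it off at a level \<open>k > 0\<close> produces compact support inside
  the ball. For existence the obstacle is the jump of the conductivity. As a first order system for
  \<open>Q\<close> and \<open>P\<close> the radial equation puts every radial derivative on a
  Lipschitz function, and a jumping weight occurs only next to tangential derivatives, where it is
  constant along the rotations. Null vectors enter because the Laplacian of
  \<open>(a \<bullet> x) ^ l\<close> has the factor \<open>a \<bullet> a\<close>; gradient and
  Hessian of the extension are then available in closed form. Layers are described by pairs
  \<open>(a, b)\<close> rather than by their quotient, which is infinite in a layer without singular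
  part; positivity of value and flux keeps the denominators \<open>Fl\<close> (for
  \<open>l > 0\<close>) and \<open>D\<close> away from zero.\<close>

lemma integral_flow_derivative_zero:
  fixes f D :: "'a::euclidean_space \<Rightarrow> 'b::euclidean_space" and T :: "real \<Rightarrow> 'a \<Rightarrow> 'a"
  assumes f: "integrable lborel f"
    and T: "\<And>t. T t \<in> borel_measurable borel" "\<And>t. distr lborel borel (T t) = lborel"
    and w: "integrable lborel w"
    and bd: "\<And>t x. 0 < t \<Longrightarrow> t \<le> 1 \<Longrightarrow> norm (f (T t x) - f x) \<le> t * w x"
    and lim: "AE x in lborel. ((\<lambda>t. (f (T t x) - f x) /\<^sub>R t) \<longlongrightarrow> D x) (at_right 0)"
    and D: "D \<in> borel_measurable borel"
  shows "has_bochner_integral lborel D 0"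
proof -
  define s where "s n = 1 / real (Suc n)" for n
  have s: "0 < s n" "s n \<le> 1" for n
    by (auto simp: s_def)
  have s0: "filterlim s (at_right 0) sequentially"
    unfolding filterlim_at using s LIMSEQ_inverse_real_of_nat
    by (auto simp: s_def[abs_def] inverse_eq_divide)
  have fT: "integrable lborel (\<lambda>x. f (T t x))" "(LINT x|lborel. f (T t x)) = integral\<^sup>L lborel f" for t
    using f T(1)[of t] integrable_distr_eq[of "T t" lborel borel f]
      integral_distr[of "T t" lborel borel f]
    by (auto simp: T(2))
  have lim': "AE x in lborel. (\<lambda>n. (f (T (s n) x) - f x) /\<^sub>R s n) \<longlonglongrightarrow> D x"
    using lim by eventually_elim (rule filterlim_compose[OF _ s0])
  have bd': "AE x in lborel. norm ((f (T (s n) x) - f x) /\<^sub>R s n) \<le> w x" for n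
    using bd[OF s, of n] s(1)[of n]
    by (intro AE_I2) (simp add: inverse_eq_divide divide_le_eq mult.commute)
  have m: "(\<lambda>x. (f (T (s n) x) - f x) /\<^sub>R s n) \<in> borel_measurable lborel" for n
    by (intro borel_measurable_scaleR borel_measurable_diff borel_measurable_const
        borel_measurable_integrable[OF f] borel_measurable_integrable[OF fT(1)])
  have D': "D \<in> borel_measurable lborel" using D by simp
  have "integrable lborel D" "(\<lambda>n. LINT x|lborel. (f (T (s n) x) - f x) /\<^sub>R s n) \<longlonglongrightarrow> integral\<^sup>L lborel D"
    using integrable_dominated_convergence[OF D' m w lim' bd'] integral_dominated_convergence[OF D' m w lim' bd']
    by auto
  \<comment> \<open>Both terms of the quotient have the same integral, because
    \<open>T (s n)\<close> preserves Lebesgue measure; hence the limit has integral zero.\<close>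
  moreover have "(LINT x|lborel. (f (T (s n) x) - f x) /\<^sub>R s n) = 0" for n
    by (simp add: Bochner_Integration.integral_diff fT f)
  ultimately have "integrable lborel D" "(\<lambda>n. 0) \<longlonglongrightarrow> integral\<^sup>L lborel D"
    by (simp_all only:)
  then show ?thesis
    by (simp add: LIMSEQ_const_iff has_bochner_integral_iff)
qed

text \<open>The constant may depend on the radius: unlike global Lipschitz continuity this is stable
  under products, and for functions of bounded support it still dominates all difference
  quotients.\<close>

definition lipschitz_on_bounded :: "('a::real_normed_vector \<Rightarrow> 'b::real_normed_vector) \<Rightarrow> bool" where
  "lipschitz_on_bounded f \<longleftrightarrow> (\<forall>R. \<exists>L. L-lipschitz_on (cball 0 R) f)"

lemma lipschitz_on_boundedD:
  assumes "lipschitz_on_bounded f"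
  obtains L where "L \<ge> 0" "\<And>x y. norm x \<le> R \<Longrightarrow> norm y \<le> R \<Longrightarrow> norm (f x - f y) \<le> L * norm (x - y)"
proof -
  obtain L where "L-lipschitz_on (cball 0 R) f"
    using assms unfolding lipschitz_on_bounded_def by blast
  then show ?thesis
    by (intro that[of L]) (auto simp: lipschitz_on_def dist_norm)
qed

lemma lipschitz_on_boundedI:
  assumes "\<And>R. R > 0 \<Longrightarrow> \<exists>L. \<forall>x y. norm x \<le> R \<longrightarrow> norm y \<le> R \<longrightarrow> norm (f x - f y) \<le> L * norm (x - y)"
  shows "lipschitz_on_bounded f"
  unfolding lipschitz_on_bounded_def
proof
  fix R :: real
  obtain L where L: "\<And>x y. norm x \<le> max R 1 \<Longrightarrow> norm y \<le> max R 1 \<Longrightarrow> norm (f x - f y) \<le> L * norm (x - y)"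
    using assms[of "max R 1"] less_max_iff_disj[of 0 R 1] zero_less_one by blast
  have "norm (f x - f y) \<le> max L 0 * norm (x - y)" if "norm x \<le> R" "norm y \<le> R" for x y
    using L[of x y] that by (smt (verit, best) mult_right_mono norm_ge_zero)
  then show "\<exists>L. L-lipschitz_on (cball 0 R) f"
    by (intro exI[of _ "max L 0"]) (auto simp: lipschitz_on_def dist_norm)
qed

lemma lipschitz_on_bounded_bound:
  assumes "lipschitz_on_bounded f"
  obtains B where "B > 0" "\<And>x. norm x \<le> R \<Longrightarrow> norm (f x) \<le> B"
proof -
  obtain L where L: "L \<ge> 0" "\<And>x y. norm x \<le> max R 0 \<Longrightarrow> norm y \<le> max R 0 \<Longrightarrow> norm (f x - f y) \<le> L * norm (x - y)"
    using lipschitz_on_boundedD[OF assms] by blast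
  show ?thesis
  proof (rule that[of "norm (f 0) + L * max R 0 + 1"])
    show "norm (f 0) + L * max R 0 + 1 > 0"
      using L(1) by (smt (verit) mult_nonneg_nonneg norm_ge_zero max.cobounded2)
    fix x :: 'a assume x: "norm x \<le> R"
    have "norm (f x) \<le> norm (f 0) + norm (f x - f 0)"
      by (simp add: norm_triangle_sub)
    also have "norm (f x - f 0) \<le> L * norm (x - 0)"
      using x by (intro L(2)) auto
    also have "L * norm (x - 0) \<le> L * max R 0"
      using L(1) x by (intro mult_left_mono) auto
    finally show "norm (f x) \<le> norm (f 0) + L * max R 0 + 1"
      by simp
  qed
qed

lemma lipschitz_on_bounded_continuous:
  assumes "lipschitz_on_bounded f"
  shows "continuous_on UNIV f"
proof -
  have "isCont f x" for x
  proof -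
    obtain L where "L-lipschitz_on (cball 0 (norm x + 1)) f"
      using assms unfolding lipschitz_on_bounded_def by blast
    then have "continuous_on (cball 0 (norm x + 1)) f"
      by (rule lipschitz_on_continuous_on)
    then have "continuous_on (ball 0 (norm x + 1)) f"
      by (rule continuous_on_subset) auto
    then show ?thesis
      by (simp add: continuous_on_eq_continuous_at)
  qed
  then show ?thesis
    by (simp add: continuous_at_imp_continuous_on)
qed

lemma lipschitz_on_bounded_const: "lipschitz_on_bounded (\<lambda>x. c)"
  by (rule lipschitz_on_boundedI) (auto intro: exI[of _ 0])

lemma lipschitz_on_bounded_add:
  assumes "lipschitz_on_bounded f" "lipschitz_on_bounded g"
  shows "lipschitz_on_bounded (\<lambda>x. f x + g x)"
  using assms unfolding lipschitz_on_bounded_def by (blast intro: lipschitz_on_add)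

lemma lipschitz_on_bounded_diff:
  assumes "lipschitz_on_bounded f" "lipschitz_on_bounded g"
  shows "lipschitz_on_bounded (\<lambda>x. f x - g x)"
  using assms unfolding lipschitz_on_bounded_def by (blast intro: lipschitz_on_diff)

lemma lipschitz_on_bounded_bilinear:
  assumes "bounded_bilinear pr" "lipschitz_on_bounded f" "lipschitz_on_bounded g"
  shows "lipschitz_on_bounded (\<lambda>x. pr (f x) (g x))"
proof (rule lipschitz_on_boundedI)
  fix R :: real
  obtain K where K: "K > 0" "\<And>a b. norm (pr a b) \<le> norm a * norm b * K"
    using bounded_bilinear.pos_bounded[OF assms(1)] by blast
  obtain Lf where Lf: "Lf \<ge> 0" "\<And>x y. norm x \<le> R \<Longrightarrow> norm y \<le> R \<Longrightarrow> norm (f x - f y) \<le> Lf * norm (x - y)"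
    using lipschitz_on_boundedD[OF assms(2)] by blast
  obtain Lg where Lg: "Lg \<ge> 0" "\<And>x y. norm x \<le> R \<Longrightarrow> norm y \<le> R \<Longrightarrow> norm (g x - g y) \<le> Lg * norm (x - y)"
    using lipschitz_on_boundedD[OF assms(3)] by blast
  obtain Bf where Bf: "Bf > 0" "\<And>x. norm x \<le> R \<Longrightarrow> norm (f x) \<le> Bf"
    using lipschitz_on_bounded_bound[OF assms(2)] by blast
  obtain Bg where Bg: "Bg > 0" "\<And>x. norm x \<le> R \<Longrightarrow> norm (g x) \<le> Bg"
    using lipschitz_on_bounded_bound[OF assms(3)] by blast
  have "norm (pr (f x) (g x) - pr (f y) (g y)) \<le> ((Lf * Bg + Bf * Lg) * K) * norm (x - y)"
    if xy: "norm x \<le> R" "norm y \<le> R" for x y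
  proof -
    have "pr (f x) (g x) - pr (f y) (g y) = pr (f x - f y) (g x) + pr (f y) (g x - g y)"
      by (simp add: bounded_bilinear.diff_left[OF assms(1)] bounded_bilinear.diff_right[OF assms(1)])
    also have "norm \<dots> \<le> norm (f x - f y) * norm (g x) * K + norm (f y) * norm (g x - g y) * K"
      by (rule norm_triangle_le) (intro add_mono K(2))
    also have "\<dots> \<le> (Lf * norm (x - y)) * Bg * K + Bf * (Lg * norm (x - y)) * K"
      using xy K(1) Lf Lg Bf Bg
      by (intro add_mono mult_right_mono mult_mono) (auto simp: less_imp_le)
    finally show ?thesis
      by (simp add: algebra_simps)
  qed
  then show "\<exists>L. \<forall>x y. norm x \<le> R \<longrightarrow> norm y \<le> R \<longrightarrow> norm (pr (f x) (g x) - pr (f y) (g y)) \<le> L * norm (x - y)"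
    by blast
qed

lemmas lipschitz_on_bounded_mult = lipschitz_on_bounded_bilinear[OF bounded_bilinear_mult]

lemma lipschitz_on_bounded_linear:
  assumes "bounded_linear T" "lipschitz_on_bounded f"
  shows "lipschitz_on_bounded (\<lambda>x. T (f x))"
proof (rule lipschitz_on_boundedI)
  fix R :: real
  obtain K where K: "K > 0" "\<And>a. norm (T a) \<le> norm a * K"
    using bounded_linear.pos_bounded[OF assms(1)] by blast
  obtain L where L: "L \<ge> 0" "\<And>x y. norm x \<le> R \<Longrightarrow> norm y \<le> R \<Longrightarrow> norm (f x - f y) \<le> L * norm (x - y)"
    using lipschitz_on_boundedD[OF assms(2)] by blast
  have "norm (T (f x) - T (f y)) \<le> (L * K) * norm (x - y)" if "norm x \<le> R" "norm y \<le> R" for x y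
  proof -
    have "norm (T (f x) - T (f y)) \<le> norm (f x - f y) * K"
      using K(2)[of "f x - f y"] by (simp add: bounded_linear.linear[OF assms(1)] linear_diff)
    also have "\<dots> \<le> L * norm (x - y) * K"
      using K(1) L(2)[OF that] by (intro mult_right_mono) auto
    finally show ?thesis by (simp add: mult_ac)
  qed
  then show "\<exists>L. \<forall>x y. norm x \<le> R \<longrightarrow> norm y \<le> R \<longrightarrow> norm (T (f x) - T (f y)) \<le> L * norm (x - y)"
    by blast
qed

lemma lipschitz_on_bounded_compose:
  assumes "lipschitz_on_bounded f" "lipschitz_on_bounded g"
  shows "lipschitz_on_bounded (\<lambda>x. g (f x))"
proof (rule lipschitz_on_boundedI)
  fix R :: real
  obtain Lf where Lf: "Lf \<ge> 0" "\<And>x y. norm x \<le> R \<Longrightarrow> norm y \<le> R \<Longrightarrow> norm (f x - f y) \<le> Lf * norm (x - y)"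
    using lipschitz_on_boundedD[OF assms(1)] by blast
  obtain Bf where Bf: "Bf > 0" "\<And>x. norm x \<le> R \<Longrightarrow> norm (f x) \<le> Bf"
    using lipschitz_on_bounded_bound[OF assms(1)] by blast
  obtain Lg where Lg: "Lg \<ge> 0" "\<And>x y. norm x \<le> Bf \<Longrightarrow> norm y \<le> Bf \<Longrightarrow> norm (g x - g y) \<le> Lg * norm (x - y)"
    using lipschitz_on_boundedD[OF assms(2)] by blast
  have "norm (g (f x) - g (f y)) \<le> (Lg * Lf) * norm (x - y)" if xy: "norm x \<le> R" "norm y \<le> R" for x y
  proof -
    have "norm (g (f x) - g (f y)) \<le> Lg * norm (f x - f y)"
      using xy Bf by (intro Lg) auto
    also have "\<dots> \<le> Lg * (Lf * norm (x - y))"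
      using xy Lf Lg by (intro mult_left_mono) auto
    finally show ?thesis by simp
  qed
  then show "\<exists>L. \<forall>x y. norm x \<le> R \<longrightarrow> norm y \<le> R \<longrightarrow> norm (g (f x) - g (f y)) \<le> L * norm (x - y)"
    by blast
qed

lemma lipschitz_on_bounded_id: "lipschitz_on_bounded (\<lambda>x. x)"
  by (rule lipschitz_on_boundedI) (auto intro: exI[of _ 1])

lemma lipschitz_on_bounded_norm: "lipschitz_on_bounded norm"
  by (rule lipschitz_on_boundedI) (auto intro!: exI[of _ 1] simp: norm_triangle_ineq3)

lemma lipschitz_on_bounded_nth: "lipschitz_on_bounded (\<lambda>x::real^'n. x $ i)"
  by (rule lipschitz_on_bounded_linear[OF bounded_linear_vec_nth lipschitz_on_bounded_id])

lemma lipschitz_on_bounded_of_real: 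
  assumes "lipschitz_on_bounded f" shows "lipschitz_on_bounded (\<lambda>x. of_real (f x) :: complex)"
  by (rule lipschitz_on_bounded_linear[OF bounded_linear_of_real assms])

lemma lipschitz_on_bounded_power:
  fixes f :: "'a::real_normed_vector \<Rightarrow> 'b::real_normed_algebra_1"
  assumes "lipschitz_on_bounded f" shows "lipschitz_on_bounded (\<lambda>x. f x ^ n)"
  by (induction n) (auto intro!: lipschitz_on_bounded_const lipschitz_on_bounded_mult assms)

lemma lipschitz_on_bounded_C1:
  fixes f :: "'a::euclidean_space \<Rightarrow> 'b::real_normed_vector"
  assumes f: "\<And>x. (f has_derivative f' x) (at x)" and bd: "\<And>x v. norm (f' x v) \<le> B x * norm v"
    and B: "continuous_on UNIV B"
  shows "lipschitz_on_bounded f"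
proof (rule lipschitz_on_boundedI)
  fix R :: real assume R: "R > 0"
  have "compact (B ` cball 0 R)"
    by (intro compact_continuous_image continuous_on_subset[OF B]) auto
  then obtain M where M: "\<And>x. norm x \<le> R \<Longrightarrow> B x \<le> M"
  proof -
    have "bdd_above (B ` cball 0 R)"
      by (rule bounded_imp_bdd_above[OF compact_imp_bounded[OF \<open>compact (B ` cball 0 R)\<close>]])
    then show ?thesis
      using that unfolding bdd_above_def by (meson imageI mem_cball_0)
  qed
  have "norm (f x - f y) \<le> M * norm (x - y)" if xy: "norm x \<le> R" "norm y \<le> R" for x y
  proof (rule differentiable_bound[of "cball 0 R" f f' M])
    fix z :: 'a assume z: "z \<in> cball 0 R"
    show "(f has_derivative f' z) (at z within cball 0 R)"
      using f has_derivative_at_withinI by blast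
    have "B z \<le> M" using M z by auto
    then have "norm (f' z v) \<le> M * norm v" for v
      using bd[of z v] by (meson mult_right_mono norm_ge_zero order_trans)
    then show "onorm (f' z) \<le> M"
      by (rule onorm_le)
  qed (use xy in auto)
  then show "\<exists>L. \<forall>x y. norm x \<le> R \<longrightarrow> norm y \<le> R \<longrightarrow> norm (f x - f y) \<le> L * norm (x - y)"
    by blast
qed

lemma lipschitz_on_bounded_GDERIV:
  fixes f :: "'a::euclidean_space \<Rightarrow> real"
  assumes f: "\<And>x. GDERIV f x :> d x" and d: "continuous_on UNIV d"
  shows "lipschitz_on_bounded f"
proof (rule lipschitz_on_bounded_C1)
  show "(f has_derivative (\<lambda>v. v \<bullet> d x)) (at x)" for x
    using f[of x] by (simp add: gderiv_def)
  show "norm (v \<bullet> d x) \<le> norm (d x) * norm v" for x v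
    using Cauchy_Schwarz_ineq2[of v "d x"] by (simp add: mult.commute)
  show "continuous_on UNIV (\<lambda>x. norm (d x))"
    by (intro continuous_intros d)
qed

lemma integrable_lipschitz_bounded_support:
  fixes f :: "'a::euclidean_space \<Rightarrow> 'b::euclidean_space"
  assumes f: "lipschitz_on_bounded f" and supp: "\<And>x. norm x > R \<Longrightarrow> f x = 0"
  shows "integrable lborel f"
proof -
  have "set_integrable lborel (cball 0 R) f"
    unfolding set_integrable_def
    by (intro borel_integrable_compact continuous_on_subset[OF lipschitz_on_bounded_continuous[OF f]]) auto
  moreover have "(\<lambda>x. indicat_real (cball 0 R) x *\<^sub>R f x) = f"
    using supp by (auto simp: indicator_def fun_eq_iff not_le)
  ultimately show ?thesis
    by (simp add: set_integrable_def)
qed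

lemma integrable_indicator_cball:
  "integrable lborel (\<lambda>x. c * indicat_real (cball (0::'a::euclidean_space) R) x)"
  using emeasure_lborel_cball_finite[of "0::'a" R] by (simp add: less_top)

lemma has_vector_derivative_imp_right_limit:
  assumes "(g has_vector_derivative d) (at 0)"
  shows "((\<lambda>t. (g t - g 0) /\<^sub>R t) \<longlongrightarrow> d) (at_right 0)"
proof -
  have "(g has_vector_derivative d) (at 0 within {0<..})"
    using assms by (rule has_vector_derivative_at_within)
  then have *: "((\<lambda>y. (1 / norm (y - 0)) *\<^sub>R (g y - (g 0 + (y - 0) *\<^sub>R d))) \<longlongrightarrow> 0) (at_right 0)"
    unfolding has_vector_derivative_def has_derivative_within by blast
  have "((\<lambda>t. (g t - g 0) /\<^sub>R t - d) \<longlongrightarrow> 0) (at_right 0)"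
  proof (rule Lim_transform_eventually[OF *])
    show "\<forall>\<^sub>F y in at_right 0. (1 / norm (y - 0)) *\<^sub>R (g y - (g 0 + (y - 0) *\<^sub>R d)) = (g y - g 0) /\<^sub>R y - d"
      by (auto simp: eventually_at_filter inverse_eq_divide algebra_simps)
  qed
  then show ?thesis by (simp add: LIM_zero_iff)
qed

text \<open>Translations as the flow. An almost everywhere derivative admits functions with corners
  on the interfaces; the Lipschitz constant supplies the dominating function.\<close>

lemma integral_directional_derivative_zero:
  fixes f D :: "'a::euclidean_space \<Rightarrow> 'b::euclidean_space"
  assumes f: "lipschitz_on_bounded f" and supp: "\<And>x. norm x > R \<Longrightarrow> f x = 0"
    and der: "AE x in lborel. ((\<lambda>t. f (x + t *\<^sub>R e)) has_vector_derivative D x) (at 0)"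
    and D: "D \<in> borel_measurable borel"
  shows "has_bochner_integral lborel D 0"
proof -
  \<comment> \<open>Shifts by \<open>t *\<^sub>R e\<close> with \<open>t \<le> 1\<close> move a
    point by at most \<open>norm e\<close>, so outside this radius both values in the quotient
    vanish.\<close>
  define S where "S = \<bar>R\<bar> + norm e"
  obtain L where L: "L \<ge> 0" "\<And>x y. norm x \<le> S + norm e \<Longrightarrow> norm y \<le> S + norm e \<Longrightarrow> norm (f x - f y) \<le> L * norm (x - y)"
    using lipschitz_on_boundedD[OF f] by blast
  show ?thesis
  proof (rule integral_flow_derivative_zero[where T = "\<lambda>t x. t *\<^sub>R e + x"
        and w = "\<lambda>x. (L * norm e) * indicat_real (cball 0 S) x", OF _ _ lborel_distr_plus
          integrable_indicator_cball _ _ D])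
    show "integrable lborel f"
      using f supp by (rule integrable_lipschitz_bounded_support)
    show "(+) (t *\<^sub>R e) \<in> borel_measurable borel" for t
      by simp
    fix t :: real and x :: 'a assume t: "0 < t" "t \<le> 1"
    have te: "norm (t *\<^sub>R e) \<le> norm e"
      using t by (simp add: mult_left_le_one_le)
    show "norm (f (t *\<^sub>R e + x) - f x) \<le> t * ((L * norm e) * indicat_real (cball 0 S) x)"
    proof (cases "norm x \<le> S")
      case True
      have "norm (f (t *\<^sub>R e + x) - f x) \<le> L * norm (t *\<^sub>R e + x - x)"
        using True te norm_triangle_ineq[of "t *\<^sub>R e" x] norm_ge_zero[of e]
        by (intro L(2)) linarith+
      then show ?thesis
        using True t by (simp add: mult_ac)
    next
      case False
      have "norm x \<le> norm (t *\<^sub>R e + x) + norm (t *\<^sub>R e)"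
        by (metis add_diff_cancel_left' norm_triangle_ineq4 add.commute)
      then have "R < norm (t *\<^sub>R e + x)" "R < norm x"
        using False te abs_ge_self[of R] norm_ge_zero[of e] unfolding S_def by linarith+
      then show ?thesis
        using False by (simp add: supp)
    qed
  next
    show "AE x in lborel. ((\<lambda>t. (f (t *\<^sub>R e + x) - f x) /\<^sub>R t) \<longlongrightarrow> D x) (at_right 0)"
      using der
    proof eventually_elim
      case (elim x)
      then show ?case
        using has_vector_derivative_imp_right_limit by (fastforce simp: add.commute)
      qed
  qed
qed

section \<open>Rotations in coordinate planes\<close>

lemma distr_lborel_orthogonal_transformation:
  fixes f :: "real^'n::{finite,wellorder} \<Rightarrow> real^'n::{finite,wellorder}"
  assumes f: "orthogonal_transformation f"
  shows "distr lborel borel f = lborel"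
proof (rule sym, rule lborel_eqI)
  have "linear f"
    using f by (rule orthogonal_transformation_linear)
  then have fm: "f \<in> borel_measurable borel"
    by (intro borel_measurable_continuous_onI linear_continuous_on linear_conv_bounded_linear[THEN iffD1])
  show "sets (distr lborel borel f) = sets borel" by simp
  fix l u :: "real^'n::_" assume lu: "\<And>b. b \<in> Basis \<Longrightarrow> l \<bullet> b \<le> u \<bullet> b"
  have inv: "orthogonal_transformation (inv f)"
    using f by (rule orthogonal_transformation_inv)
  \<comment> \<open>The preimage of a box is an image under the inverse, which is again orthogonal,
    so the invariance of measure for images applies.\<close>
  have vim: "f -` box l u = inv f ` box l u"
    using orthogonal_transformation_bij[OF f] by (rule bij_vimage_eq_inv_image)
  have lm: "box l u \<in> lmeasurable" by simp
  have "emeasure (distr lborel borel f) (box l u) = emeasure lborel (f -` box l u)"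
    using fm by (subst emeasure_distr) auto
  also have "\<dots> = emeasure lebesgue (inv f ` box l u)"
    using fm by (subst vim[symmetric], subst emeasure_completion) (auto simp: measurable_sets_borel)
  also have "\<dots> = ennreal (measure lebesgue (inv f ` box l u))"
    using measurable_orthogonal_image[OF inv lm] by (simp add: emeasure_eq_measure2)
  also have "\<dots> = ennreal (measure lebesgue (box l u))"
    using measure_orthogonal_image[OF inv lm] by simp
  also have "\<dots> = ennreal (\<Prod>b\<in>Basis. (u - l) \<bullet> b)"
    using lu by (simp add: measure_lborel_box_eq)
  finally show "emeasure (distr lborel borel f) (box l u) = ennreal (\<Prod>b\<in>Basis. (u - l) \<bullet> b)" .
qed

text \<open>The rotation by the angle \<open>t\<close> in the plane of the coordinates
  \<open>i\<close> and \<open>j\<close>, written as the identity plus a correction so that the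
  displacement and the velocity \<open>axis j (x $ i) - axis i (x $ j)\<close> at
  \<open>t = 0\<close> are visible.\<close>

definition plane_rotation :: "'n \<Rightarrow> 'n \<Rightarrow> real \<Rightarrow> real^'n \<Rightarrow> real^'n::finite" where
  "plane_rotation i j t x = x + (cos t - 1) *\<^sub>R (axis i (x $ i) + axis j (x $ j))
     + sin t *\<^sub>R (axis j (x $ i) - axis i (x $ j))"

lemma orthogonal_plane_rotation:
  assumes "i \<noteq> j"
  shows "orthogonal_transformation (plane_rotation i j t)"
proof -
  have "linear (plane_rotation i j t)"
    by (rule linearI) (auto simp: plane_rotation_def vec_eq_iff axis_def algebra_simps)
  moreover have "plane_rotation i j t v \<bullet> plane_rotation i j t w = v \<bullet> w" for v w
  proof -
    have ax: "axis k b $ m = (if m = k then b else 0)" for k m :: 'a and b :: real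
      by (simp add: axis_def)
    have sc: "sin t * sin t = 1 - cos t * cos t"
      using sin_cos_squared_add[of t] by (simp add: power2_eq_square)
    have cc: "cos t * (cos t * z) = z - sin t * (sin t * z)" for z
      using arg_cong[OF sc, of "\<lambda>u. u * z"] by (simp add: left_diff_distrib mult.assoc)
    have "plane_rotation i j t v \<bullet> plane_rotation i j t w =
        v \<bullet> w + (cos t * cos t + sin t * sin t - 1) * (v $ i * w $ i + v $ j * w $ j)"
      using assms by (simp add: plane_rotation_def inner_add_left inner_add_right inner_diff_left
          inner_diff_right inner_axis inner_axis' ax) (simp add: algebra_simps cc)
    then show ?thesis by (simp add: sc)
  qed
  ultimately show ?thesis
    by (simp add: orthogonal_transformation_def)
qed

text \<open>Both coefficients \<open>cos t - 1\<close> and \<open>sin t\<close> are at most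
  \<open>t\<close> in absolute value, and each multiplies a sum or difference of two vectors of
  length at most \<open>norm x\<close>; this gives the factor 4.\<close>

lemma norm_plane_rotation_diff_le:
  assumes "0 \<le> t" "t \<le> 1"
  shows "norm (plane_rotation i j t x - x) \<le> 4 * t * norm x"
proof -
  have "1 - cos t = 2 * (sin (t / 2))\<^sup>2"
    using cos_double_sin[of "t / 2"] by simp
  also have "(sin (t / 2))\<^sup>2 \<le> (t / 2)\<^sup>2"
    using abs_sin_x_le_abs_x[of "t / 2"] unfolding abs_le_square_iff .
  also have "2 * (t / 2)\<^sup>2 \<le> t"
    using assms mult_left_mono[of t 2 t] by (simp add: power2_eq_square)
  finally have c: "\<bar>cos t - 1\<bar> \<le> t" by simp
  have s: "\<bar>sin t\<bar> \<le> t" using assms abs_sin_x_le_abs_x[of t] by simp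
  have a: "norm (axis k (x $ m) :: real^'a) \<le> norm x" for k m
  proof -
    have "norm (axis k (x $ m) :: real^'a) = \<bar>x $ m\<bar>"
      by (simp add: norm_eq_sqrt_inner inner_axis_axis)
    then show ?thesis
      using component_le_norm_cart[of x m] by simp
  qed
  have "norm (plane_rotation i j t x - x) \<le>
      \<bar>cos t - 1\<bar> * norm (axis i (x $ i) + axis j (x $ j) :: real^'a) + \<bar>sin t\<bar> * norm (axis j (x $ i) - axis i (x $ j) :: real^'a)"
    unfolding plane_rotation_def by (smt (verit) norm_scaleR norm_triangle_ineq add.assoc add_diff_cancel_left')
  also have "\<dots> \<le> t * (norm x + norm x) + t * (norm x + norm x)"
    using c s a[of i i] a[of j j] a[of j i] a[of i j]
    by (intro add_mono mult_mono order_trans[OF norm_triangle_ineq] order_trans[OF norm_triangle_ineq4]) auto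
  finally show ?thesis by simp
qed

text \<open>Rotations preserve \<open>norm x\<close>, so \<open>k (norm x)\<close> is constant along
  the flow, comes out of every difference quotient and is never differentiated. This is how jumps of
  the conductivity are tolerated.\<close>

lemma integral_rotation_derivative_zero:
  fixes \<psi> :: "real^'n::{finite,wellorder} \<Rightarrow> 'b::euclidean_space"
  assumes ij: "i \<noteq> j" and \<psi>: "lipschitz_on_bounded \<psi>" and supp: "\<And>x. norm x > R \<Longrightarrow> \<psi> x = 0"
    and der: "\<And>x. (\<psi> has_derivative \<psi>' x) (at x)"
    and k: "k \<in> borel_measurable borel" "\<And>s. \<bar>k s\<bar> \<le> B"
    and meas: "(\<lambda>x. \<psi>' x (axis j (x $ i) - axis i (x $ j))) \<in> borel_measurable borel"
  shows "has_bochner_integral lborel (\<lambda>x. k (norm x) *\<^sub>R \<psi>' x (axis j (x $ i) - axis i (x $ j))) 0"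
proof -
  have nT: "norm (plane_rotation i j t x) = norm x" for t x
    by (rule orthogonal_transformation_norm[OF orthogonal_plane_rotation[OF ij]])
  obtain L where L: "L \<ge> 0" "\<And>x y. norm x \<le> R \<Longrightarrow> norm y \<le> R \<Longrightarrow> norm (\<psi> x - \<psi> y) \<le> L * norm (x - y)"
    using lipschitz_on_boundedD[OF \<psi>] by blast
  have B: "B \<ge> 0" using k(2)[of 0] by simp
  have km: "(\<lambda>x::real^'n::_. k (norm x)) \<in> borel_measurable borel"
    using k(1) by measurable
  show ?thesis
  proof (rule integral_flow_derivative_zero[where T = "plane_rotation i j" and
        f = "\<lambda>x. k (norm x) *\<^sub>R \<psi> x" and
        w = "\<lambda>x. (B * (L * (4 * R))) * indicat_real (cball 0 R) x", OF _ _ _ integrable_indicator_cball])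
    show "integrable lborel (\<lambda>x. k (norm x) *\<^sub>R \<psi> x)"
    proof (rule Bochner_Integration.integrable_bound[where f = "\<lambda>x. B *\<^sub>R \<psi> x"])
      have ii: "integrable lborel \<psi>"
        using \<psi> supp by (rule integrable_lipschitz_bounded_support)
      then show "integrable lborel (\<lambda>x. B *\<^sub>R \<psi> x)" by simp
      show "(\<lambda>x. k (norm x) *\<^sub>R \<psi> x) \<in> borel_measurable lborel"
        using km borel_measurable_integrable[OF ii] by simp
      show "AE x in lborel. norm (k (norm x) *\<^sub>R \<psi> x) \<le> norm (B *\<^sub>R \<psi> x)"
        using k(2) B by (auto intro!: mult_right_mono)
    qed
    show "plane_rotation i j t \<in> borel_measurable borel" for t
      by (intro borel_measurable_continuous_onI linear_continuous_on linear_conv_bounded_linear[THEN iffD1]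
          orthogonal_transformation_linear[OF orthogonal_plane_rotation[OF ij]])
    show "distr lborel borel (plane_rotation i j t) = lborel" for t
      by (rule distr_lborel_orthogonal_transformation[OF orthogonal_plane_rotation[OF ij]])
    fix t :: real and x :: "real^'n::_" assume t: "0 < t" "t \<le> 1"
    show "norm (k (norm (plane_rotation i j t x)) *\<^sub>R \<psi> (plane_rotation i j t x) - k (norm x) *\<^sub>R \<psi> x)
      \<le> t * (B * (L * (4 * R)) * indicat_real (cball 0 R) x)"
    proof (cases "norm x \<le> R")
      case True
      have "norm (\<psi> (plane_rotation i j t x) - \<psi> x) \<le> L * norm (plane_rotation i j t x - x)"
        using True by (intro L(2)) (auto simp: nT)
      also have "\<dots> \<le> L * (4 * t * R)"
        using True t L(1) by (intro mult_left_mono order_trans[OF norm_plane_rotation_diff_le]) auto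
      finally have "\<bar>k (norm x)\<bar> * norm (\<psi> (plane_rotation i j t x) - \<psi> x) \<le> B * (L * (4 * t * R))"
        using B k(2) by (intro mult_mono) auto
      then show ?thesis
        using True by (simp add: nT flip: scaleR_diff_right) (simp add: mult_ac)
    next
      case False
      then show ?thesis by (simp add: supp nT)
    qed
  next
    show "AE x in lborel. ((\<lambda>t. (k (norm (plane_rotation i j t x)) *\<^sub>R \<psi> (plane_rotation i j t x) - k (norm x) *\<^sub>R \<psi> x) /\<^sub>R t)
        \<longlongrightarrow> k (norm x) *\<^sub>R \<psi>' x (axis j (x $ i) - axis i (x $ j))) (at_right 0)"
    proof (rule AE_I2)
      fix x :: "real^'n::_"
      have T0: "plane_rotation i j 0 x = x" by (simp add: plane_rotation_def)
      have "((\<lambda>t. plane_rotation i j t x) has_vector_derivative (axis j (x $ i) - axis i (x $ j))) (at 0)"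
        unfolding plane_rotation_def
        by (auto intro!: derivative_eq_intros simp: has_vector_derivative_def)
      then have "((\<lambda>t. \<psi> (plane_rotation i j t x)) has_derivative (\<lambda>t. \<psi>' x (t *\<^sub>R (axis j (x $ i) - axis i (x $ j))))) (at 0)"
        using der[of x] T0 unfolding has_vector_derivative_def
        by (intro has_derivative_compose[where f = "\<lambda>t. plane_rotation i j t x" and g = \<psi>]) auto
      then have "((\<lambda>t. \<psi> (plane_rotation i j t x)) has_vector_derivative \<psi>' x (axis j (x $ i) - axis i (x $ j))) (at 0)"
        using der[of x] by (simp add: has_vector_derivative_def has_derivative_bounded_linear linear_simps)
      then have "((\<lambda>t. (\<psi> (plane_rotation i j t x) - \<psi> x) /\<^sub>R t) \<longlongrightarrow> \<psi>' x (axis j (x $ i) - axis i (x $ j))) (at_right 0)"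
        by (auto dest!: has_vector_derivative_imp_right_limit simp: T0)
      from tendsto_scaleR[OF tendsto_const[of "k (norm x)"] this]
      show "((\<lambda>t. (k (norm (plane_rotation i j t x)) *\<^sub>R \<psi> (plane_rotation i j t x) - k (norm x) *\<^sub>R \<psi> x) /\<^sub>R t)
        \<longlongrightarrow> k (norm x) *\<^sub>R \<psi>' x (axis j (x $ i) - axis i (x $ j))) (at_right 0)"
        by (simp add: nT scaleR_diff_right mult.commute)
    qed
    show "(\<lambda>x. k (norm x) *\<^sub>R \<psi>' x (axis j (x $ i) - axis i (x $ j))) \<in> borel_measurable borel"
      using km meas by simp
  qed
qed

section \<open>Mollification\<close>

text \<open>Squaring removes the corner of the positive part at 0. The function serves both as the
  shape of the mollifier and as the truncation in the uniqueness proof.\<close>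

lemma has_real_derivative_pos_part_square:
  "((\<lambda>s::real. (max 0 s)\<^sup>2) has_real_derivative 2 * max 0 s) (at s)"
proof -
  consider "s > 0" | "s < 0" | "s = 0" by linarith
  then show ?thesis
  proof cases
    case 1
    have "((\<lambda>s::real. s\<^sup>2) has_real_derivative 2 * max 0 s) (at s)"
      using 1 by (auto intro!: derivative_eq_intros)
    then show ?thesis
      by (rule DERIV_cong_ev[THEN iffD1, rotated -1])
        (use 1 in \<open>auto intro!: eventually_mono[OF eventually_gt_at_top] eventually_mono[OF order_tendstoD(1)[OF tendsto_ident_at[of s UNIV]]] simp: eventually_nhds intro: exI[of _ "{0<..}"]\<close>)
  next
    case 2
    have "((\<lambda>s::real. 0) has_real_derivative 2 * max 0 s) (at s)"
      using 2 by (auto intro!: derivative_eq_intros)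
    then show ?thesis
      by (rule DERIV_cong_ev[THEN iffD1, rotated -1])
        (use 2 in \<open>auto simp: eventually_nhds intro!: exI[of _ "{..<0}"]\<close>)
  next
    case 3
    have "((\<lambda>h. ((max 0 (s + h))\<^sup>2 - (max 0 s)\<^sup>2) / h) \<longlongrightarrow> 0) (at 0)"
    proof (rule Lim_null_comparison)
      show "\<forall>\<^sub>F h in at 0. norm (((max 0 (s + h))\<^sup>2 - (max 0 s)\<^sup>2) / h) \<le> \<bar>h\<bar>"
        using 3 by (intro always_eventually) (auto simp: max_def power2_eq_square)
      show "((\<lambda>h::real. \<bar>h\<bar>) \<longlongrightarrow> 0) (at 0)"
        by (auto intro!: tendsto_eq_intros)
    qed
    then show ?thesis
      using 3 by (simp add: DERIV_def)
  qed
qed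

text \<open>A polynomial profile that is just \<open>C^1\<close> at the edge of its support, which
  is the regularity demanded of test functions.\<close>

definition bump :: "real \<Rightarrow> 'a::euclidean_space \<Rightarrow> real" where
  "bump e z = (max 0 (e\<^sup>2 - z \<bullet> z))\<^sup>2"

definition mollifier :: "real \<Rightarrow> 'a::euclidean_space \<Rightarrow> real" where
  "mollifier e z = bump e z / (LINT y|lborel. bump e (y::'a))"

definition grad_mollifier :: "real \<Rightarrow> 'a::euclidean_space \<Rightarrow> 'a" where
  "grad_mollifier e z = (- 4 * max 0 (e\<^sup>2 - z \<bullet> z) / (LINT y|lborel. bump e (y::'a))) *\<^sub>R z"

lemma continuous_bump: "continuous_on UNIV (bump e)"
  unfolding bump_def by (intro continuous_intros)

lemma bump_eq_0: "0 < e \<Longrightarrow> e \<le> norm z \<Longrightarrow> bump e z = 0"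
  using power_mono[of e "norm z" 2] by (simp add: bump_def power2_norm_eq_inner)

lemma bump_pos: "norm z < e \<Longrightarrow> 0 < bump e z"
  using power_strict_mono[of "norm z" e 2] by (simp add: bump_def power2_norm_eq_inner)

lemma integrable_continuous_bounded_support:
  fixes f :: "'a::euclidean_space \<Rightarrow> 'b::euclidean_space"
  assumes f: "continuous_on UNIV f" and supp: "\<And>x. norm x > R \<Longrightarrow> f x = 0"
  shows "integrable lborel f"
proof -
  have "set_integrable lborel (cball 0 R) f"
    unfolding set_integrable_def
    by (intro borel_integrable_compact continuous_on_subset[OF f]) auto
  moreover have "(\<lambda>x. indicat_real (cball 0 R) x *\<^sub>R f x) = f"
    using supp by (auto simp: indicator_def fun_eq_iff not_le)
  ultimately show ?thesis
    by (simp add: set_integrable_def)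
qed

lemma integrable_bump: "0 < e \<Longrightarrow> integrable lborel (bump e)"
  by (rule integrable_continuous_bounded_support[OF continuous_bump, of e]) (auto intro: bump_eq_0)

text \<open>The set where a continuous function is nonzero is open, and nonempty open sets have
  positive measure.\<close>

lemma AE_lborel_zero_imp_zero:
  fixes f :: "'a::euclidean_space \<Rightarrow> real"
  assumes f: "continuous_on UNIV f" and ae: "AE x in lborel. f x = 0"
  shows "f x = 0"
proof (rule ccontr)
  assume "f x \<noteq> 0"
  have op: "open {x. f x \<noteq> 0}"
    using f by (simp add: open_Collect_neq continuous_on_const)
  obtain N where N: "N \<in> null_sets lborel" "{x. f x \<noteq> 0} \<subseteq> N"
    using ae by (auto elim!: AE_E simp: null_sets_def)
  have "negligible {x. f x \<noteq> 0}"
    using N negligible_subset negligible_iff_null_sets null_sets_completionI by metis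
  then show False
    using open_not_negligible[OF op] \<open>f x \<noteq> 0\<close> by blast
qed

lemma integral_bump_pos:
  assumes "0 < e"
  shows "0 < (LINT y|lborel. bump e (y::'a::euclidean_space))"
proof -
  have nn: "\<And>y::'a. 0 \<le> bump e y" by (simp add: bump_def)
  then have "0 \<le> (LINT y|lborel. bump e (y::'a))" by simp
  moreover have "(LINT y|lborel. bump e (y::'a)) \<noteq> 0"
  proof
    assume "(LINT y|lborel. bump e (y::'a)) = 0"
    then have "AE y in lborel. bump e (y::'a) = 0"
      using integral_nonneg_eq_0_iff_AE[OF integrable_bump[OF assms, where 'a='a]] nn by simp
    then have "bump e (0::'a) = 0"
      by (rule AE_lborel_zero_imp_zero[OF continuous_bump])
    then show False
      using bump_pos[of "0::'a" e] assms by simp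
  qed
  ultimately show ?thesis by simp
qed

lemma distr_lborel_minus: "distr lborel borel (\<lambda>y::'a::euclidean_space. x - y) = lborel"
  using lborel_affine[of "-1" x] by (simp add: density_1)

context
  fixes e :: real
  assumes e: "0 < e"
begin

lemma mollifier_nonneg: "0 \<le> mollifier e z"
  using integral_bump_pos[OF e] by (simp add: mollifier_def bump_def less_imp_le)

lemma mollifier_eq_0: "e \<le> norm z \<Longrightarrow> mollifier e z = 0"
  by (simp add: mollifier_def bump_eq_0[OF e])

lemma continuous_mollifier: "continuous_on UNIV (mollifier e :: 'a::euclidean_space \<Rightarrow> real)"
  unfolding mollifier_def using integral_bump_pos[OF e, where 'a='a]
  by (intro continuous_intros continuous_bump) auto

lemma continuous_grad_mollifier: "continuous_on UNIV (grad_mollifier e :: 'a::euclidean_space \<Rightarrow> 'a)"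
  unfolding grad_mollifier_def using integral_bump_pos[OF e, where 'a='a]
  by (intro continuous_intros) auto

lemma GDERIV_mollifier: "GDERIV (mollifier e) z :> grad_mollifier e z"
proof -
  define c where "c = (LINT y|lborel. bump e (y::'a))"
  have "((\<lambda>z. e\<^sup>2 - z \<bullet> z) has_derivative (\<lambda>h. h \<bullet> (- 2 *\<^sub>R z))) (at z)"
    by (auto intro!: derivative_eq_intros simp: inner_commute)
  then have 1: "GDERIV (\<lambda>z. e\<^sup>2 - z \<bullet> z) z :> - 2 *\<^sub>R z"
    by (simp add: gderiv_def)
  have "((\<lambda>s. (max 0 s)\<^sup>2 / c) has_real_derivative 2 * max 0 s / c) (at s)" for s
    by (rule DERIV_cdivide[OF has_real_derivative_pos_part_square])
  from GDERIV_DERIV_compose[OF 1 this]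
  show ?thesis
    unfolding mollifier_def grad_mollifier_def bump_def c_def[symmetric]
    by (simp add: c_def bump_def)
qed

lemma integrable_mollifier: "integrable lborel (mollifier e)"
  by (rule integrable_continuous_bounded_support[OF continuous_mollifier, of e]) (auto intro: mollifier_eq_0)

lemma integral_mollifier: "integral\<^sup>L lborel (mollifier e :: 'a::euclidean_space \<Rightarrow> real) = 1"
  using integral_bump_pos[OF e, where 'a='a] by (simp add: mollifier_def[abs_def])

lemma integrable_mollifier_minus: "integrable lborel (\<lambda>y. mollifier e ((x::'a::euclidean_space) - y))"
  using integrable_distr_eq[of "\<lambda>y. x - y" lborel borel "mollifier e"] integrable_mollifier[where 'a='a]
    borel_measurable_continuous_onI[OF continuous_mollifier[where 'a='a]]
  by (simp add: distr_lborel_minus)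

lemma integral_mollifier_minus: "(LINT y|lborel. mollifier e ((x::'a::euclidean_space) - y)) = 1"
  using integral_distr[of "\<lambda>y. x - y" lborel borel "mollifier e"] integral_mollifier[where 'a='a]
    borel_measurable_continuous_onI[OF continuous_mollifier[where 'a='a]]
  by (simp add: distr_lborel_minus)

lemma integrable_mollifier_swap: "integrable lborel (\<lambda>x::'a::euclidean_space. mollifier e (x - y))"
  and integral_mollifier_swap: "(LINT x|lborel. mollifier e ((x::'a::euclidean_space) - y)) = 1"
proof -
  have s: "mollifier e (x - y) = mollifier e (y - x)" for x y :: 'a
    by (simp add: mollifier_def bump_def norm_minus_commute flip: power2_norm_eq_inner)
  show "integrable lborel (\<lambda>x::'a::euclidean_space. mollifier e (x - y))"
    by (subst s) (rule integrable_mollifier_minus)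
  show "(LINT x|lborel. mollifier e ((x::'a) - y)) = 1"
    by (subst s) (rule integral_mollifier_minus)
qed

lemma mollifier_bound:
  obtains B where "B > 0" "\<And>z::'a::euclidean_space. mollifier e z \<le> B"
proof -
  have "compact (mollifier e ` cball (0::'a) e)"
    by (intro compact_continuous_image continuous_on_subset[OF continuous_mollifier]) auto
  then have "bdd_above (mollifier e ` cball (0::'a) e)"
    by (rule bounded_imp_bdd_above[OF compact_imp_bounded])
  then obtain M where M: "\<And>z::'a. norm z \<le> e \<Longrightarrow> mollifier e z \<le> M"
    unfolding bdd_above_def by (meson imageI mem_cball_0)
  have "mollifier e z \<le> max M 1" for z :: 'a
    using M[of z] mollifier_eq_0[of z] by (cases "norm z \<le> e") auto
  then show ?thesis
    by (intro that[of "max M 1"]) auto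
qed

end

definition mollify :: "real \<Rightarrow> ('a::euclidean_space \<Rightarrow> real) \<Rightarrow> 'a \<Rightarrow> real" where
  "mollify e f x = (LINT y|lborel. mollifier e (x - y) * f y)"

lemma integrable_mollify:
  fixes f :: "'a::euclidean_space \<Rightarrow> real"
  assumes e: "0 < e" and f: "integrable lborel f"
  shows "integrable lborel (\<lambda>y. mollifier e (x - y) * f y)"
proof -
  obtain B where B: "B > 0" "\<And>z::'a. mollifier e z \<le> B"
    using mollifier_bound[OF e] by blast
  have m: "(\<lambda>y. mollifier e (x - y)) \<in> borel_measurable borel"
    using borel_measurable_integrable[OF integrable_mollifier_minus[OF e]] by simp
  show ?thesis
  proof (rule Bochner_Integration.integrable_bound[where f = "\<lambda>y. B * f y"])
    show "AE y in lborel. norm (mollifier e (x - y) * f y) \<le> norm (B * f y)"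
    proof (rule AE_I2)
      fix y
      have "\<bar>mollifier e (x - y)\<bar> \<le> B"
        using B(2)[of "x - y"] mollifier_nonneg[OF e, of "x - y"] by simp
      then show "norm (mollifier e (x - y) * f y) \<le> norm (B * f y)"
        using B(1) by (simp add: abs_mult mult_right_mono)
    qed
  qed (use f m in auto)
qed

text \<open>\<open>mollify e f x\<close> is a weighted mean of the values of \<open>f\<close> at
  distance less than \<open>e\<close> from \<open>x\<close>. With \<open>c = f x\<close> this yields
  convergence, with \<open>c = 0\<close> a bound.\<close>

lemma mollify_close:
  fixes f :: "'a::euclidean_space \<Rightarrow> real"
  assumes e: "0 < e" and f: "integrable lborel f" and d: "\<And>y. norm (x - y) < e \<Longrightarrow> \<bar>f y - c\<bar> \<le> d"
  shows "\<bar>mollify e f x - c\<bar> \<le> d"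
proof -
  have im: "integrable lborel (\<lambda>y. mollifier e (x - y) * c)"
    using integrable_mollifier_minus[OF e, of x] by simp
  have i: "integrable lborel (\<lambda>y. mollifier e (x - y) * (f y - c))"
    using Bochner_Integration.integrable_diff[OF integrable_mollify[OF e f, of x] im]
    by (simp add: algebra_simps)
  have "mollify e f x - c = (LINT y|lborel. mollifier e (x - y) * f y) - (LINT y|lborel. mollifier e (x - y) * c)"
    using integral_mollifier_minus[OF e, of x] by (simp add: mollify_def)
  also have "\<dots> = (LINT y|lborel. mollifier e (x - y) * (f y - c))"
    using integrable_mollify[OF e f, of x] im
    by (simp add: algebra_simps)
  finally have "\<bar>mollify e f x - c\<bar> \<le> (LINT y|lborel. \<bar>mollifier e (x - y) * (f y - c)\<bar>)"
    using integral_abs_bound by metis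
  also have "\<dots> \<le> (LINT y|lborel. mollifier e (x - y) * d)"
  proof (rule integral_mono)
    fix y
    show "\<bar>mollifier e (x - y) * (f y - c)\<bar> \<le> mollifier e (x - y) * d"
      using d[of y] mollifier_eq_0[OF e, of "x - y"] mollifier_nonneg[OF e, of "x - y"]
      by (cases "norm (x - y) < e") (auto simp: abs_mult intro!: mult_left_mono)
  qed (use i integrable_mollifier_minus[OF e] in auto)
  also have "\<dots> = d"
    using integral_mollifier_minus[OF e, of x] by simp
  finally show ?thesis .
qed

lemma GDERIV_mollify:
  fixes f :: "'a::euclidean_space \<Rightarrow> real"
  assumes e: "0 < e" and f: "continuous_on UNIV f" and supp: "\<And>x. norm x > R \<Longrightarrow> f x = 0"
  shows "GDERIV (mollify e f) x :> (LINT y|lborel. f y *\<^sub>R grad_mollifier e (x - y))" (is ?A)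
    and "continuous_on UNIV (\<lambda>x. LINT y|lborel. f y *\<^sub>R grad_mollifier e (x - y))" (is ?B)
proof -
  \<comment> \<open>Differentiation under the integral sign is carried out over a compact box, so
    all integrals are first moved to a box that contains the support of \<open>f\<close>.\<close>
  obtain a b :: 'a where ab: "cball 0 R \<subseteq> cbox a b"
    using bounded_subset_cbox_symmetric[OF bounded_cball] by metis
  have cb: "integral\<^sup>L lborel h = integral (cbox a b) h"
    if h: "continuous_on UNIV h" "\<And>x. norm x > R \<Longrightarrow> h x = 0" for h :: "'a \<Rightarrow> 'c::euclidean_space"
  proof -
    have "integral\<^sup>L lborel h = integral UNIV h"
      by (rule integral_lborel[symmetric, OF integrable_continuous_bounded_support[OF h]])
    also have "\<dots> = integral (cbox a b) h"
    proof -
      have "(\<lambda>x. if x \<in> cbox a b then h x else 0) = h"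
        using ab h(2) by (force simp: fun_eq_iff not_le[symmetric])
      then show ?thesis
        using integral_restrict_UNIV[of "cbox a b" h] by simp
    qed
    finally show ?thesis .
  qed
  have cf: "continuous_on S f" for S
    using f continuous_on_subset by blast
  have cm: "continuous_on S (\<lambda>x. mollifier e (g x))" "continuous_on S (\<lambda>x. grad_mollifier e (g x))"
    if "continuous_on S g" for S :: "'s::topological_space set" and g :: "'s \<Rightarrow> 'a"
    using continuous_on_compose2[OF continuous_mollifier[OF e] that]
      continuous_on_compose2[OF continuous_grad_mollifier[OF e] that] by auto
  have cf2: "continuous_on S (\<lambda>z. f (g z))" if "continuous_on S g" for S :: "'s::topological_space set" and g :: "'s \<Rightarrow> 'a"
    using continuous_on_compose2[OF f that] by auto
  have eq1: "mollify e f x = integral (cbox a b) (\<lambda>y. mollifier e (x - y) * f y)" for x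
    unfolding mollify_def using supp by (intro cb) (auto intro!: continuous_intros cm cf)
  have eq2: "(LINT y|lborel. f y *\<^sub>R grad_mollifier e (x - y)) = integral (cbox a b) (\<lambda>y. f y *\<^sub>R grad_mollifier e (x - y))" for x
    using supp by (intro cb) (auto intro!: continuous_intros cm cf)
  show ?B
    unfolding eq2
    by (rule integral_continuous_on_param) (auto intro!: continuous_intros cm cf2 simp: split_beta)
  have int: "(\<lambda>y. f y *\<^sub>R grad_mollifier e (x - y)) integrable_on cbox a b"
    by (intro integrable_continuous continuous_intros cm cf)
  have "((\<lambda>x. integral (cbox a b) (\<lambda>y. mollifier e (x - y) * f y)) has_derivative
      blinfun_apply (integral (cbox a b) (\<lambda>y. blinfun_inner_left (f y *\<^sub>R grad_mollifier e (x - y))))) (at x within UNIV)"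
  proof (rule leibniz_rule)
    fix x t :: 'a
    have "GDERIV (\<lambda>z. mollifier e (z - t)) x :> grad_mollifier e (x - t)"
      using GDERIV_mollifier[OF e, of "x - t"] unfolding gderiv_def
      by (intro has_derivative_compose[where g = "mollifier e" and f = "\<lambda>z. z - t" and f' = "\<lambda>h. h", simplified])
        (auto intro!: derivative_eq_intros)
    then show "((\<lambda>z. mollifier e (z - t) * f t) has_derivative
        blinfun_apply (blinfun_inner_left (f t *\<^sub>R grad_mollifier e (x - t)))) (at x within UNIV)"
      unfolding gderiv_def by (auto intro!: derivative_eq_intros simp: inner_commute)
  next
    show "(\<lambda>y. mollifier e (x - y) * f y) integrable_on cbox a b" for x
      by (intro integrable_continuous continuous_intros cm cf)
    show "continuous_on (UNIV \<times> cbox a b) (\<lambda>(x, t). blinfun_inner_left (f t *\<^sub>R grad_mollifier e (x - t)))"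
      by (auto intro!: continuous_intros cm cf2 bounded_linear.continuous_on[OF bounded_linear_blinfun_inner_left] simp: split_beta)
  qed auto
  note D = this
  have E: "blinfun_apply (integral (cbox a b) (\<lambda>y. blinfun_inner_left (f y *\<^sub>R grad_mollifier e (x - y)))) h
     = h \<bullet> integral (cbox a b) (\<lambda>y. f y *\<^sub>R grad_mollifier e (x - y))" for h
    using integral_linear[OF int bounded_linear_blinfun_inner_left]
    by (simp add: o_def inner_commute)
  have "blinfun_apply (integral (cbox a b) (\<lambda>y. blinfun_inner_left (f y *\<^sub>R grad_mollifier e (x - y))))
     = (\<lambda>h. h \<bullet> integral (cbox a b) (\<lambda>y. f y *\<^sub>R grad_mollifier e (x - y)))"
    using E by (rule ext)
  with D show ?A
    unfolding gderiv_def eq1[abs_def] eq2 by (simp only:)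
qed

text \<open>As a function of \<open>y\<close>, the kernel \<open>mollifier e (x - y)\<close> is a
  test function as soon as the ball of radius \<open>e\<close> about \<open>x\<close> lies in the
  unit ball. Its gradient in \<open>y\<close> carries a minus sign, which cancels the one in the
  definition of a weak gradient.\<close>

lemma weak_gradient_mollify:
  fixes v g :: "real^3 \<Rightarrow> real"
  assumes e: "0 < e" and x: "norm x + e < 1"
    and v: "continuous_on UNIV v" "\<And>x. norm x > R \<Longrightarrow> v x = 0"
    and wg: "\<And>\<phi> d. test_function unit_ball \<phi> d \<Longrightarrow>
      (LINT x|lborel. v x * d x $ i) = - (LINT x|lborel. g x * \<phi> x)"
  shows "(LINT y|lborel. v y *\<^sub>R grad_mollifier e (x - y)) $ i = mollify e g x"
proof -
  have int: "integrable lborel (\<lambda>y. v y *\<^sub>R grad_mollifier e (x - y))"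
    by (rule integrable_continuous_bounded_support[where R = R])
      (auto intro!: continuous_intros v(1) continuous_on_compose2[OF continuous_grad_mollifier[OF e]] simp: v(2))
  have "test_function unit_ball (\<lambda>y. mollifier e (x - y)) (\<lambda>y. - grad_mollifier e (x - y))"
    unfolding test_function_def
  proof (intro conjI allI exI impI)
    show "GDERIV (\<lambda>y. mollifier e (x - y)) y :> - grad_mollifier e (x - y)" for y
    proof -
      have "((\<lambda>y. mollifier e (x - y)) has_derivative (\<lambda>h. (- h) \<bullet> grad_mollifier e (x - y))) (at y)"
        using GDERIV_mollifier[OF e, of "x - y"] unfolding gderiv_def
        by (intro has_derivative_compose[where g = "mollifier e" and f = "\<lambda>z. x - z" and f' = "\<lambda>h. - h"])
          (auto intro!: derivative_eq_intros)
      then show ?thesis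
        by (simp add: gderiv_def)
    qed
    show "continuous_on UNIV (\<lambda>y. - grad_mollifier e (x - y))"
      by (intro continuous_intros continuous_on_compose2[OF continuous_grad_mollifier[OF e]]) auto
    show "compact (cball x e)" by simp
    show "cball x e \<subseteq> unit_ball"
    proof
      fix y assume "y \<in> cball x e"
      then have "norm y \<le> norm x + e"
        using norm_triangle_sub[of y x] by (simp add: dist_norm norm_minus_commute)
      then show "y \<in> unit_ball" using x by simp
    qed
    show "mollifier e (x - y) = 0" if "y \<notin> cball x e" for y
      using that mollifier_eq_0[OF e, of "x - y"] by (simp add: dist_norm)
  qed
  from wg[OF this] have "(LINT y|lborel. v y * grad_mollifier e (x - y) $ i) = mollify e g x"
    by (simp add: mollify_def mult.commute)
  moreover have "(LINT y|lborel. v y *\<^sub>R grad_mollifier e (x - y)) $ i = (LINT y|lborel. (v y *\<^sub>R grad_mollifier e (x - y)) $ i)"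
    using integral_bounded_linear[OF bounded_linear_vec_nth int] by simp
  ultimately show ?thesis by simp
qed

section \<open>Square integrability and mean square convergence of mollifications\<close>

lemma borel_measurable_mollify:
  fixes f :: "'a::euclidean_space \<Rightarrow> real"
  assumes e: "0 < e" and f: "f \<in> borel_measurable borel"
  shows "mollify e f \<in> borel_measurable borel"
proof -
  have m: "mollifier e \<in> borel_measurable (borel :: 'a measure)"
    by (rule borel_measurable_continuous_onI[OF continuous_mollifier[OF e]])
  have "(\<lambda>(x, y). mollifier e (x - y) * f y) \<in> borel_measurable (lborel \<Otimes>\<^sub>M lborel)"
    using m f by (auto intro!: borel_measurable_times measurable_compose[OF _ m] measurable_compose[OF _ f] simp: split_beta)
  then have "mollify e f \<in> borel_measurable lborel"
    unfolding mollify_def[abs_def] by (rule lborel.borel_measurable_lebesgue_integral)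
  then show ?thesis by simp
qed

text \<open>Jensen's inequality for the probability density \<open>mollifier e (x - y)\<close>,
  obtained from the nonnegativity of the variance.\<close>

lemma mollify_square_le:
  fixes f :: "'a::euclidean_space \<Rightarrow> real"
  assumes e: "0 < e" and f: "integrable lborel f" and f2: "integrable lborel (\<lambda>x. (f x)\<^sup>2)"
  shows "(mollify e f x)\<^sup>2 \<le> mollify e (\<lambda>x. (f x)\<^sup>2) x"
proof -
  define c where "c = mollify e f x"
  note i1 = integrable_mollify[OF e f, of x] and i2 = integrable_mollify[OF e f2, of x]
    and i0 = integrable_mollifier_minus[OF e, of x]
  have j1: "integrable lborel (\<lambda>y. 2 * c * (mollifier e (x - y) * f y))"
    and j0: "integrable lborel (\<lambda>y. c\<^sup>2 * mollifier e (x - y))"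
    using i1 i0 by simp_all
  have "0 \<le> (LINT y|lborel. mollifier e (x - y) * (f y - c)\<^sup>2)"
    by (intro integral_nonneg_AE AE_I2 mult_nonneg_nonneg mollifier_nonneg[OF e]) simp
  also have "\<dots> = (LINT y|lborel. mollifier e (x - y) * (f y)\<^sup>2 - 2 * c * (mollifier e (x - y) * f y) + c\<^sup>2 * mollifier e (x - y))"
    by (intro Bochner_Integration.integral_cong refl) (simp add: power2_eq_square algebra_simps)
  also have "\<dots> = mollify e (\<lambda>x. (f x)\<^sup>2) x - 2 * c * mollify e f x + c\<^sup>2"
    using i2 j1 j0 integral_mollifier_minus[OF e, of x] by (simp add: mollify_def)
  finally show ?thesis
    by (simp add: c_def power2_eq_square)
qed

text \<open>Jensen's inequality at each point, then Tonelli: the kernel has integral one in its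
  other variable as well.\<close>

lemma integral_mollify_square_le:
  fixes f :: "'a::euclidean_space \<Rightarrow> real"
  assumes e: "0 < e" and f: "integrable lborel f" and f2: "integrable lborel (\<lambda>x. (f x)\<^sup>2)"
  shows "integrable lborel (\<lambda>x. (mollify e f x)\<^sup>2)"
    and "(LINT x|lborel. (mollify e f x)\<^sup>2) \<le> (LINT x|lborel. (f x)\<^sup>2)"
proof -
  have mm: "mollify e f \<in> borel_measurable borel"
    using borel_measurable_mollify[OF e] borel_measurable_integrable[OF f] by simp
  have m: "mollifier e \<in> borel_measurable (borel :: 'a measure)"
    by (rule borel_measurable_continuous_onI[OF continuous_mollifier[OF e]])
  have f': "f \<in> borel_measurable borel"
    using borel_measurable_integrable[OF f] by simp
  have "(\<integral>\<^sup>+x. ennreal ((mollify e f x)\<^sup>2) \<partial>lborel) \<le>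
      (\<integral>\<^sup>+x. \<integral>\<^sup>+y. ennreal (mollifier e (x - y) * (f y)\<^sup>2) \<partial>lborel \<partial>lborel)"
  proof (rule nn_integral_mono)
    fix x :: 'a
    show "ennreal ((mollify e f x)\<^sup>2) \<le> (\<integral>\<^sup>+y. ennreal (mollifier e (x - y) * (f y)\<^sup>2) \<partial>lborel)"
      using mollify_square_le[OF e f f2, of x] mollifier_nonneg[OF e, where 'a='a]
      by (subst nn_integral_eq_integral[OF integrable_mollify[OF e f2]])
        (auto simp: mollify_def intro!: ennreal_leI AE_I2)
  qed
  also have "\<dots> = (\<integral>\<^sup>+y. \<integral>\<^sup>+x. ennreal (mollifier e (x - y) * (f y)\<^sup>2) \<partial>lborel \<partial>lborel)"
    by (rule lborel_pair.Fubini'[symmetric])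
      (use m f' in \<open>auto intro!: measurable_compose[OF _ measurable_ennreal] borel_measurable_times borel_measurable_power
        measurable_compose[OF _ m] measurable_compose[OF _ f'] simp: split_beta\<close>)
  also have "\<dots> = (\<integral>\<^sup>+y. ennreal ((f y)\<^sup>2) \<partial>lborel)"
  proof (rule nn_integral_cong)
    fix y :: 'a
    have "(\<integral>\<^sup>+x. ennreal (mollifier e (x - y) * (f y)\<^sup>2) \<partial>lborel) = ennreal (LINT x|lborel. mollifier e (x - y) * (f y)\<^sup>2)"
      using integrable_mollifier_swap[OF e, of y] mollifier_nonneg[OF e, where 'a='a]
      by (intro nn_integral_eq_integral) auto
    then show "(\<integral>\<^sup>+x. ennreal (mollifier e (x - y) * (f y)\<^sup>2) \<partial>lborel) = ennreal ((f y)\<^sup>2)"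
      using integral_mollifier_swap[OF e, of y] by simp
  qed
  also have "\<dots> = ennreal (LINT x|lborel. (f x)\<^sup>2)"
    using f2 by (intro nn_integral_eq_integral) auto
  finally have le: "(\<integral>\<^sup>+x. ennreal ((mollify e f x)\<^sup>2) \<partial>lborel) \<le> ennreal (LINT x|lborel. (f x)\<^sup>2)" .
  show int: "integrable lborel (\<lambda>x. (mollify e f x)\<^sup>2)"
    using mm le by (intro integrableI_nonneg) (auto simp: le_less_trans)
  show "(LINT x|lborel. (mollify e f x)\<^sup>2) \<le> (LINT x|lborel. (f x)\<^sup>2)"
    using le nn_integral_eq_integral[OF int] by (simp add: ennreal_le_iff)
qed

text \<open>Two approximations: \<open>f\<close> is truncated at a height \<open>M\<close>, with
  \<open>(f x)\<^sup>2\<close> dominating the error, and the truncation is replaced by continuous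
  functions that converge almost everywhere. Clipping these at the same height keeps the second
  error below \<open>4 * M\<^sup>2\<close> on the ball.\<close>

lemma L2_approx_bounded_continuous:
  fixes f :: "'a::euclidean_space \<Rightarrow> real"
  assumes f: "f \<in> borel_measurable borel" and supp: "\<And>x. x \<notin> ball 0 1 \<Longrightarrow> f x = 0"
    and f2: "integrable lborel (\<lambda>x. (f x)\<^sup>2)" and d: "0 < d"
  obtains k M where "continuous_on UNIV k" "M \<ge> 0" "\<And>x. \<bar>k x\<bar> \<le> M"
    "(LINT x|lborel. (f x - indicat_real (ball 0 1) x * k x)\<^sup>2) < d"
proof -
  define cl where "cl M t = max (- M) (min M t)" for M t :: real
  have cl_bd: "M \<ge> 0 \<Longrightarrow> \<bar>cl M t\<bar> \<le> M" for M t by (auto simp: cl_def)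
  have cl_cont: "continuous_on UNIV (cl M)" for M
    unfolding cl_def by (intro continuous_intros)
  have cl_meas: "cl M \<in> borel_measurable borel" for M
    by (rule borel_measurable_continuous_onI[OF cl_cont])
  have lim1: "(\<lambda>n. LINT x|lborel. (f x - cl (real n) (f x))\<^sup>2) \<longlonglongrightarrow> (LINT x|(lborel :: 'a measure). (0::real))"
  proof (rule integral_dominated_convergence[where w = "\<lambda>x. (f x)\<^sup>2"])
    show "AE x in lborel. (\<lambda>n. (f x - cl (real n) (f x))\<^sup>2) \<longlonglongrightarrow> 0"
    proof (rule AE_I2)
      fix x
      obtain N where N: "\<bar>f x\<bar> \<le> real N" using real_arch_simple by blast
      show "(\<lambda>n. (f x - cl (real n) (f x))\<^sup>2) \<longlonglongrightarrow> 0"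
        by (rule tendsto_eventually, rule eventually_sequentiallyI[of N])
          (use N in \<open>auto simp: cl_def\<close>)
    qed
    show "AE x in lborel. norm ((f x - cl (real n) (f x))\<^sup>2) \<le> (f x)\<^sup>2" for n
    proof (rule AE_I2)
      fix x
      have "\<bar>f x - cl (real n) (f x)\<bar> \<le> \<bar>f x\<bar>" by (auto simp: cl_def)
      then show "norm ((f x - cl (real n) (f x))\<^sup>2) \<le> (f x)\<^sup>2"
        by (simp add: abs_le_square_iff)
    qed
  qed (use f f2 measurable_compose[OF f cl_meas] in auto)
  \<comment> \<open>The two errors enter through
    \<open>(a + b)\<^sup>2 \<le> 2 * a\<^sup>2 + 2 * b\<^sup>2\<close>, so a quarter of
    \<open>d\<close> is allowed for each.\<close>
  then have "\<forall>\<^sub>F n in sequentially. (LINT x|lborel. (f x - cl (real n) (f x))\<^sup>2) < d / 4"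
    using d by (intro order_tendstoD) auto
  then obtain n where n: "(LINT x|lborel. (f x - cl (real n) (f x))\<^sup>2) < d / 4"
    unfolding eventually_sequentially by auto
  define M where "M = real n"
  have M: "M \<ge> 0" by (simp add: M_def)
  have "f \<in> borel_measurable lebesgue"
    using f by (simp add: measurable_completion)
  then have "f measurable_on UNIV"
    by (rule lebesgue_measurable_imp_measurable_on) simp
  then obtain N h where N: "negligible N" and h: "\<And>n. continuous_on UNIV (h n)"
    and hf: "\<And>x. x \<notin> N \<Longrightarrow> (\<lambda>n. h n x) \<longlonglongrightarrow> f x"
    unfolding measurable_on_def by auto
  have hc: "continuous_on UNIV (\<lambda>x. cl M (h n x))" for n
    using continuous_on_compose2[OF cl_cont h] by simp
  have AEN: "AE x in lborel. x \<notin> N"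
    using N by (metis AE_completion_iff AE_not_in negligible_iff_null_sets)
  have ib: "integrable lborel (\<lambda>x. (4 * M\<^sup>2) * indicat_real (ball (0::'a) 1) x)"
    using emeasure_lborel_ball_finite[of "0::'a" 1] by (simp add: less_top)
  have sq4: "(cl M s - cl M t)\<^sup>2 \<le> 4 * M\<^sup>2" for s t
  proof -
    have "\<bar>cl M s - cl M t\<bar> \<le> \<bar>2 * M\<bar>" using cl_bd[OF M, of s] cl_bd[OF M, of t] M by linarith
    then show ?thesis unfolding abs_le_square_iff by (simp add: power_mult_distrib)
  qed
  have m1: "(\<lambda>x. indicat_real (ball (0::'a) 1) x * (cl M (f x) - cl M (h n x))\<^sup>2) \<in> borel_measurable lborel" for n
    using measurable_compose[OF f cl_meas] borel_measurable_continuous_onI[OF hc]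
    by (intro borel_measurable_times borel_measurable_power borel_measurable_diff borel_measurable_indicator) auto
  have lim2: "(\<lambda>n. LINT x|lborel. indicat_real (ball 0 1) x * (cl M (f x) - cl M (h n x))\<^sup>2) \<longlonglongrightarrow> (LINT x|(lborel :: 'a measure). (0::real))"
  proof (rule integral_dominated_convergence[OF _ m1 ib])
    show "AE x in lborel. (\<lambda>n. indicat_real (ball 0 1) x * (cl M (f x) - cl M (h n x))\<^sup>2) \<longlonglongrightarrow> 0"
      using AEN
    proof eventually_elim
      case (elim x)
      have "isCont (cl M) (f x)" using cl_cont by (simp add: continuous_on_eq_continuous_at)
      from isCont_tendsto_compose[OF this hf[OF elim]]
      have "(\<lambda>n. indicat_real (ball 0 1) x * (cl M (f x) - cl M (h n x))\<^sup>2) \<longlonglongrightarrow> indicat_real (ball 0 1) x * (cl M (f x) - cl M (f x))\<^sup>2"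
        by (intro tendsto_intros)
      then show ?case by simp
    qed
    show "AE x in lborel. norm (indicat_real (ball 0 1) x * (cl M (f x) - cl M (h n x))\<^sup>2) \<le> (4 * M\<^sup>2) * indicat_real (ball 0 1) x" for n
      using sq4 by (intro AE_I2) (auto simp: indicator_def)
  qed simp
  then have "\<forall>\<^sub>F n in sequentially. (LINT x|lborel. indicat_real (ball 0 1) x * (cl M (f x) - cl M (h n x))\<^sup>2) < d / 4"
    using d by (intro order_tendstoD) auto
  then obtain m where m: "(LINT x|lborel. indicat_real (ball 0 1) x * (cl M (f x) - cl M (h m x))\<^sup>2) < d / 4"
    unfolding eventually_sequentially by auto
  define k where "k x = cl M (h m x)" for x
  have i1: "integrable lborel (\<lambda>x. (f x - cl M (f x))\<^sup>2)"
  proof (rule Bochner_Integration.integrable_bound[OF f2])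
    show "AE x in lborel. norm ((f x - cl M (f x))\<^sup>2) \<le> norm ((f x)\<^sup>2)"
    proof (rule AE_I2)
      fix x
      have "\<bar>f x - cl M (f x)\<bar> \<le> \<bar>f x\<bar>" using M by (auto simp: cl_def)
      then show "norm ((f x - cl M (f x))\<^sup>2) \<le> norm ((f x)\<^sup>2)"
        by (simp add: abs_le_square_iff)
    qed
  qed (use f measurable_compose[OF f cl_meas] in auto)
  have i2: "integrable lborel (\<lambda>x. indicat_real (ball 0 1) x * (cl M (f x) - k x)\<^sup>2)"
    unfolding k_def
    by (rule Bochner_Integration.integrable_bound[OF ib m1]) (use sq4 in \<open>auto simp: indicator_def\<close>)
  have pw: "(f x - indicat_real (ball 0 1) x * k x)\<^sup>2 \<le>
      2 * (f x - cl M (f x))\<^sup>2 + 2 * (indicat_real (ball 0 1) x * (cl M (f x) - k x)\<^sup>2)" for x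
  proof (cases "x \<in> ball 0 1")
    case True
    have "(a + b)\<^sup>2 \<le> 2 * a\<^sup>2 + 2 * b\<^sup>2" for a b :: real
      using zero_le_power2[of "a - b"] by (simp add: power2_eq_square algebra_simps)
    from this[of "f x - cl M (f x)" "cl M (f x) - k x"] True show ?thesis by simp
  qed (simp add: supp)
  have "(LINT x|lborel. (f x - indicat_real (ball 0 1) x * k x)\<^sup>2) \<le>
      (LINT x|lborel. 2 * (f x - cl M (f x))\<^sup>2 + 2 * (indicat_real (ball 0 1) x * (cl M (f x) - k x)\<^sup>2))"
    using i1 i2 pw by (intro integral_mono') auto
  also have "\<dots> = 2 * (LINT x|lborel. (f x - cl M (f x))\<^sup>2) + 2 * (LINT x|lborel. indicat_real (ball 0 1) x * (cl M (f x) - k x)\<^sup>2)"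
    using i1 i2 by simp
  also have "\<dots> < d"
    using n m by (simp add: M_def k_def)
  finally show ?thesis
    using hc[of m] cl_bd[OF M] M by (intro that[of k M]) (auto simp: k_def[abs_def])
qed

lemma integrable_mult_L2:
  fixes a b :: "'a \<Rightarrow> real"
  assumes "a \<in> borel_measurable M" "b \<in> borel_measurable M"
    "integrable M (\<lambda>x. (a x)\<^sup>2)" "integrable M (\<lambda>x. (b x)\<^sup>2)"
  shows "integrable M (\<lambda>x. a x * b x)"
proof (rule Bochner_Integration.integrable_bound[where f = "\<lambda>x. (a x)\<^sup>2 + (b x)\<^sup>2"])
  have "\<bar>s * t\<bar> \<le> s\<^sup>2 + t\<^sup>2" for s t :: real
  proof -
    have "2 * (\<bar>s\<bar> * \<bar>t\<bar>) \<le> s\<^sup>2 + t\<^sup>2"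
      using zero_le_power2[of "\<bar>s\<bar> - \<bar>t\<bar>"] by (simp add: power2_diff)
    moreover have "0 \<le> \<bar>s\<bar> * \<bar>t\<bar>" by simp
    ultimately show ?thesis unfolding abs_mult by linarith
  qed
  then show "AE x in M. norm (a x * b x) \<le> norm ((a x)\<^sup>2 + (b x)\<^sup>2)"
    by (intro AE_I2) auto
qed (use assms in auto)

lemma abs_integral_mult_le_L2:
  fixes a b :: "'a \<Rightarrow> real"
  assumes m: "a \<in> borel_measurable M" "b \<in> borel_measurable M"
    and i: "integrable M (\<lambda>x. (a x)\<^sup>2)" "integrable M (\<lambda>x. (b x)\<^sup>2)"
  shows "\<bar>LINT x|M. a x * b x\<bar> \<le> sqrt (LINT x|M. (a x)\<^sup>2) * sqrt (LINT x|M. (b x)\<^sup>2)"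
proof -
  have ab: "integrable M (\<lambda>x. \<bar>a x\<bar> * \<bar>b x\<bar>)"
    using integrable_abs[OF integrable_mult_L2[OF m i]] by (simp add: abs_mult)
  have "(\<integral>\<^sup>+x. ennreal \<bar>a x\<bar> * ennreal \<bar>b x\<bar> \<partial>M)\<^sup>2 \<le> (\<integral>\<^sup>+x. (ennreal \<bar>a x\<bar>)\<^sup>2 \<partial>M) * (\<integral>\<^sup>+x. (ennreal \<bar>b x\<bar>)\<^sup>2 \<partial>M)"
    by (rule Cauchy_Schwarz_nn_integral) (use m in auto)
  also have "(\<integral>\<^sup>+x. ennreal \<bar>a x\<bar> * ennreal \<bar>b x\<bar> \<partial>M) = ennreal (LINT x|M. \<bar>a x\<bar> * \<bar>b x\<bar>)"
    using ab by (simp add: nn_integral_eq_integral flip: ennreal_mult)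
  also have "(\<integral>\<^sup>+x. (ennreal \<bar>a x\<bar>)\<^sup>2 \<partial>M) = ennreal (LINT x|M. (a x)\<^sup>2)"
    using i by (simp add: nn_integral_eq_integral ennreal_power)
  also have "(\<integral>\<^sup>+x. (ennreal \<bar>b x\<bar>)\<^sup>2 \<partial>M) = ennreal (LINT x|M. (b x)\<^sup>2)"
    using i by (simp add: nn_integral_eq_integral ennreal_power)
  finally have "(LINT x|M. \<bar>a x\<bar> * \<bar>b x\<bar>)\<^sup>2 \<le> (LINT x|M. (a x)\<^sup>2) * (LINT x|M. (b x)\<^sup>2)"
    by (simp add: ennreal_power ennreal_mult[symmetric] ennreal_le_iff)
  then have "(LINT x|M. \<bar>a x\<bar> * \<bar>b x\<bar>) \<le> sqrt (LINT x|M. (a x)\<^sup>2) * sqrt (LINT x|M. (b x)\<^sup>2)"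
    by (simp add: real_le_rsqrt real_sqrt_mult[symmetric])
  moreover have "\<bar>LINT x|M. a x * b x\<bar> \<le> (LINT x|M. \<bar>a x\<bar> * \<bar>b x\<bar>)"
    using integral_abs_bound[of M "\<lambda>x. a x * b x"] by (simp add: abs_mult)
  ultimately show ?thesis by simp
qed

lemma integrable_L2_ball:
  fixes f :: "'a::euclidean_space \<Rightarrow> real"
  assumes f: "f \<in> borel_measurable borel" and supp: "\<And>x. x \<notin> ball 0 1 \<Longrightarrow> f x = 0"
    and f2: "integrable lborel (\<lambda>x. (f x)\<^sup>2)"
  shows "integrable lborel f"
proof (rule Bochner_Integration.integrable_bound[where f = "\<lambda>x. indicat_real (ball 0 1) x + (f x)\<^sup>2"])
  show "integrable lborel (\<lambda>x. indicat_real (ball 0 1) x + (f x)\<^sup>2)"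
    using f2 emeasure_lborel_ball_finite[of "0::'a" 1] by (simp add: less_top)
  have "\<bar>t\<bar> \<le> 1 + t\<^sup>2" for t :: real
  proof -
    have "2 * \<bar>t\<bar> \<le> 1 + t\<^sup>2"
      using zero_le_power2[of "\<bar>t\<bar> - 1"] by (simp add: power2_diff)
    then show ?thesis by simp
  qed
  then show "AE x in lborel. norm (f x) \<le> norm (indicat_real (ball 0 1) x + (f x)\<^sup>2)"
    using supp by (intro AE_I2) (auto simp: indicator_def split: if_splits)
qed (use f in auto)

text \<open>A density argument: \<open>f\<close> is close to a bounded function \<open>K\<close>
  that is continuous in the open ball, mollification does not increase the error, and for
  \<open>K\<close> the convergence is pointwise. As \<open>K\<close> may jump at the sphere, at a
  point \<open>x\<close> of the ball \<open>e n\<close> has to fall below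
  \<open>1 - norm x\<close>.\<close>

lemma mollify_L2_tendsto:
  fixes f :: "'a::euclidean_space \<Rightarrow> real"
  assumes f: "f \<in> borel_measurable borel" and supp: "\<And>x. x \<notin> ball 0 1 \<Longrightarrow> f x = 0"
    and f2: "integrable lborel (\<lambda>x. (f x)\<^sup>2)"
    and e: "\<And>n. 0 < e n" "e \<longlonglongrightarrow> 0"
  shows "(\<lambda>n. LINT x|lborel. indicat_real (ball 0 1) x * (mollify (e n) f x - f x)\<^sup>2) \<longlonglongrightarrow> 0"
proof (rule order_tendstoI)
  fix d :: real assume "d < 0"
  moreover have "0 \<le> (LINT x|lborel. indicat_real (ball 0 1) x * (mollify (e n) f x - f x)\<^sup>2)" for n
    by simp
  ultimately show "\<forall>\<^sub>F n in sequentially. d < (LINT x|lborel. indicat_real (ball 0 1) x * (mollify (e n) f x - f x)\<^sup>2)"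
    by (intro always_eventually allI) (rule less_le_trans)
next
  fix d :: real assume d: "0 < d"
  \<comment> \<open>The final estimate has three errors, each with the factor 3:
    \<open>3 * (d / 12) + 3 * (d / 6) + 3 * (d / 12) = d\<close>.\<close>
  obtain k M where k: "continuous_on UNIV k" and M: "M \<ge> 0" "\<And>x. \<bar>k x\<bar> \<le> M"
    and D: "(LINT x|lborel. (f x - indicat_real (ball 0 1) x * k x)\<^sup>2) < d / 12"
  proof (rule L2_approx_bounded_continuous[OF f supp f2])
    show "0 < d / 12" using d by simp
  qed blast+
  define K where "K x = indicat_real (ball 0 1) x * k x" for x
  have Km: "K \<in> borel_measurable borel"
    unfolding K_def[abs_def] by (intro borel_measurable_times borel_measurable_indicator borel_measurable_continuous_onI[OF k]) auto
  have Kb: "\<bar>K x\<bar> \<le> M" for x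
    using M by (auto simp: K_def indicator_def)
  have K0: "x \<notin> ball 0 1 \<Longrightarrow> K x = 0" for x by (simp add: K_def)
  have ind: "integrable lborel (\<lambda>x. c * indicat_real (ball (0::'a) 1) x)" for c
    using emeasure_lborel_ball_finite[of "0::'a" 1] by (simp add: less_top)
  have K2: "integrable lborel (\<lambda>x. (K x)\<^sup>2)"
  proof (rule Bochner_Integration.integrable_bound[OF ind[of "M\<^sup>2"]])
    show "AE x in lborel. norm ((K x)\<^sup>2) \<le> norm (M\<^sup>2 * indicat_real (ball 0 1) x)"
      using Kb K0 M(1) by (intro AE_I2) (auto simp: indicator_def abs_le_square_iff[symmetric])
  qed (use Km in auto)
  have fi: "integrable lborel f" by (rule integrable_L2_ball[OF f supp f2])
  have Ki: "integrable lborel K" by (rule integrable_L2_ball[OF Km K0 K2])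
  have fK2: "integrable lborel (\<lambda>x. (f x - K x)\<^sup>2)"
  proof -
    have "integrable lborel (\<lambda>x. (f x)\<^sup>2 - 2 * (f x * K x) + (K x)\<^sup>2)"
      using f2 K2 integrable_mult_L2[of f lborel K] f Km by auto
    then show ?thesis by (simp add: power2_diff algebra_simps)
  qed
  have fKi: "integrable lborel (\<lambda>x. f x - K x)" using fi Ki by simp
  have diff: "mollify (e n) (\<lambda>x. f x - K x) x = mollify (e n) f x - mollify (e n) K x" for n x
    using integrable_mollify[OF e(1) fi] integrable_mollify[OF e(1) Ki]
    by (simp add: mollify_def right_diff_distrib)
  have mm: "mollify (e n) f \<in> borel_measurable borel" "mollify (e n) K \<in> borel_measurable borel" for n
    using borel_measurable_mollify[OF e(1)] f Km by auto
  have mKb: "\<bar>mollify (e n) K x\<bar> \<le> M" for n x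
  proof -
    have "\<bar>mollify (e n) K x - 0\<bar> \<le> M"
      by (rule mollify_close[OF e(1) Ki]) (use Kb in simp)
    then show ?thesis by simp
  qed
  have im1: "integrable lborel (\<lambda>x. (mollify (e n) (\<lambda>x. f x - K x) x)\<^sup>2)"
    and le1: "(LINT x|lborel. (mollify (e n) (\<lambda>x. f x - K x) x)\<^sup>2) \<le> (LINT x|lborel. (f x - K x)\<^sup>2)" for n
    using integral_mollify_square_le[OF e(1) fKi fK2] by blast+
  have sq: "indicat_real (ball 0 1) x * (mollify (e n) K x - K x)\<^sup>2 \<le> (4 * M\<^sup>2) * indicat_real (ball 0 1) x" for n x
  proof -
    have "\<bar>mollify (e n) K x - K x\<bar> \<le> \<bar>2 * M\<bar>" using mKb[of n x] Kb[of x] M by linarith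
    then have "(mollify (e n) K x - K x)\<^sup>2 \<le> 4 * M\<^sup>2" unfolding abs_le_square_iff by (simp add: power_mult_distrib)
    then show ?thesis by (simp add: indicator_def)
  qed
  have mmK: "(\<lambda>x. indicat_real (ball 0 1) x * (mollify (e n) K x - K x)\<^sup>2) \<in> borel_measurable lborel" for n
    using mm Km by (intro borel_measurable_times borel_measurable_power borel_measurable_diff borel_measurable_indicator) auto
  have im2: "integrable lborel (\<lambda>x. indicat_real (ball 0 1) x * (mollify (e n) K x - K x)\<^sup>2)" for n
    by (rule Bochner_Integration.integrable_bound[OF ind[of "4 * M\<^sup>2"] mmK]) (use sq in auto)
  have "(\<lambda>n. LINT x|lborel. indicat_real (ball 0 1) x * (mollify (e n) K x - K x)\<^sup>2) \<longlonglongrightarrow> (LINT x|(lborel :: 'a measure). (0::real))"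
  proof (rule integral_dominated_convergence[OF _ mmK ind[of "4 * M\<^sup>2"]])
    show "AE x in lborel. (\<lambda>n. indicat_real (ball 0 1) x * (mollify (e n) K x - K x)\<^sup>2) \<longlonglongrightarrow> 0"
    proof (rule AE_I2)
      fix x :: 'a
      show "(\<lambda>n. indicat_real (ball 0 1) x * (mollify (e n) K x - K x)\<^sup>2) \<longlonglongrightarrow> 0"
      proof (cases "x \<in> ball 0 1")
        case True
        have "(\<lambda>n. mollify (e n) K x) \<longlonglongrightarrow> K x"
          unfolding tendsto_iff
        proof (intro allI impI)
          fix r :: real assume r: "0 < r"
          have "isCont k x" using k by (simp add: continuous_on_eq_continuous_at)
          then obtain s where s: "s > 0" "\<And>y. norm (y - x) < s \<Longrightarrow> \<bar>k y - k x\<bar> < r / 2"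
          proof -
            have "\<exists>s>0. \<forall>y. dist y x < s \<longrightarrow> dist (k y) (k x) < r / 2"
              using \<open>isCont k x\<close> half_gt_zero[OF r] unfolding continuous_at_eps_delta by blast
            then show ?thesis
              using that by (auto simp: dist_norm)
          qed
          have "\<forall>\<^sub>F n in sequentially. e n < min s (1 - norm x)"
            using s(1) True by (intro order_tendstoD[OF e(2)]) auto
          then show "\<forall>\<^sub>F n in sequentially. dist (mollify (e n) K x) (K x) < r"
          proof eventually_elim
            case (elim n)
            have "\<bar>mollify (e n) K x - K x\<bar> \<le> r / 2"
            proof (rule mollify_close[OF e(1) Ki])
              fix y assume y: "norm (x - y) < e n"
              have "norm y \<le> norm x + norm (x - y)"
                using norm_triangle_sub[of y x] by (simp add: norm_minus_commute)
              then have "y \<in> ball 0 1" using y elim by simp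
              then show "\<bar>K y - K x\<bar> \<le> r / 2"
                using True s(2)[of y] y elim by (simp add: K_def norm_minus_commute)
            qed
            then show ?case using r by (simp add: dist_real_def)
          qed
        qed
        then have "(\<lambda>n. indicat_real (ball 0 1) x * (mollify (e n) K x - K x)\<^sup>2) \<longlonglongrightarrow> indicat_real (ball 0 1) x * (K x - K x)\<^sup>2"
          by (intro tendsto_intros)
        then show ?thesis by simp
      qed simp
    qed
    show "AE x in lborel. norm (indicat_real (ball 0 1) x * (mollify (e n) K x - K x)\<^sup>2) \<le> (4 * M\<^sup>2) * indicat_real (ball 0 1) x" for n
      using sq by (intro AE_I2) simp
  qed simp
  then have "\<forall>\<^sub>F n in sequentially. (LINT x|lborel. indicat_real (ball 0 1) x * (mollify (e n) K x - K x)\<^sup>2) < d / 6"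
    using d by (intro order_tendstoD) auto
  then show "\<forall>\<^sub>F n in sequentially. (LINT x|lborel. indicat_real (ball 0 1) x * (mollify (e n) f x - f x)\<^sup>2) < d"
  proof eventually_elim
    case (elim n)
    have pw: "indicat_real (ball 0 1) x * (mollify (e n) f x - f x)\<^sup>2 \<le>
      3 * (mollify (e n) (\<lambda>x. f x - K x) x)\<^sup>2 + 3 * (indicat_real (ball 0 1) x * (mollify (e n) K x - K x)\<^sup>2)
      + 3 * (f x - K x)\<^sup>2" for x
    proof -
      have "(a + b - c)\<^sup>2 \<le> 3 * a\<^sup>2 + 3 * b\<^sup>2 + 3 * c\<^sup>2" for a b c :: real
      proof -
        have "3 * a\<^sup>2 + 3 * b\<^sup>2 + 3 * c\<^sup>2 - (a + b - c)\<^sup>2 = (a - b)\<^sup>2 + (a + c)\<^sup>2 + (b + c)\<^sup>2"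
          by (simp add: power2_eq_square algebra_simps)
        then show ?thesis
          using zero_le_power2[of "a - b"] zero_le_power2[of "a + c"] zero_le_power2[of "b + c"] by linarith
      qed
      from this[of "mollify (e n) f x - mollify (e n) K x" "mollify (e n) K x - K x" "f x - K x"]
      show ?thesis
        by (auto simp: diff indicator_def)
    qed
    have "(LINT x|lborel. indicat_real (ball 0 1) x * (mollify (e n) f x - f x)\<^sup>2) \<le>
      (LINT x|lborel. 3 * (mollify (e n) (\<lambda>x. f x - K x) x)\<^sup>2 + 3 * (indicat_real (ball 0 1) x * (mollify (e n) K x - K x)\<^sup>2)
      + 3 * (f x - K x)\<^sup>2)"
      using pw im1 im2 fK2 by (intro integral_mono') auto
    also have "\<dots> = 3 * (LINT x|lborel. (mollify (e n) (\<lambda>x. f x - K x) x)\<^sup>2) +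
      3 * (LINT x|lborel. indicat_real (ball 0 1) x * (mollify (e n) K x - K x)\<^sup>2) + 3 * (LINT x|lborel. (f x - K x)\<^sup>2)"
      using im1 im2 fK2 by simp
    also have "\<dots> < d"
      using elim le1[of n] D unfolding K_def by linarith
    finally show ?case .
  qed
qed

text \<open>Splits \<open>mollify (e n) g\<close> into \<open>g\<close> and an error. With
  \<open>g\<close> the limit is dominated convergence, since the weights \<open>q n\<close> converge
  boundedly; the error tends to zero by the Cauchy-Schwarz inequality and mean square
  convergence.\<close>

lemma mollify_weighted_limit:
  fixes F g p :: "'a::euclidean_space \<Rightarrow> real" and q :: "nat \<Rightarrow> 'a \<Rightarrow> real"
  assumes F: "F \<in> borel_measurable borel" "integrable lborel (\<lambda>x. (F x)\<^sup>2)"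
    and g: "g \<in> borel_measurable borel" "\<And>x. x \<notin> ball 0 1 \<Longrightarrow> g x = 0" "integrable lborel (\<lambda>x. (g x)\<^sup>2)"
    and e: "\<And>n. 0 < e n" "e \<longlonglongrightarrow> 0"
    and q: "\<And>n. q n \<in> borel_measurable borel" "\<And>n x. \<bar>q n x\<bar> \<le> V" "\<And>n x. x \<notin> ball 0 1 \<Longrightarrow> q n x = 0"
      "\<And>x. (\<lambda>n. q n x) \<longlonglongrightarrow> p x"
  shows "(\<lambda>n. LINT x|lborel. F x * q n x * mollify (e n) g x) \<longlonglongrightarrow> (LINT x|lborel. F x * p x * g x)"
proof -
  have V: "V \<ge> 0" using q(2)[of 0 undefined] by simp
  have pm: "p \<in> borel_measurable borel"
    by (rule borel_measurable_LIMSEQ_real[OF q(4) q(1)])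
  define a where "a n x = F x * q n x" for n x
  define b where "b n x = indicat_real (ball 0 1) x * (mollify (e n) g x - g x)" for n x
  have mm: "mollify (e n) g \<in> borel_measurable borel" for n
    using borel_measurable_mollify[OF e(1) g(1)] .
  have gi: "integrable lborel g" by (rule integrable_L2_ball[OF g])
  have am: "a n \<in> borel_measurable borel" for n
    unfolding a_def[abs_def] using F(1) q(1) by auto
  have bm: "b n \<in> borel_measurable borel" for n
    unfolding b_def[abs_def] using mm g(1)
    by (intro borel_measurable_times borel_measurable_diff borel_measurable_indicator) auto
  have a2le: "(a n x)\<^sup>2 \<le> V\<^sup>2 * (F x)\<^sup>2" for n x
    using q(2)[of n x] V unfolding a_def power_mult_distrib
    by (subst mult.commute) (intro mult_right_mono, auto simp: abs_le_square_iff[symmetric])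
  have a2: "integrable lborel (\<lambda>x. (a n x)\<^sup>2)" for n
    by (rule Bochner_Integration.integrable_bound[where f = "\<lambda>x. V\<^sup>2 * (F x)\<^sup>2"])
      (use F(2) am a2le in auto)
  have b2: "integrable lborel (\<lambda>x. (b n x)\<^sup>2)" for n
  proof (rule Bochner_Integration.integrable_bound[where f = "\<lambda>x. 2 * (mollify (e n) g x)\<^sup>2 + 2 * (g x)\<^sup>2"])
    show "integrable lborel (\<lambda>x. 2 * (mollify (e n) g x)\<^sup>2 + 2 * (g x)\<^sup>2)"
      using integral_mollify_square_le(1)[OF e(1) gi g(3)] g(3) by simp
    have "(s - t)\<^sup>2 \<le> 2 * s\<^sup>2 + 2 * t\<^sup>2" for s t :: real
      using zero_le_power2[of "s + t"] by (simp add: power2_eq_square algebra_simps)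
    then show "AE x in lborel. norm ((b n x)\<^sup>2) \<le> norm (2 * (mollify (e n) g x)\<^sup>2 + 2 * (g x)\<^sup>2)"
      by (intro AE_I2) (auto simp: b_def indicator_def)
  qed (use bm in auto)
  have b2eq: "(LINT x|lborel. (b n x)\<^sup>2) = (LINT x|lborel. indicat_real (ball 0 1) x * (mollify (e n) g x - g x)\<^sup>2)" for n
    by (intro Bochner_Integration.integral_cong refl) (auto simp: b_def indicator_def)
  have ab0: "(\<lambda>n. LINT x|lborel. a n x * b n x) \<longlonglongrightarrow> 0"
  proof (rule Lim_null_comparison)
    show "\<forall>\<^sub>F n in sequentially. norm (LINT x|lborel. a n x * b n x) \<le>
        sqrt (V\<^sup>2 * (LINT x|lborel. (F x)\<^sup>2)) * sqrt (LINT x|lborel. indicat_real (ball 0 1) x * (mollify (e n) g x - g x)\<^sup>2)"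
    proof (intro always_eventually allI)
      fix n
      have "\<bar>LINT x|lborel. a n x * b n x\<bar> \<le> sqrt (LINT x|lborel. (a n x)\<^sup>2) * sqrt (LINT x|lborel. (b n x)\<^sup>2)"
        using am bm a2 b2 by (intro abs_integral_mult_le_L2) auto
      also have "\<dots> \<le> sqrt (V\<^sup>2 * (LINT x|lborel. (F x)\<^sup>2)) * sqrt (LINT x|lborel. (b n x)\<^sup>2)"
      proof (intro mult_right_mono real_sqrt_le_mono)
        have "(LINT x|lborel. (a n x)\<^sup>2) \<le> (LINT x|lborel. V\<^sup>2 * (F x)\<^sup>2)"
          using a2 F(2) a2le by (intro integral_mono) auto
        then show "(LINT x|lborel. (a n x)\<^sup>2) \<le> V\<^sup>2 * (LINT x|lborel. (F x)\<^sup>2)" by simp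
      qed simp
      finally show "norm (LINT x|lborel. a n x * b n x) \<le>
        sqrt (V\<^sup>2 * (LINT x|lborel. (F x)\<^sup>2)) * sqrt (LINT x|lborel. indicat_real (ball 0 1) x * (mollify (e n) g x - g x)\<^sup>2)"
        by (simp add: b2eq)
    qed
    have "(\<lambda>n. sqrt (V\<^sup>2 * (LINT x|lborel. (F x)\<^sup>2)) * sqrt (LINT x|lborel. indicat_real (ball 0 1) x * (mollify (e n) g x - g x)\<^sup>2))
      \<longlonglongrightarrow> sqrt (V\<^sup>2 * (LINT x|lborel. (F x)\<^sup>2)) * sqrt 0"
      by (intro tendsto_intros mollify_L2_tendsto[OF g e])
    then show "(\<lambda>n. sqrt (V\<^sup>2 * (LINT x|lborel. (F x)\<^sup>2)) * sqrt (LINT x|lborel. indicat_real (ball 0 1) x * (mollify (e n) g x - g x)\<^sup>2))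
      \<longlonglongrightarrow> 0" by simp
  qed
  have Fg: "integrable lborel (\<lambda>x. F x * g x)"
    using integrable_mult_L2[of F lborel g] F g by auto
  have lim: "(\<lambda>n. LINT x|lborel. a n x * g x) \<longlonglongrightarrow> (LINT x|lborel. F x * p x * g x)"
  proof (rule integral_dominated_convergence[where w = "\<lambda>x. V * \<bar>F x * g x\<bar>"])
    show "AE x in lborel. (\<lambda>n. a n x * g x) \<longlonglongrightarrow> F x * p x * g x"
      unfolding a_def by (intro AE_I2 tendsto_intros q(4))
    show "AE x in lborel. norm (a n x * g x) \<le> V * \<bar>F x * g x\<bar>" for n
    proof (rule AE_I2)
      fix x
      have "\<bar>q n x\<bar> * \<bar>F x * g x\<bar> \<le> V * \<bar>F x * g x\<bar>"
        by (intro mult_right_mono q(2)) simp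
      then show "norm (a n x * g x) \<le> V * \<bar>F x * g x\<bar>"
        by (simp add: a_def abs_mult mult_ac)
    qed
    show "integrable lborel (\<lambda>x. V * \<bar>F x * g x\<bar>)"
      using integrable_abs[OF Fg] by simp
  qed (use am F(1) pm g(1) in auto)
  have "(LINT x|lborel. F x * q n x * mollify (e n) g x) = (LINT x|lborel. a n x * g x) + (LINT x|lborel. a n x * b n x)" for n
  proof -
    have "(LINT x|lborel. F x * q n x * mollify (e n) g x) = (LINT x|lborel. a n x * g x + a n x * b n x)"
    proof (intro Bochner_Integration.integral_cong refl)
      fix x
      show "F x * q n x * mollify (e n) g x = a n x * g x + a n x * b n x"
        using q(3)[of x n] by (cases "x \<in> ball 0 1") (auto simp: a_def b_def algebra_simps)
    qed
    also have "\<dots> = (LINT x|lborel. a n x * g x) + (LINT x|lborel. a n x * b n x)"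
      using integrable_mult_L2[of "a n" lborel g] integrable_mult_L2[of "a n" lborel "b n"] am bm a2 b2 g
      by (intro Bochner_Integration.integral_add) auto
    finally show ?thesis .
  qed
  then show ?thesis
    using tendsto_add[OF lim ab0] by simp
qed

section \<open>Uniqueness for the weak Dirichlet problem\<close>

lemma mollify_uniform_limit:
  fixes v :: "'a::euclidean_space \<Rightarrow> real"
  assumes v: "continuous_on UNIV v" "\<And>x. norm x > R \<Longrightarrow> v x = 0" and d: "0 < d"
  shows "\<exists>s>0. (\<forall>x y. norm (x - y) < s \<longrightarrow> \<bar>v x - v y\<bar> < d) \<and>
    (\<forall>e x. 0 < e \<longrightarrow> e < s \<longrightarrow> \<bar>mollify e v x - v x\<bar> \<le> d)"
proof -
  \<comment> \<open>With the radius enlarged by one, a step shorter than one leads from outside this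
    ball only to points beyond \<open>R\<close>, where \<open>v\<close> vanishes.\<close>
  have "uniformly_continuous_on (cball 0 (\<bar>R\<bar> + 1)) v"
    by (intro compact_uniformly_continuous continuous_on_subset[OF v(1)]) auto
  then obtain t where t: "t > 0" "\<And>x y. norm x \<le> \<bar>R\<bar> + 1 \<Longrightarrow> norm y \<le> \<bar>R\<bar> + 1 \<Longrightarrow> dist y x < t \<Longrightarrow> dist (v y) (v x) < d"
    using d unfolding uniformly_continuous_on_def by (metis mem_cball_0)
  have uc: "\<bar>v x - v y\<bar> < d" if xy: "norm (x - y) < min t 1" for x y
  proof (cases "norm x \<le> \<bar>R\<bar> + 1 \<and> norm y \<le> \<bar>R\<bar> + 1")
    case True
    then show ?thesis
      using t(2)[of y x] xy by (simp add: dist_norm)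
  next
    case False
    have "norm x \<le> norm y + norm (x - y)" "norm y \<le> norm x + norm (x - y)"
      using norm_triangle_sub[of x y] norm_triangle_sub[of y x] by (simp_all add: norm_minus_commute)
    then have "norm x > R" "norm y > R"
      using False xy abs_ge_self[of R] by linarith+
    then show ?thesis using v(2) d by simp
  qed
  have vi: "integrable lborel v" by (rule integrable_continuous_bounded_support[OF v])
  show ?thesis
  proof (intro exI[of _ "min t 1"] conjI allI impI)
    show "0 < min t 1" using t by simp
    show "\<bar>v x - v y\<bar> < d" if "norm (x - y) < min t 1" for x y using that by (rule uc)
    show "\<bar>mollify e v x - v x\<bar> \<le> d" if "0 < e" "e < min t 1" for e x
    proof (rule mollify_close[OF that(1) vi])
      fix y assume "norm (x - y) < e"
      then show "\<bar>v y - v x\<bar> \<le> d"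
        using uc[of y x] that by (simp add: norm_minus_commute)
    qed
  qed
qed

text \<open>
  The test function is \<open>\<psi>(v\<^sub>\<epsilon>)\<close> with \<open>\<psi>(s) = max(0, s - k)\<^sup>2\<close> and \<open>v\<^sub>\<epsilon>\<close> a mollification; it vanishes
  near the sphere since \<open>v\<close> does so there. As \<open>\<epsilon> \<longrightarrow> 0\<close> the equation becomes
  \<open>\<integral> \<gamma> \<bar>\<nabla>v\<bar>\<^sup>2 \<psi>'(v) = 0\<close>, and then \<open>\<integral> \<psi>(v) = \<integral> \<psi>(v) \<partial>\<^sub>1x\<^sub>1 = - \<integral> x\<^sub>1 \<psi>'(v) \<partial>\<^sub>1v = 0\<close>.
\<close>

lemma weak_solution_nonpos:
  fixes v :: "real^3 \<Rightarrow> real" and g :: "3 \<Rightarrow> real^3 \<Rightarrow> real" and \<gamma> :: "real^3 \<Rightarrow> real"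
  assumes v: "continuous_on UNIV v" "\<And>x. norm x \<ge> 1 \<Longrightarrow> v x = 0"
    and g: "\<And>i. g i \<in> borel_measurable borel" "\<And>i x. x \<notin> ball 0 1 \<Longrightarrow> g i x = 0" "\<And>i. integrable lborel (\<lambda>x. (g i x)\<^sup>2)"
    and \<gamma>: "\<gamma> \<in> borel_measurable borel" "\<And>x. norm x < 1 \<Longrightarrow> 0 < \<gamma> x" "\<And>x. \<bar>\<gamma> x\<bar> \<le> B"
    and wg: "\<And>\<phi> d i. test_function unit_ball \<phi> d \<Longrightarrow> (LINT x|lborel. v x * d x $ i) = - (LINT x|lborel. g i x * \<phi> x)"
    and eq: "\<And>\<phi> d. test_function unit_ball \<phi> d \<Longrightarrow> (LINT x|lborel. \<gamma> x * (\<Sum>i\<in>UNIV. g i x * d x $ i)) = 0"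
  shows "v x \<le> 0"
proof (rule field_le_epsilon)
  fix k :: real assume k: "0 < k"
  have v': "norm x > 1 \<Longrightarrow> v x = 0" for x using v(2) by simp
  have vi: "integrable lborel v" by (rule integrable_continuous_bounded_support[OF v(1) v'])
  obtain V where V: "V \<ge> 0" "\<And>x. \<bar>v x\<bar> \<le> V"
  proof -
    have "compact (v ` cball 0 1)"
      by (intro compact_continuous_image continuous_on_subset[OF v(1)]) auto
    then have "bounded (v ` cball 0 1)" by (rule compact_imp_bounded)
    then obtain b where b: "\<And>x. norm x \<le> 1 \<Longrightarrow> \<bar>v x\<bar> \<le> b"
      unfolding bounded_iff by (metis imageI mem_cball_0 real_norm_def)
    have "\<bar>v x\<bar> \<le> max b 0" for x
      using b[of x] v'[of x] by (cases "norm x \<le> 1") auto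
    then show ?thesis by (intro that[of "max b 0"]) auto
  qed
  obtain s where s: "0 < s" "\<And>x y. norm (x - y) < s \<Longrightarrow> \<bar>v x - v y\<bar> < k / 2"
    "\<And>e x. 0 < e \<Longrightarrow> e < s \<Longrightarrow> \<bar>mollify e v x - v x\<bar> \<le> k / 2"
    using mollify_uniform_limit[OF v(1) v' half_gt_zero[OF k]] by blast
  \<comment> \<open>The margin keeps a collar of width \<open>2 * e n\<close> at the sphere inside
    the ball and narrower than the modulus of continuity \<open>s\<close>.\<close>
  define s1 where "s1 = min s 1 / 4"
  have s1: "0 < s1" "s1 < s" "2 * s1 < s" "2 * s1 < 1" using s(1) by (auto simp: s1_def)
  define e where "e n = s1 / real (Suc n)" for n
  have e: "0 < e n" "e n \<le> s1" for n
    using s1 by (auto simp: e_def divide_le_eq mult_le_cancel_left1)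
  have e0: "e \<longlonglongrightarrow> 0"
    unfolding e_def[abs_def] using LIMSEQ_Suc[OF lim_const_over_n] .
  define u where "u n = mollify (e n) v" for n
  define du where "du n x = (LINT y|lborel. v y *\<^sub>R grad_mollifier (e n) (x - y))" for n x
  have Du: "GDERIV (u n) x :> du n x" and cdu: "continuous_on UNIV (du n)" for n x
    unfolding u_def du_def[abs_def] using GDERIV_mollify[OF e(1) v(1) v'] by auto
  have cu: "continuous_on UNIV (u n)" for n
    by (intro continuous_at_imp_continuous_on ballI has_derivative_continuous[OF Du[unfolded gderiv_def]])
  have uV: "\<bar>u n x\<bar> \<le> V" for n x
  proof -
    have "\<bar>mollify (e n) v x - 0\<bar> \<le> V"
      by (rule mollify_close[OF e(1) vi]) (use V in simp)
    then show ?thesis by (simp add: u_def)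
  qed
  \<comment> \<open>In the collar \<open>v\<close> differs by at most \<open>k / 2\<close> from its
    value zero at the radial projection \<open>y\<close> to the sphere, and mollification costs
    another \<open>k / 2\<close>. Hence the truncation at level \<open>k\<close> is supported in a
    smaller ball.\<close>
  have uk: "u n x \<le> k" if x: "norm x \<ge> 1 - 2 * e n" for n x
  proof -
    have "\<bar>v x\<bar> \<le> k / 2"
    proof (cases "norm x \<ge> 1")
      case False
      then have x0: "norm x > 0" using x s1 e[of n] by linarith
      define y where "y = (1 / norm x) *\<^sub>R x"
      have "norm (x - y) = \<bar>1 - 1 / norm x\<bar> * norm x"
        unfolding y_def by (metis norm_scaleR scaleR_left_diff_distrib scaleR_one)
      also have "\<dots> = 1 - norm x"
        using x0 False by (simp add: abs_if field_simps)
      finally have "norm (x - y) < s" using x e(2)[of n] s1 by linarith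
      moreover have "v y = 0" using x0 by (intro v(2)) (simp add: y_def)
      ultimately show ?thesis using s(2)[of x y] by simp
    qed (use v(2) k in auto)
    moreover have "\<bar>u n x - v x\<bar> \<le> k / 2"
      unfolding u_def using e[of n] s1 by (intro s(3)) auto
    ultimately show ?thesis by linarith
  qed
  have ulim: "(\<lambda>n. u n x) \<longlonglongrightarrow> v x" for x
    unfolding tendsto_iff
  proof (intro allI impI)
    fix r :: real assume r: "0 < r"
    obtain t where t: "0 < t" "\<And>e x. 0 < e \<Longrightarrow> e < t \<Longrightarrow> \<bar>mollify e v x - v x\<bar> \<le> r / 2"
      using mollify_uniform_limit[OF v(1) v' half_gt_zero[OF r]] by blast
    have "\<forall>\<^sub>F n in sequentially. e n < t"
      using t(1) by (intro order_tendstoD[OF e0])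
    then show "\<forall>\<^sub>F n in sequentially. dist (u n x) (v x) < r"
    proof eventually_elim
      case (elim n)
      then show ?case using t(2)[OF e(1), of n x] r by (simp add: u_def dist_real_def)
    qed
  qed
  define q where "q n x = 2 * max 0 (u n x - k)" for n x
  define p where "p x = 2 * max 0 (v x - k)" for x
  have qb: "\<bar>q n x\<bar> \<le> 2 * V" for n x
    using uV[of n x] k V(1) by (auto simp: q_def max_def)
  have q0: "norm x \<ge> 1 - 2 * e n \<Longrightarrow> q n x = 0" for n x
    using uk[of n x] by (simp add: q_def)
  have q0': "x \<notin> ball 0 1 \<Longrightarrow> q n x = 0" for n x
    using q0[of n x] e(1)[of n] by simp
  have qlim: "(\<lambda>n. q n x) \<longlonglongrightarrow> p x" for x
    unfolding q_def p_def by (intro tendsto_intros ulim)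
  have cq: "continuous_on UNIV (q n)" for n
    unfolding q_def[abs_def] by (intro continuous_intros cu)
  have qm: "q n \<in> borel_measurable borel" for n
    by (rule borel_measurable_continuous_onI[OF cq])
  have Dpsi: "GDERIV (\<lambda>x. (max 0 (u n x - k))\<^sup>2) x :> q n x *\<^sub>R du n x" for n x
  proof -
    have "GDERIV (\<lambda>x. u n x - k) x :> du n x"
      using GDERIV_diff[OF Du GDERIV_const[of k]] by simp
    from GDERIV_DERIV_compose[OF this has_real_derivative_pos_part_square] show ?thesis
      by (simp add: q_def)
  qed
  \<comment> \<open>The collar is twice as wide as the mollification radius: where
    \<open>q n\<close> is nonzero, the ball of radius \<open>e n\<close> about \<open>x\<close> lies
    inside the unit ball, and there the weak gradient commutes with mollification.\<close>
  have qdu: "q n x * du n x $ i = q n x * mollify (e n) (g i) x" for n x i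
  proof (cases "norm x \<ge> 1 - 2 * e n")
    case False
    then have "norm x + e n < 1" using e(1)[of n] by linarith
    from weak_gradient_mollify[where i = i, OF e(1) this v(1) v' wg]
    show ?thesis by (simp add: du_def)
  qed (simp add: q0)
  have test: "test_function unit_ball (\<lambda>x. (max 0 (u n x - k))\<^sup>2) (\<lambda>x. q n x *\<^sub>R du n x)" for n
    unfolding test_function_def
  proof (intro conjI allI exI impI)
    show "GDERIV (\<lambda>x. (max 0 (u n x - k))\<^sup>2) x :> q n x *\<^sub>R du n x" for x by (rule Dpsi)
    show "continuous_on UNIV (\<lambda>x. q n x *\<^sub>R du n x)" by (intro continuous_intros cq cdu)
    show "compact (cball (0::real^3) (1 - 2 * e n))" by simp
    show "cball 0 (1 - 2 * e n) \<subseteq> unit_ball" using e(1)[of n] by auto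
    show "(max 0 (u n x - k))\<^sup>2 = 0" if "x \<notin> cball 0 (1 - 2 * e n)" for x
      using that uk[of n x] by simp
  qed
  have Fm: "(\<lambda>x. \<gamma> x * g i x) \<in> borel_measurable borel" for i
    using \<gamma>(1) g(1) by auto
  have F2: "integrable lborel (\<lambda>x. (\<gamma> x * g i x)\<^sup>2)" for i
  proof (rule Bochner_Integration.integrable_bound[where f = "\<lambda>x. B\<^sup>2 * (g i x)\<^sup>2"])
    have "(\<gamma> x)\<^sup>2 \<le> B\<^sup>2" for x
      using \<gamma>(3)[of x] by (simp add: abs_le_square_iff[symmetric])
    then show "AE x in lborel. norm ((\<gamma> x * g i x)\<^sup>2) \<le> norm (B\<^sup>2 * (g i x)\<^sup>2)"
      by (intro AE_I2) (simp add: power_mult_distrib mult_right_mono)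
  qed (use g(3) Fm in auto)
  have lim1: "(\<lambda>n. LINT x|lborel. (\<gamma> x * g i x) * q n x * mollify (e n) (g i) x) \<longlonglongrightarrow> (LINT x|lborel. (\<gamma> x * g i x) * p x * g i x)" for i
    by (rule mollify_weighted_limit[OF Fm F2 g e(1) e0 qm qb q0' qlim])
  have pm: "p \<in> borel_measurable borel"
    by (rule borel_measurable_LIMSEQ_real[OF qlim qm])
  have pb: "\<bar>p x\<bar> \<le> 2 * V" for x
    using V(2)[of x] k V(1) by (auto simp: p_def max_def)
  have pn: "p x \<ge> 0" for x by (simp add: p_def)
  have int1: "integrable lborel (\<lambda>x. a x * q x * b x)"
    if "a \<in> borel_measurable borel" "integrable lborel (\<lambda>x. (a x)\<^sup>2)" "b \<in> borel_measurable borel" "integrable lborel (\<lambda>x. (b x)\<^sup>2)"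
      "q \<in> borel_measurable borel" "\<And>x. \<bar>q x\<bar> \<le> 2 * V" for a b q :: "real^3 \<Rightarrow> real"
  proof (rule Bochner_Integration.integrable_bound[where f = "\<lambda>x. (2 * V) * (a x * b x)"])
    show "integrable lborel (\<lambda>x. (2 * V) * (a x * b x))"
      using integrable_mult_L2[of a lborel b] that by auto
    show "AE x in lborel. norm (a x * q x * b x) \<le> norm (2 * V * (a x * b x))"
    proof (rule AE_I2)
      fix x
      have "\<bar>q x\<bar> * \<bar>a x * b x\<bar> \<le> (2 * V) * \<bar>a x * b x\<bar>"
        by (intro mult_right_mono that) simp
      then show "norm (a x * q x * b x) \<le> norm (2 * V * (a x * b x))"
        using V(1) by (simp add: abs_mult mult_ac)
    qed
  qed (use that in auto)
  have gi: "integrable lborel (g i)" for i by (rule integrable_L2_ball[OF g])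
  have mg: "mollify (e n) (g i) \<in> borel_measurable borel" "integrable lborel (\<lambda>x. (mollify (e n) (g i) x)\<^sup>2)" for n i
    using borel_measurable_mollify[OF e(1) g(1)] integral_mollify_square_le(1)[OF e(1) gi g(3)] by auto
  have "(\<Sum>i\<in>UNIV. LINT x|lborel. (\<gamma> x * g i x) * q n x * mollify (e n) (g i) x) = 0" for n
  proof -
    have "(\<Sum>i\<in>UNIV. LINT x|lborel. (\<gamma> x * g i x) * q n x * mollify (e n) (g i) x)
      = (LINT x|lborel. (\<Sum>i\<in>UNIV. (\<gamma> x * g i x) * q n x * mollify (e n) (g i) x))"
      by (intro Bochner_Integration.integral_sum[symmetric] int1[OF Fm F2 mg qm qb])
    also have "\<dots> = (LINT x|lborel. \<gamma> x * (\<Sum>i\<in>UNIV. g i x * (q n x *\<^sub>R du n x) $ i))"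
      by (intro Bochner_Integration.integral_cong refl) (simp add: sum_distrib_left mult.assoc qdu)
    also have "\<dots> = 0" by (rule eq[OF test])
    finally show ?thesis .
  qed
  moreover have "(\<lambda>n. \<Sum>i\<in>UNIV. LINT x|lborel. (\<gamma> x * g i x) * q n x * mollify (e n) (g i) x)
     \<longlonglongrightarrow> (\<Sum>i\<in>UNIV. LINT x|lborel. (\<gamma> x * g i x) * p x * g i x)"
    by (intro tendsto_sum lim1)
  ultimately have sum0: "(\<Sum>i\<in>UNIV. LINT x|lborel. (\<gamma> x * g i x) * p x * g i x) = 0"
    by (simp add: LIMSEQ_const_iff)
  have nn: "0 \<le> (\<gamma> x * g i x) * p x * g i x" for x i
  proof (cases "norm x < 1")
    case True
    have eq2: "(\<gamma> x * g i x) * p x * g i x = \<gamma> x * p x * (g i x)\<^sup>2" by (simp add: power2_eq_square)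
    show ?thesis unfolding eq2 using \<gamma>(2)[OF True] pn[of x] by simp
  qed (simp add: g(2))
  \<comment> \<open>The three integrals are nonnegative with sum zero, so each of them vanishes;
    since \<open>\<gamma>\<close> is positive in the ball, \<open>p\<close> annihilates the gradient
    almost everywhere.\<close>
  have "(LINT x|lborel. (\<gamma> x * g i x) * p x * g i x) = 0" for i
    using sum0 by (subst (asm) sum_nonneg_eq_0_iff) (auto intro!: integral_nonneg_AE AE_I2 nn)
  then have AE0: "AE x in lborel. (\<gamma> x * g i x) * p x * g i x = 0" for i
    using integral_nonneg_eq_0_iff_AE[OF int1[OF Fm F2 g(1) g(3) pm pb, of i i]] nn by simp
  have pg: "AE x in lborel. p x * g i x = 0" for i
    using AE0[of i]
  proof eventually_elim
    case (elim x)
    then show ?case using \<gamma>(2)[of x] g(2)[of x i] by (cases "norm x < 1") auto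
  qed
  \<comment> \<open>The coordinate is cut off to be square integrable; \<open>q n\<close> vanishes
    outside the ball, so the products are still those with \<open>x $ 1\<close>.\<close>
  define X where "X x = indicat_real (ball 0 1) x * x $ 1" for x :: "real^3"
  have Xm: "X \<in> borel_measurable borel"
    unfolding X_def[abs_def] by (intro borel_measurable_times borel_measurable_indicator borel_measurable_continuous_onI continuous_intros) auto
  have X2: "integrable lborel (\<lambda>x. (X x)\<^sup>2)"
  proof (rule Bochner_Integration.integrable_bound[where f = "\<lambda>x. 1 * indicat_real (cball 0 1) x", OF integrable_indicator_cball])
    have "(X x)\<^sup>2 \<le> indicat_real (cball 0 1) x" for x
      using component_le_norm_cart[of x 1] abs_le_square_iff[of "x $ 1" 1]
      by (auto simp: X_def indicator_def)
    then show "AE x in lborel. norm ((X x)\<^sup>2) \<le> norm (1 * indicat_real (cball 0 1) x)"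
      by (intro AE_I2) auto
  qed (use Xm in auto)
  have "(\<lambda>n. LINT x|lborel. X x * q n x * mollify (e n) (g 1) x) \<longlonglongrightarrow> (LINT x|lborel. X x * p x * g 1 x)"
    by (rule mollify_weighted_limit[OF Xm X2 g e(1) e0 qm qb q0' qlim])
  also have "(LINT x|lborel. X x * p x * g 1 x) = 0"
    by (rule integral_eq_zero_AE) (use pg[of 1] in eventually_elim, simp add: mult.assoc)
  finally have limX: "(\<lambda>n. LINT x|lborel. X x * q n x * mollify (e n) (g 1) x) \<longlonglongrightarrow> 0" .
  have psi_int: "integrable lborel (\<lambda>x. (max 0 (u n x - k))\<^sup>2)" for n
  proof (rule integrable_continuous_bounded_support)
    show "continuous_on UNIV (\<lambda>x. (max 0 (u n x - k))\<^sup>2)" by (intro continuous_intros cu)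
    show "(max 0 (u n x - k))\<^sup>2 = 0" if "norm x > 1" for x
      using uk[of n x] e(1)[of n] that by simp
  qed
  have ibp: "(LINT x|lborel. (max 0 (u n x - k))\<^sup>2) = - (LINT x|lborel. X x * q n x * mollify (e n) (g 1) x)" for n
  proof -
    have int2: "integrable lborel (\<lambda>x. X x * q n x * mollify (e n) (g 1) x)"
      by (rule int1[OF Xm X2 mg qm qb])
    have "(LINT x|lborel. (max 0 (u n x - k))\<^sup>2 + x $ 1 * (q n x * du n x $ 1)) = 0"
    proof (rule has_bochner_integral_integral_eq[OF integral_directional_derivative_zero[where f = "\<lambda>x. x $ 1 * (max 0 (u n x - k))\<^sup>2" and e = "axis 1 1" and R = 1]])
      show "lipschitz_on_bounded (\<lambda>x. x $ 1 * (max 0 (u n x - k))\<^sup>2)"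
        by (intro lipschitz_on_bounded_mult lipschitz_on_bounded_nth lipschitz_on_bounded_GDERIV[OF Dpsi] continuous_intros cq cdu)
      show "1 < norm x \<Longrightarrow> x $ 1 * (max 0 (u n x - k))\<^sup>2 = 0" for x
        using uk[of n x] e(1)[of n] by simp
      show "AE x in lborel. ((\<lambda>t. (x + t *\<^sub>R axis 1 1) $ 1 * (max 0 (u n (x + t *\<^sub>R axis 1 1) - k))\<^sup>2) has_vector_derivative
          (max 0 (u n x - k))\<^sup>2 + x $ 1 * (q n x * du n x $ 1)) (at 0)"
      proof (rule AE_I2)
        fix x :: "real^3"
        have l: "((\<lambda>t. x + t *\<^sub>R axis 1 1) has_derivative (\<lambda>t. t *\<^sub>R axis 1 1)) (at 0)"
          by (auto intro!: derivative_eq_intros)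
        have 1: "((\<lambda>t. (max 0 (u n (x + t *\<^sub>R axis 1 1) - k))\<^sup>2) has_derivative (\<lambda>t. (t *\<^sub>R axis 1 1) \<bullet> (q n x *\<^sub>R du n x))) (at 0)"
          using Dpsi[of n x] unfolding gderiv_def
          by (intro has_derivative_compose[OF l, where g = "\<lambda>x. (max 0 (u n x - k))\<^sup>2"]) simp
        have 2: "((\<lambda>t. (x + t *\<^sub>R axis 1 1) $ 1) has_derivative (\<lambda>t. t)) (at 0)"
          using bounded_linear.has_derivative[OF bounded_linear_vec_nth l, of 1] by (simp add: axis_def)
        from has_derivative_mult[OF 2 1]
        show "((\<lambda>t. (x + t *\<^sub>R axis 1 1) $ 1 * (max 0 (u n (x + t *\<^sub>R axis 1 1) - k))\<^sup>2) has_vector_derivative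
          (max 0 (u n x - k))\<^sup>2 + x $ 1 * (q n x * du n x $ 1)) (at 0)"
          by (simp add: has_vector_derivative_def inner_axis' algebra_simps)
      qed
      show "(\<lambda>x. (max 0 (u n x - k))\<^sup>2 + x $ 1 * (q n x * du n x $ 1)) \<in> borel_measurable borel"
        by (intro borel_measurable_continuous_onI continuous_intros cu cq cdu)
    qed
    also have "(LINT x|lborel. (max 0 (u n x - k))\<^sup>2 + x $ 1 * (q n x * du n x $ 1)) =
        (LINT x|lborel. (max 0 (u n x - k))\<^sup>2 + X x * q n x * mollify (e n) (g 1) x)"
    proof (intro Bochner_Integration.integral_cong refl)
      fix x
      show "(max 0 (u n x - k))\<^sup>2 + x $ 1 * (q n x * du n x $ 1) = (max 0 (u n x - k))\<^sup>2 + X x * q n x * mollify (e n) (g 1) x"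
        using qdu[of n x 1] q0'[of x n] by (cases "x \<in> ball 0 1") (auto simp: X_def)
    qed
    finally show ?thesis
      using psi_int int2 by simp
  qed
  have "(\<lambda>n. LINT x|lborel. (max 0 (u n x - k))\<^sup>2) \<longlonglongrightarrow> (LINT x|lborel. (max 0 (v x - k))\<^sup>2)"
  proof (rule integral_dominated_convergence[where w = "\<lambda>x. V\<^sup>2 * indicat_real (cball 0 1) x", OF _ _ integrable_indicator_cball])
    show "AE x in lborel. (\<lambda>n. (max 0 (u n x - k))\<^sup>2) \<longlonglongrightarrow> (max 0 (v x - k))\<^sup>2"
      by (intro AE_I2 tendsto_intros ulim)
    show "AE x in lborel. norm ((max 0 (u n x - k))\<^sup>2) \<le> V\<^sup>2 * indicat_real (cball 0 1) x" for n
    proof (rule AE_I2)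
      fix x
      have "\<bar>max 0 (u n x - k)\<bar> \<le> \<bar>V\<bar>" using uV[of n x] k V(1) by (auto simp: max_def)
      then have "(max 0 (u n x - k))\<^sup>2 \<le> V\<^sup>2" unfolding abs_le_square_iff .
      then show "norm ((max 0 (u n x - k))\<^sup>2) \<le> V\<^sup>2 * indicat_real (cball 0 1) x"
        using uk[of n x] e(1)[of n] by (cases "norm x \<le> 1") (auto simp: max_def)
    qed
    show "(\<lambda>x. (max 0 (v x - k))\<^sup>2) \<in> borel_measurable lborel"
      by (simp, intro borel_measurable_continuous_onI continuous_intros v)
    show "(\<lambda>x. (max 0 (u n x - k))\<^sup>2) \<in> borel_measurable lborel" for n
      by (simp, intro borel_measurable_continuous_onI continuous_intros cu)
  qed
  then have "(\<lambda>n. - (LINT x|lborel. X x * q n x * mollify (e n) (g 1) x)) \<longlonglongrightarrow> (LINT x|lborel. (max 0 (v x - k))\<^sup>2)"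
    by (simp only: ibp)
  moreover have "(\<lambda>n. - (LINT x|lborel. X x * q n x * mollify (e n) (g 1) x)) \<longlonglongrightarrow> - 0"
    by (intro tendsto_minus limX)
  ultimately have "(LINT x|lborel. (max 0 (v x - k))\<^sup>2) = 0"
    using LIMSEQ_unique by fastforce
  moreover have ct: "continuous_on UNIV (\<lambda>x. (max 0 (v x - k))\<^sup>2)"
    by (intro continuous_intros v)
  moreover have "integrable lborel (\<lambda>x. (max 0 (v x - k))\<^sup>2)"
    by (rule integrable_continuous_bounded_support[OF ct, of 1]) (use v' k in simp)
  ultimately have "AE x in lborel. (max 0 (v x - k))\<^sup>2 = 0"
    using integral_nonneg_eq_0_iff_AE[of lborel "\<lambda>x. (max 0 (v x - k))\<^sup>2"] by simp
  from AE_lborel_zero_imp_zero[OF ct this, of x]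
  show "v x \<le> 0 + k" by (simp add: max_def split: if_splits)
qed

text \<open>The gradient in \<open>dirichlet_solution\<close> is only Lebesgue measurable on the
  ball. Changing it on a null set and extending it by zero gives Borel functions on the whole space,
  to which the mollification estimates apply.\<close>

lemma lebesgue_on_ball_borel_representative:
  fixes h :: "'a::euclidean_space \<Rightarrow> complex"
  assumes h: "h \<in> borel_measurable (lebesgue_on (ball 0 1))"
    and h2: "integrable (lebesgue_on (ball 0 1)) (\<lambda>x. (norm (h x))\<^sup>2)"
  obtains b where "b \<in> borel_measurable borel" "\<And>x. x \<notin> ball 0 1 \<Longrightarrow> b x = 0"
    "integrable lborel (\<lambda>x. (norm (b x))\<^sup>2)" "AE x in lborel. x \<in> ball 0 1 \<longrightarrow> h x = b x"
proof -
  define H where "H x = (if x \<in> ball 0 1 then h x else 0)" for x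
  have Hm: "H \<in> borel_measurable lebesgue"
    unfolding H_def[abs_def] using h by (subst borel_measurable_if) auto
  have "(\<lambda>x. Re (H x)) \<in> borel_measurable lebesgue" "(\<lambda>x. Im (H x)) \<in> borel_measurable lebesgue"
    using Hm by auto
  from this[THEN completion_ex_borel_measurable_real]
  obtain p q where pq: "p \<in> borel_measurable lborel" "q \<in> borel_measurable lborel"
    and ae: "AE x in lborel. Re (H x) = p x" "AE x in lborel. Im (H x) = q x"
    by blast
  define b where "b x = indicat_real (ball 0 1) x *\<^sub>R Complex (p x) (q x)" for x
  have bm: "b \<in> borel_measurable borel"
    unfolding b_def[abs_def] Complex_eq using pq
    by (intro borel_measurable_scaleR borel_measurable_indicator borel_measurable_add borel_measurable_times) auto
  have Hb: "AE x in lborel. H x = b x"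
    using ae by eventually_elim (auto simp: b_def H_def complex_eq_iff indicator_def)
  have "integrable lebesgue (\<lambda>x. (norm (H x))\<^sup>2)"
  proof -
    have "integrable lebesgue (\<lambda>x. indicat_real (ball 0 1) x *\<^sub>R (norm (h x))\<^sup>2)"
      using h2 by (simp add: integrable_restrict_space)
    moreover have "(\<lambda>x. indicat_real (ball 0 1) x *\<^sub>R (norm (h x))\<^sup>2) = (\<lambda>x. (norm (H x))\<^sup>2)"
      by (auto simp: H_def indicator_def)
    ultimately show ?thesis by simp
  qed
  moreover have "AE x in lebesgue. (norm (H x))\<^sup>2 = (norm (b x))\<^sup>2"
    using AE_completion[OF Hb] by eventually_elim simp
  moreover have bm2: "(\<lambda>x. (norm (b x))\<^sup>2) \<in> borel_measurable lborel"
    using bm by simp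
  ultimately have "integrable lebesgue (\<lambda>x. (norm (b x))\<^sup>2)"
    using measurable_completion[OF bm2] borel_measurable_integrable
    by (subst (asm) integrable_cong_AE) (use Hm in auto)
  then have "integrable lborel (\<lambda>x. (norm (b x))\<^sup>2)"
    using integrable_completion[OF bm2] by simp
  moreover have "AE x in lborel. x \<in> ball 0 1 \<longrightarrow> h x = b x"
    using Hb by eventually_elim (auto simp: H_def)
  ultimately show ?thesis
    using bm by (intro that[of b]) (auto simp: b_def)
qed

lemma integral_lebesgue_on_ball_eq_lborel:
  fixes f g :: "'a::euclidean_space \<Rightarrow> 'b::euclidean_space"
  assumes f: "f \<in> borel_measurable (lebesgue_on (ball 0 1))"
    and g: "g \<in> borel_measurable borel" "\<And>x. x \<notin> ball 0 1 \<Longrightarrow> g x = 0"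
    and ae: "AE x in lborel. x \<in> ball 0 1 \<longrightarrow> f x = g x"
  shows "integral\<^sup>L (lebesgue_on (ball 0 1)) f = integral\<^sup>L lborel g"
proof -
  have "integral\<^sup>L (lebesgue_on (ball 0 1)) f = (LINT x|lebesgue. indicat_real (ball 0 1) x *\<^sub>R f x)"
    by (rule integral_restrict_space) auto
  also have "\<dots> = integral\<^sup>L lebesgue g"
  proof (rule integral_cong_AE)
    show "(\<lambda>x. indicat_real (ball 0 1) x *\<^sub>R f x) \<in> borel_measurable lebesgue"
      using f by (subst (asm) borel_measurable_restrict_space_iff) auto
    show "g \<in> borel_measurable lebesgue"
      using g by (intro measurable_completion) simp
    show "AE x in lebesgue. indicat_real (ball 0 1) x *\<^sub>R f x = g x"
      using AE_completion[OF ae] by eventually_elim (auto simp: indicator_def g(2))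
  qed
  also have "\<dots> = integral\<^sup>L lborel g"
    using g by (intro integral_completion) simp
  finally show ?thesis .
qed

lemma test_functionD:
  assumes "test_function unit_ball \<phi> d"
  shows "\<And>x. GDERIV \<phi> x :> d x" "continuous_on UNIV d" "continuous_on UNIV \<phi>"
    "\<And>x. norm x \<ge> 1 \<Longrightarrow> \<phi> x = 0" "\<And>x. norm x \<ge> 1 \<Longrightarrow> d x = 0"
proof -
  show gd: "\<And>x. GDERIV \<phi> x :> d x" and "continuous_on UNIV d"
    using assms by (auto simp: test_function_def)
  show "continuous_on UNIV \<phi>"
    by (intro continuous_at_imp_continuous_on ballI has_derivative_continuous[OF gd[unfolded gderiv_def]])
  obtain K where K: "compact K" "K \<subseteq> unit_ball" "\<And>x. x \<notin> K \<Longrightarrow> \<phi> x = 0"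
    using assms by (auto simp: test_function_def)
  show "norm x \<ge> 1 \<Longrightarrow> \<phi> x = 0" for x
    using K(2) by (intro K(3)) auto
  show "d x = 0" if "norm x \<ge> 1" for x
  proof -
    \<comment> \<open>The support is compact in the open ball, so \<open>\<phi>\<close> vanishes in
      a whole neighbourhood of \<open>x\<close>, also when \<open>x\<close> is on the
      sphere.\<close>
    have op: "open (- K)" using compact_imp_closed[OF K(1)] by auto
    have "(\<phi> has_derivative (\<lambda>h. 0)) (at x)"
    proof (rule has_derivative_transform_within_open[of "\<lambda>_. 0", OF _ op])
      show "x \<in> - K" using K(2) that by auto
    qed (use K(3) in auto)
    then have "(\<lambda>h. h \<bullet> d x) = (\<lambda>h. 0)"
      using has_derivative_unique gd[of x] unfolding gderiv_def by blast
    then have "d x \<bullet> d x = 0" by meson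
    then show ?thesis by simp
  qed
qed

lemma test_function_bounded:
  assumes "test_function unit_ball \<phi> d"
  obtains B where "B \<ge> 0" "\<And>x. \<bar>\<phi> x\<bar> \<le> B" "\<And>x i. \<bar>d x $ i\<bar> \<le> B"
proof -
  note T = test_functionD[OF assms]
  have "bounded (\<phi> ` cball 0 1)" "bounded (d ` cball 0 1)"
    by (intro compact_imp_bounded compact_continuous_image continuous_on_subset[OF T(3)] continuous_on_subset[OF T(2)]; simp)+
  then obtain a b where ab: "\<And>x. norm x \<le> 1 \<Longrightarrow> norm (\<phi> x) \<le> a" "\<And>x. norm x \<le> 1 \<Longrightarrow> norm (d x) \<le> b"
    unfolding bounded_iff by (metis imageI mem_cball_0)
  show ?thesis
  proof (rule that[of "max (max a b) 0"])
    show "\<bar>\<phi> x\<bar> \<le> max (max a b) 0" for x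
      using ab(1)[of x] T(4)[of x] by (cases "norm x \<le> 1") auto
    show "\<bar>d x $ i\<bar> \<le> max (max a b) 0" for x i
      using ab(2)[of x] T(5)[of x] component_le_norm_cart[of "d x" i] by (cases "norm x \<le> 1") auto
  qed simp
qed

lemma integrable_L2_mult_bounded:
  fixes b :: "'a::euclidean_space \<Rightarrow> complex" and c :: "'a \<Rightarrow> real"
  assumes b: "b \<in> borel_measurable borel" "\<And>x. x \<notin> ball 0 1 \<Longrightarrow> b x = 0" "integrable lborel (\<lambda>x. (norm (b x))\<^sup>2)"
    and c: "c \<in> borel_measurable borel" "\<And>x. \<bar>c x\<bar> \<le> B"
  shows "integrable lborel (\<lambda>x. b x * of_real (c x))"
proof (rule Bochner_Integration.integrable_bound[where f = "\<lambda>x. B * norm (b x)"])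
  show "integrable lborel (\<lambda>x. B * norm (b x))"
    using integrable_L2_ball[of "\<lambda>x. norm (b x)"] b by auto
  have "0 \<le> B" using c(2)[of 0] by simp
  then show "AE x in lborel. norm (b x * of_real (c x)) \<le> norm (B * norm (b x))"
    using c(2) by (intro AE_I2) (simp add: norm_mult mult.commute mult_right_mono)
qed (use b c in auto)

text \<open>\<open>\<gamma>\<close> may be arbitrary outside the ball, so the equation is rewritten
  with a Borel function \<open>\<gamma>'\<close> that agrees with it inside, and with Borel
  gradients extended by zero.\<close>

lemma dirichlet_solution_borel_gradient:
  assumes u: "dirichlet_solution \<gamma> f u"
    and \<gamma>: "\<gamma>' \<in> borel_measurable borel" "\<And>x. norm x < 1 \<Longrightarrow> \<gamma> x = \<gamma>' x" 
  obtains b where "\<And>i::3. b i \<in> borel_measurable borel" "\<And>i x. x \<notin> ball 0 1 \<Longrightarrow> b i x = 0"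
    "\<And>i. integrable lborel (\<lambda>x. (norm (b i x))\<^sup>2)"
    "\<And>\<phi> d i. test_function unit_ball \<phi> d \<Longrightarrow>
       (LINT x|lborel. indicat_real (ball 0 1) x *\<^sub>R (u x * of_real (d x $ i))) = - (LINT x|lborel. b i x * of_real (\<phi> x))"
    "\<And>\<phi> d. test_function unit_ball \<phi> d \<Longrightarrow>
       (LINT x|lborel. of_real (\<gamma>' x) * (\<Sum>i\<in>UNIV. b i x * of_real (d x $ i))) = 0"
proof -
  obtain G where G: "G \<in> borel_measurable (lebesgue_on unit_ball)" "integrable (lebesgue_on unit_ball) (\<lambda>x. (norm (G x))\<^sup>2)"
    and wg: "\<And>\<phi> d i. test_function unit_ball \<phi> d \<Longrightarrow>
        (LINT x|lebesgue_on unit_ball. u x * of_real (d x $ i)) = - (LINT x|lebesgue_on unit_ball. G x $ i * of_real (\<phi> x))"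
    and eq: "\<And>\<phi> d. test_function unit_ball \<phi> d \<Longrightarrow>
           (LINT x|lebesgue_on unit_ball. of_real (\<gamma> x) * (\<Sum>i\<in>UNIV. G x $ i * of_real (d x $ i))) = 0"
    using u unfolding dirichlet_solution_def square_integrable_on_def weak_gradient_def by blast
  have Gi: "(\<lambda>x. G x $ i) \<in> borel_measurable (lebesgue_on unit_ball)" for i
    by (rule measurable_compose[OF G(1)]) (intro borel_measurable_continuous_onI continuous_intros)
  have Gi2: "integrable (lebesgue_on unit_ball) (\<lambda>x. (norm (G x $ i))\<^sup>2)" for i
  proof (rule Bochner_Integration.integrable_bound[OF G(2)])
    show "AE x in lebesgue_on unit_ball. norm ((norm (G x $ i))\<^sup>2) \<le> norm ((norm (G x))\<^sup>2)"
      by (intro AE_I2) (simp add: power_mono Finite_Cartesian_Product.norm_nth_le)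
  qed (use Gi in auto)
  have "\<forall>i::3. \<exists>b. b \<in> borel_measurable borel \<and> (\<forall>x. x \<notin> ball 0 1 \<longrightarrow> b x = 0) \<and>
    integrable lborel (\<lambda>x. (norm (b x))\<^sup>2) \<and> (AE x in lborel. x \<in> ball 0 1 \<longrightarrow> G x $ i = b x)"
  proof
    fix i :: 3
    obtain b where "b \<in> borel_measurable borel" "\<And>x. x \<notin> ball 0 1 \<Longrightarrow> b x = 0"
      "integrable lborel (\<lambda>x. (norm (b x))\<^sup>2)" "AE x in lborel. x \<in> ball 0 1 \<longrightarrow> G x $ i = b x"
      by (rule lebesgue_on_ball_borel_representative[OF Gi[of i] Gi2[of i]]) blast
    then show "\<exists>b. b \<in> borel_measurable borel \<and> (\<forall>x. x \<notin> ball 0 1 \<longrightarrow> b x = 0) \<and>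
      integrable lborel (\<lambda>x. (norm (b x))\<^sup>2) \<and> (AE x in lborel. x \<in> ball 0 1 \<longrightarrow> G x $ i = b x)"
      by blast
  qed
  then have "\<exists>b. \<forall>i::3. b i \<in> borel_measurable borel \<and> (\<forall>x. x \<notin> ball 0 1 \<longrightarrow> b i x = 0) \<and>
    integrable lborel (\<lambda>x. (norm (b i x))\<^sup>2) \<and> (AE x in lborel. x \<in> ball 0 1 \<longrightarrow> G x $ i = b i x)"
    by (rule choice)
  then obtain b where b: "\<And>i::3. b i \<in> borel_measurable borel" "\<And>i x. x \<notin> ball 0 1 \<Longrightarrow> b i x = 0"
    "\<And>i. integrable lborel (\<lambda>x. (norm (b i x))\<^sup>2)" "\<And>i. AE x in lborel. x \<in> ball 0 1 \<longrightarrow> G x $ i = b i x"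
    by blast
  have cu: "continuous_on (cball 0 1) u" using u by (simp add: dirichlet_solution_def)
  have bl: "f \<in> borel_measurable (lebesgue_on unit_ball)" if "f \<in> borel_measurable borel" for f :: "real^3 \<Rightarrow> complex"
    using that by (simp add: measurable_completion measurable_restrict_space1)
  show ?thesis
  proof (rule that[of b])
    fix \<phi> d assume t: "test_function unit_ball \<phi> d"
    note T = test_functionD[OF t]
    have dm: "(\<lambda>x. complex_of_real (d x $ i)) \<in> borel_measurable borel" for i
      by (intro borel_measurable_continuous_onI continuous_intros T)
    have pm: "(\<lambda>x. complex_of_real (\<phi> x)) \<in> borel_measurable borel"
      by (intro borel_measurable_continuous_onI continuous_intros T)
    show "(LINT x|lborel. indicat_real (ball 0 1) x *\<^sub>R (u x * of_real (d x $ i))) = - (LINT x|lborel. b i x * of_real (\<phi> x))" for i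
    proof -
      have um: "(\<lambda>x. indicat_real (ball 0 1) x *\<^sub>R (u x * of_real (d x $ i))) \<in> borel_measurable borel"
      proof -
        have "continuous_on (ball 0 1) (\<lambda>x. u x * of_real (d x $ i))"
          by (intro continuous_intros continuous_on_subset[OF cu] continuous_on_subset[OF T(2)]) auto
        then show ?thesis
          by (intro borel_measurable_continuous_on_indicator) auto
      qed
      have "(LINT x|lebesgue_on unit_ball. u x * of_real (d x $ i)) =
          (LINT x|lborel. indicat_real (ball 0 1) x *\<^sub>R (u x * of_real (d x $ i)))"
      proof (rule integral_lebesgue_on_ball_eq_lborel)
        have "(\<lambda>x. indicat_real (ball 0 1) x *\<^sub>R (u x * of_real (d x $ i))) \<in> borel_measurable (lebesgue_on unit_ball)"
          by (rule bl[OF um])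
        then show "(\<lambda>x. u x * of_real (d x $ i)) \<in> borel_measurable (lebesgue_on unit_ball)"
          by (rule measurable_cong[THEN iffD1, rotated]) auto
      qed (use um in auto)
      moreover have "(LINT x|lebesgue_on unit_ball. G x $ i * of_real (\<phi> x)) = (LINT x|lborel. b i x * of_real (\<phi> x))"
      proof (rule integral_lebesgue_on_ball_eq_lborel)
        show "(\<lambda>x. G x $ i * of_real (\<phi> x)) \<in> borel_measurable (lebesgue_on unit_ball)"
          by (intro borel_measurable_times Gi bl[OF pm])
        show "AE x in lborel. x \<in> unit_ball \<longrightarrow> G x $ i * of_real (\<phi> x) = b i x * of_real (\<phi> x)"
          using b(4)[of i] by eventually_elim auto
      qed (use b pm in auto)
      ultimately show ?thesis using wg[OF t, of i] by simp
    qed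
    show "(LINT x|lborel. of_real (\<gamma>' x) * (\<Sum>i\<in>UNIV. b i x * of_real (d x $ i))) = 0"
    proof -
      have gm: "(\<lambda>x. complex_of_real (\<gamma>' x)) \<in> borel_measurable borel"
        using \<gamma>(1) by simp
      have "(LINT x|lebesgue_on unit_ball. of_real (\<gamma> x) * (\<Sum>i\<in>UNIV. G x $ i * of_real (d x $ i))) =
        (LINT x|lebesgue_on unit_ball. of_real (\<gamma>' x) * (\<Sum>i\<in>UNIV. G x $ i * of_real (d x $ i)))"
        by (intro Bochner_Integration.integral_cong refl) (simp add: \<gamma>(2))
      also have "\<dots> = (LINT x|lborel. of_real (\<gamma>' x) * (\<Sum>i\<in>UNIV. b i x * of_real (d x $ i)))"
      proof (rule integral_lebesgue_on_ball_eq_lborel)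
        show "(\<lambda>x. of_real (\<gamma>' x) * (\<Sum>i\<in>UNIV. G x $ i * of_real (d x $ i))) \<in> borel_measurable (lebesgue_on unit_ball)"
          by (intro borel_measurable_times borel_measurable_sum Gi bl[OF gm] bl[OF dm])
        show "(\<lambda>x. of_real (\<gamma>' x) * (\<Sum>i\<in>UNIV. b i x * of_real (d x $ i))) \<in> borel_measurable borel"
          by (intro borel_measurable_times borel_measurable_sum gm dm b)
        have "AE x in lborel. \<forall>i. x \<in> unit_ball \<longrightarrow> G x $ i = b i x"
          using b(4) by (subst AE_all_countable) auto
        then show "AE x in lborel. x \<in> unit_ball \<longrightarrow> of_real (\<gamma>' x) * (\<Sum>i\<in>UNIV. G x $ i * of_real (d x $ i)) =
           of_real (\<gamma>' x) * (\<Sum>i\<in>UNIV. b i x * of_real (d x $ i))"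
          by eventually_elim auto
      qed (use b(2) in auto)
      finally show ?thesis using eq[OF t] by simp
    qed
  qed (use b in auto)
qed

lemma dirichlet_solution_unique:
  assumes u1: "dirichlet_solution \<gamma> f u1" and u2: "dirichlet_solution \<gamma> f u2"
    and \<gamma>: "\<gamma>' \<in> borel_measurable borel" "\<And>x. norm x < 1 \<Longrightarrow> \<gamma> x = \<gamma>' x"
      "\<And>x. norm x < 1 \<Longrightarrow> 0 < \<gamma>' x" "\<And>x. \<bar>\<gamma>' x\<bar> \<le> B"
    and x: "norm x \<le> 1"
  shows "u1 x = u2 x"
proof -
  obtain b1 where b1: "\<And>i::3. b1 i \<in> borel_measurable borel" "\<And>i x. x \<notin> ball 0 1 \<Longrightarrow> b1 i x = 0"
    "\<And>i. integrable lborel (\<lambda>x. (norm (b1 i x))\<^sup>2)"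
    and w1: "\<And>\<phi> d i. test_function unit_ball \<phi> d \<Longrightarrow>
       (LINT x|lborel. indicat_real (ball 0 1) x *\<^sub>R (u1 x * of_real (d x $ i))) = - (LINT x|lborel. b1 i x * of_real (\<phi> x))"
    and e1: "\<And>\<phi> d. test_function unit_ball \<phi> d \<Longrightarrow>
       (LINT x|lborel. of_real (\<gamma>' x) * (\<Sum>i\<in>UNIV. b1 i x * of_real (d x $ i))) = 0"
    by (rule dirichlet_solution_borel_gradient[OF u1 \<gamma>(1,2)], assumption) blast
  obtain b2 where b2: "\<And>i::3. b2 i \<in> borel_measurable borel" "\<And>i x. x \<notin> ball 0 1 \<Longrightarrow> b2 i x = 0"
    "\<And>i. integrable lborel (\<lambda>x. (norm (b2 i x))\<^sup>2)"
    and w2: "\<And>\<phi> d i. test_function unit_ball \<phi> d \<Longrightarrow>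
       (LINT x|lborel. indicat_real (ball 0 1) x *\<^sub>R (u2 x * of_real (d x $ i))) = - (LINT x|lborel. b2 i x * of_real (\<phi> x))"
    and e2: "\<And>\<phi> d. test_function unit_ball \<phi> d \<Longrightarrow>
       (LINT x|lborel. of_real (\<gamma>' x) * (\<Sum>i\<in>UNIV. b2 i x * of_real (d x $ i))) = 0"
    by (rule dirichlet_solution_borel_gradient[OF u2 \<gamma>(1,2)], assumption) blast
  have cu: "continuous_on (cball 0 1) u1" "continuous_on (cball 0 1) u2"
    and bd: "\<And>x. norm x = 1 \<Longrightarrow> u1 x = u2 x"
    using u1 u2 by (auto simp: dirichlet_solution_def)
  \<comment> \<open>The one-sided estimate concerns real functions. Taking the real and imaginary
    parts of the difference and their negatives for \<open>T\<close> forces the complex difference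
    to vanish.\<close>
  have nonpos: "T (u1 x - u2 x) \<le> 0" if T: "bounded_linear T" and T1: "\<And>z. \<bar>T z\<bar> \<le> norm z" for T :: "complex \<Rightarrow> real"
  proof -
    interpret T: bounded_linear T by (rule T)
    define v where "v y = (if y \<in> cball 0 1 then T (u1 y - u2 y) else 0)" for y
    define g where "g i y = T (b1 i y - b2 i y)" for i y
    have Tr: "T (z * of_real s) = T z * s" for z s
      using T.scaleR[of s z] by (simp add: scaleR_conv_of_real mult.commute)
    have Tm: "T \<in> borel_measurable borel"
      by (rule borel_measurable_continuous_onI[OF linear_continuous_on[OF T]])
    \<comment> \<open>Gluing with zero is continuous because both solutions have the same boundary
      values.\<close>
    have cv: "continuous_on UNIV v"
    proof -
      have "continuous_on (cball 0 1 \<union> - ball 0 1) v"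
        unfolding v_def
      proof (rule continuous_on_cases)
        show "continuous_on (cball 0 1) (\<lambda>y. T (u1 y - u2 y))"
          by (intro T.continuous_on continuous_intros cu)
        show "\<forall>y. y \<in> cball 0 1 \<and> \<not> y \<in> cball 0 1 \<or> y \<in> - ball 0 1 \<and> y \<in> cball 0 1 \<longrightarrow> T (u1 y - u2 y) = 0"
          using bd by (auto simp: T.zero)
      qed auto
      moreover have "cball 0 1 \<union> - ball 0 1 = (UNIV :: (real^3) set)" by auto
      ultimately show ?thesis by simp
    qed
    have gm: "g i \<in> borel_measurable borel" for i
      unfolding g_def[abs_def] by (rule measurable_compose[OF _ Tm]) (use b1(1) b2(1) in auto)
    have g2: "integrable lborel (\<lambda>x. (g i x)\<^sup>2)" for i
    proof (rule Bochner_Integration.integrable_bound[where f = "\<lambda>x. 2 * (norm (b1 i x))\<^sup>2 + 2 * (norm (b2 i x))\<^sup>2"])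
      have "(g i x)\<^sup>2 \<le> 2 * (norm (b1 i x))\<^sup>2 + 2 * (norm (b2 i x))\<^sup>2" for x
      proof -
        have "\<bar>g i x\<bar> \<le> norm (b1 i x) + norm (b2 i x)"
          unfolding g_def using T1 norm_triangle_ineq4 order_trans by blast
        then have "\<bar>g i x\<bar> \<le> \<bar>norm (b1 i x) + norm (b2 i x)\<bar>" by simp
        then have "(g i x)\<^sup>2 \<le> (norm (b1 i x) + norm (b2 i x))\<^sup>2" unfolding abs_le_square_iff .
        also have "\<dots> \<le> 2 * (norm (b1 i x))\<^sup>2 + 2 * (norm (b2 i x))\<^sup>2"
          using zero_le_power2[of "norm (b1 i x) - norm (b2 i x)"] by (simp add: power2_sum power2_diff)
        finally show ?thesis .
      qed
      then show "AE x in lborel. norm ((g i x)\<^sup>2) \<le> norm (2 * (norm (b1 i x))\<^sup>2 + 2 * (norm (b2 i x))\<^sup>2)"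
        by (intro AE_I2) simp
    qed (use b1 b2 gm in auto)
    have "v x \<le> 0"
    proof (rule weak_solution_nonpos[OF cv _ gm _ g2 \<gamma>(1,3,4)])
      show "v x = 0" if "1 \<le> norm x" for x
        using bd[of x] that by (auto simp: v_def T.zero)
      show "g i x = 0" if "x \<notin> ball 0 1" for i x
        using b1(2) b2(2) that by (simp add: g_def T.zero)
      fix \<phi> d assume t: "test_function unit_ball \<phi> d"
      note TT = test_functionD[OF t]
      obtain C where C: "C \<ge> 0" "\<And>x. \<bar>\<phi> x\<bar> \<le> C" "\<And>x i. \<bar>d x $ i\<bar> \<le> C"
        using test_function_bounded[OF t] by metis
      have pm: "\<phi> \<in> borel_measurable borel"
        by (intro borel_measurable_continuous_onI TT)
      have dm: "(\<lambda>x. d x $ i) \<in> borel_measurable borel" for i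
        by (intro borel_measurable_continuous_onI continuous_intros TT)
      show "(LINT x|lborel. v x * d x $ i) = - (LINT x|lborel. g i x * \<phi> x)" for i
      proof -
        have iu: "integrable lborel (\<lambda>x. indicat_real (ball 0 1) x *\<^sub>R (u x * of_real (d x $ i)))"
          if "continuous_on (cball 0 1) u" for u :: "real^3 \<Rightarrow> complex"
        proof -
          have "integrable lborel (\<lambda>x. indicat_real (cball 0 1) x *\<^sub>R (u x * of_real (d x $ i)))"
            by (intro borel_integrable_compact continuous_intros that continuous_on_subset[OF TT(2)]) auto
          moreover have "(\<lambda>x. indicat_real (cball 0 1) x *\<^sub>R (u x * of_real (d x $ i))) = (\<lambda>x. indicat_real (ball 0 1) x *\<^sub>R (u x * of_real (d x $ i)))"
            using TT(5) by (auto simp: fun_eq_iff indicator_def)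
          ultimately show ?thesis by simp
        qed
        have ib: "integrable lborel (\<lambda>x. b1 i x * of_real (\<phi> x))" "integrable lborel (\<lambda>x. b2 i x * of_real (\<phi> x))"
          using integrable_L2_mult_bounded[OF b1 pm C(2)] integrable_L2_mult_bounded[OF b2 pm C(2)] by auto
        have "(LINT x|lborel. v x * d x $ i) = (LINT x|lborel. T (indicat_real (ball 0 1) x *\<^sub>R (u1 x * of_real (d x $ i)) - indicat_real (ball 0 1) x *\<^sub>R (u2 x * of_real (d x $ i))))"
        proof (intro Bochner_Integration.integral_cong refl)
          fix x
          show "v x * d x $ i = T (indicat_real (ball 0 1) x *\<^sub>R (u1 x * of_real (d x $ i)) - indicat_real (ball 0 1) x *\<^sub>R (u2 x * of_real (d x $ i)))"
            using TT(5)[of x] by (auto simp: v_def indicator_def T.diff Tr T.zero algebra_simps)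
        qed
        also have "\<dots> = T (LINT x|lborel. indicat_real (ball 0 1) x *\<^sub>R (u1 x * of_real (d x $ i)) - indicat_real (ball 0 1) x *\<^sub>R (u2 x * of_real (d x $ i)))"
          by (intro integral_bounded_linear[OF T] Bochner_Integration.integrable_diff iu cu)
        also have "\<dots> = T (- (LINT x|lborel. b1 i x * of_real (\<phi> x) - b2 i x * of_real (\<phi> x)))"
          using iu[OF cu(1)] iu[OF cu(2)] ib w1[OF t, of i] w2[OF t, of i] by simp
        also have "\<dots> = - (LINT x|lborel. T (b1 i x * of_real (\<phi> x) - b2 i x * of_real (\<phi> x)))"
          using ib by (subst integral_bounded_linear[OF T]) (auto simp: linear_neg[OF T.linear] T.diff)
        also have "(LINT x|lborel. T (b1 i x * of_real (\<phi> x) - b2 i x * of_real (\<phi> x))) = (LINT x|lborel. g i x * \<phi> x)"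
          by (intro Bochner_Integration.integral_cong refl) (simp add: g_def T.diff Tr left_diff_distrib)
        finally show ?thesis .
      qed
      show "(LINT x|lborel. \<gamma>' x * (\<Sum>i\<in>UNIV. g i x * d x $ i)) = 0"
      proof -
        have ie: "integrable lborel (\<lambda>x. of_real (\<gamma>' x) * (\<Sum>i\<in>UNIV. b i x * of_real (d x $ i)))"
          if b: "\<And>i::3. b i \<in> borel_measurable borel" "\<And>i x. x \<notin> ball 0 1 \<Longrightarrow> b i x = 0"
              "\<And>i. integrable lborel (\<lambda>x. (norm (b i x))\<^sup>2)" for b :: "3 \<Rightarrow> real^3 \<Rightarrow> complex"
        proof -
          have "integrable lborel (\<lambda>x. \<Sum>i\<in>UNIV. b i x * of_real (\<gamma>' x * d x $ i))"
          proof (intro Bochner_Integration.integrable_sum integrable_L2_mult_bounded[OF b])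
            show "(\<lambda>x. \<gamma>' x * d x $ i) \<in> borel_measurable borel" for i using \<gamma>(1) dm by simp
            show "\<bar>\<gamma>' x * d x $ i\<bar> \<le> B * C" for i x
              unfolding abs_mult using \<gamma>(4)[of x] C(1) C(3)[of x i] by (intro mult_mono) auto
          qed
          then show ?thesis by (simp add: sum_distrib_left mult_ac)
        qed
        have "(LINT x|lborel. \<gamma>' x * (\<Sum>i\<in>UNIV. g i x * d x $ i)) =
          (LINT x|lborel. T (of_real (\<gamma>' x) * (\<Sum>i\<in>UNIV. b1 i x * of_real (d x $ i)) - of_real (\<gamma>' x) * (\<Sum>i\<in>UNIV. b2 i x * of_real (d x $ i))))"
        proof (intro Bochner_Integration.integral_cong refl)
          fix x
          have eqn: "of_real (\<gamma>' x) * (\<Sum>i\<in>UNIV. b1 i x * of_real (d x $ i)) - of_real (\<gamma>' x) * (\<Sum>i\<in>UNIV. b2 i x * of_real (d x $ i))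
            = (\<Sum>i\<in>UNIV. (b1 i x - b2 i x) * of_real (d x $ i)) * of_real (\<gamma>' x)"
            by (simp add: left_diff_distrib sum_subtractf algebra_simps)
          show "\<gamma>' x * (\<Sum>i\<in>UNIV. g i x * d x $ i) =
            T (of_real (\<gamma>' x) * (\<Sum>i\<in>UNIV. b1 i x * of_real (d x $ i)) - of_real (\<gamma>' x) * (\<Sum>i\<in>UNIV. b2 i x * of_real (d x $ i)))"
            unfolding eqn Tr T.sum g_def by (rule mult.commute)
        qed
        also have "\<dots> = T ((LINT x|lborel. of_real (\<gamma>' x) * (\<Sum>i\<in>UNIV. b1 i x * of_real (d x $ i))) - (LINT x|lborel. of_real (\<gamma>' x) * (\<Sum>i\<in>UNIV. b2 i x * of_real (d x $ i))))"
          using ie[OF b1] ie[OF b2] by (subst integral_bounded_linear[OF T]) auto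
        also have "\<dots> = 0" by (simp only: e1[OF t] e2[OF t] diff_self T.zero)
        finally show ?thesis .
      qed
    qed
    then show ?thesis using x by (simp add: v_def)
  qed
  have "Re (u1 x - u2 x) \<le> 0" "Im (u1 x - u2 x) \<le> 0"
    by (rule nonpos; simp add: abs_Re_le_cmod abs_Im_le_cmod bounded_linear_Re bounded_linear_Im)+
  moreover have "- Re (u1 x - u2 x) \<le> 0" "- Im (u1 x - u2 x) \<le> 0"
    by (rule nonpos; simp add: abs_Re_le_cmod abs_Im_le_cmod bounded_linear_Re bounded_linear_Im bounded_linear_minus)+
  ultimately show ?thesis by (simp add: complex_eq_iff)
qed

section \<open>The radial ansatz\<close>

lemma AE_norm_notin_finite:
  assumes "finite F"
  shows "AE x in lborel. norm (x::'a::euclidean_space) \<notin> F"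
proof -
  have "negligible (\<Union>s\<in>F. sphere (0::'a) s)"
    using assms by (intro negligible_Union) (auto intro: negligible_sphere)
  then have "AE x in lborel. x \<notin> (\<Union>s\<in>F. sphere (0::'a) s)"
    by (metis AE_completion_iff AE_not_in negligible_iff_null_sets)
  then show ?thesis by eventually_elim auto
qed

lemma lipschitz_on_bounded_partials:
  fixes \<psi> :: "real^'n \<Rightarrow> 'b::real_normed_vector"
  assumes \<psi>: "\<And>x. (\<psi> has_derivative (\<lambda>v. \<Sum>i\<in>UNIV. v $ i *\<^sub>R \<psi>' i x)) (at x)"
    and c: "\<And>i. continuous_on UNIV (\<psi>' i)"
  shows "lipschitz_on_bounded \<psi>"
proof (rule lipschitz_on_bounded_C1[OF \<psi>])
  show "continuous_on UNIV (\<lambda>x. \<Sum>i\<in>UNIV. norm (\<psi>' i x))"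
    by (intro continuous_on_sum continuous_on_norm c)
  show "norm (\<Sum>i\<in>UNIV. v $ i *\<^sub>R \<psi>' i x) \<le> (\<Sum>i\<in>UNIV. norm (\<psi>' i x)) * norm v" for x v
  proof -
    have "norm (\<Sum>i\<in>UNIV. v $ i *\<^sub>R \<psi>' i x) \<le> (\<Sum>i\<in>UNIV. norm (v $ i *\<^sub>R \<psi>' i x))" by (rule norm_sum)
    also have "\<dots> \<le> (\<Sum>i\<in>UNIV. norm v * norm (\<psi>' i x))"
      unfolding norm_scaleR
      by (intro sum_mono mult_right_mono) (auto intro: component_le_norm_cart)
    finally show ?thesis by (simp add: sum_distrib_left mult.commute)
  qed
qed

lemma sum_axis_scaleR:
  fixes f :: "'n::finite \<Rightarrow> 'b::real_vector"
  shows "(\<Sum>i\<in>UNIV. (axis p b :: real^'n) $ i *\<^sub>R f i) = b *\<^sub>R f p"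
proof -
  have "(axis p b :: real^'n) $ i *\<^sub>R f i = (if i = p then b *\<^sub>R f i else 0)" for i
    by (simp add: axis_def)
  then show ?thesis by simp
qed

text \<open>Translation invariance applied to \<open>A (norm x) * \<psi> x\<close> in the direction
  \<open>axis i 1\<close>. The corners of \<open>A\<close> sit on finitely many spheres, which have
  measure zero.\<close>

lemma radial_integration_by_parts:
  fixes A A' :: "real \<Rightarrow> real" and \<psi> :: "real^3 \<Rightarrow> complex" and \<psi>' :: "3 \<Rightarrow> real^3 \<Rightarrow> complex"
  assumes A: "lipschitz_on_bounded A" "A' \<in> borel_measurable borel" and F: "finite F"
    and dA: "\<And>s. 0 < s \<Longrightarrow> s < 1 \<Longrightarrow> s \<notin> F \<Longrightarrow> (A has_real_derivative A' s) (at s)"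
    and \<psi>: "\<And>x. (\<psi> has_derivative (\<lambda>v. \<Sum>i\<in>UNIV. v $ i *\<^sub>R \<psi>' i x)) (at x)"
    and c: "\<And>i. continuous_on UNIV (\<psi>' i)"
    and z: "\<And>x. norm x \<ge> 1 \<Longrightarrow> \<psi> x = 0" "\<And>i x. norm x \<ge> 1 \<Longrightarrow> \<psi>' i x = 0"
  shows "has_bochner_integral lborel
    (\<lambda>x. of_real (A' (norm x) * (x $ i / norm x)) * \<psi> x + of_real (A (norm x)) * \<psi>' i x) 0"
proof (rule integral_directional_derivative_zero[where f = "\<lambda>x. of_real (A (norm x)) * \<psi> x" and e = "axis i 1" and R = 1])
  have lp: "lipschitz_on_bounded \<psi>"
    by (rule lipschitz_on_bounded_partials[OF \<psi> c])
  show "lipschitz_on_bounded (\<lambda>x. complex_of_real (A (norm x)) * \<psi> x)"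
    by (intro lipschitz_on_bounded_mult lp lipschitz_on_bounded_of_real lipschitz_on_bounded_compose[OF lipschitz_on_bounded_norm A(1)])
  show "complex_of_real (A (norm x)) * \<psi> x = 0" if "norm x > 1" for x
    using z(1)[of x] that by simp
  have cA: "continuous_on UNIV A" using lipschitz_on_bounded_continuous[OF A(1)] .
  have c\<psi>: "continuous_on UNIV \<psi>"
    by (intro continuous_at_imp_continuous_on ballI has_derivative_continuous[OF \<psi>])
  have Am: "A \<in> borel_measurable borel" by (rule borel_measurable_continuous_onI[OF cA])
  have m1: "(\<lambda>x. complex_of_real (A' (norm x) * (x $ i / norm x))) \<in> borel_measurable borel"
    using A(2) borel_measurable_continuous_onI[of "\<lambda>x::real^3. x $ i"] by (auto intro!: continuous_intros)
  have m2: "(\<lambda>x::real^3. complex_of_real (A (norm x))) \<in> borel_measurable borel"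
    using Am by auto
  show "(\<lambda>x. of_real (A' (norm x) * (x $ i / norm x)) * \<psi> x + of_real (A (norm x)) * \<psi>' i x) \<in> borel_measurable borel"
    by (intro borel_measurable_add borel_measurable_times m1 m2 borel_measurable_continuous_onI c c\<psi>)
  \<comment> \<open>Besides the interfaces, the origin is excluded since the norm is not
    differentiable there, and the unit sphere since the derivative of \<open>A\<close> is given only
    inside; beyond it \<open>\<psi>\<close> vanishes.\<close>
  have "AE x in lborel. norm (x::real^3) \<notin> insert 0 (insert 1 F)"
    by (rule AE_norm_notin_finite) (use F in auto)
  then show "AE x in lborel. ((\<lambda>t. complex_of_real (A (norm (x + t *\<^sub>R axis i 1))) * \<psi> (x + t *\<^sub>R axis i 1)) has_vector_derivative
      of_real (A' (norm x) * (x $ i / norm x)) * \<psi> x + of_real (A (norm x)) * \<psi>' i x) (at 0)"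
  proof eventually_elim
    case (elim x)
    have l: "((\<lambda>t. x + t *\<^sub>R axis i 1) has_derivative (\<lambda>t. t *\<^sub>R axis i 1)) (at 0)"
      by (auto intro!: derivative_eq_intros)
    show ?case
    proof (cases "norm x < 1")
      case True
      have "((\<lambda>t. norm (x + t *\<^sub>R axis i 1)) has_derivative (\<lambda>t. (t *\<^sub>R axis i 1) \<bullet> sgn x)) (at 0)"
        using elim by (intro has_derivative_compose[OF l, where g = norm]) (auto intro!: has_derivative_norm)
      then have n: "((\<lambda>t. norm (x + t *\<^sub>R axis i 1)) has_real_derivative (x $ i / norm x)) (at 0)"
        unfolding has_field_derivative_def
        by (rule has_derivative_eq_rhs) (auto simp: inner_axis' sgn_div_norm divide_inverse)
      have "(A has_real_derivative A' (norm x)) (at (norm (x + 0 *\<^sub>R axis i 1)))"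
        using elim True by (auto intro!: dA)
      from DERIV_chain2[OF this n]
      have "((\<lambda>t. A (norm (x + t *\<^sub>R axis i 1))) has_vector_derivative (A' (norm x) * (x $ i / norm x))) (at 0)"
        by (simp add: has_real_derivative_iff_has_vector_derivative)
      from bounded_linear.has_vector_derivative[OF bounded_linear_of_real this]
      have a: "((\<lambda>t. complex_of_real (A (norm (x + t *\<^sub>R axis i 1)))) has_vector_derivative of_real (A' (norm x) * (x $ i / norm x))) (at 0)" .
      have "((\<lambda>t. \<psi> (x + t *\<^sub>R axis i 1)) has_derivative (\<lambda>t. \<Sum>j\<in>UNIV. (t *\<^sub>R axis i 1 :: real^3) $ j *\<^sub>R \<psi>' j x)) (at 0)"
        using \<psi>[of x] by (intro has_derivative_compose[OF l, where g = \<psi>]) simp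
      moreover have "(\<lambda>t. \<Sum>j\<in>UNIV. (t *\<^sub>R axis i 1 :: real^3) $ j *\<^sub>R \<psi>' j x) = (\<lambda>t. t *\<^sub>R \<psi>' i x)"
        by (simp add: sum_axis_scaleR flip: scaleR_scaleR scaleR_sum_right)
      ultimately have b: "((\<lambda>t. \<psi> (x + t *\<^sub>R axis i 1)) has_vector_derivative \<psi>' i x) (at 0)"
        by (simp add: has_vector_derivative_def)
      from has_vector_derivative_mult[OF a b] show ?thesis by (simp add: add.commute)
    next
      case False
      then have x1: "norm x > 1" using elim by auto
      have "((\<lambda>t. complex_of_real (A (norm (x + t *\<^sub>R axis i 1))) * \<psi> (x + t *\<^sub>R axis i 1)) has_vector_derivative 0) (at 0)"
      proof (rule has_vector_derivative_transform_within_open[of "\<lambda>_. 0"])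
        show "open {t. norm (x + t *\<^sub>R axis i 1) > 1}"
          by (intro open_Collect_less continuous_intros)
      qed (use x1 z in auto)
      then show ?thesis using x1 z by simp
    qed
  qed
qed

section \<open>Solid harmonics and their angular derivatives\<close>

lemma has_derivative_mult_test:
  fixes g :: "real^3 \<Rightarrow> complex"
  assumes g: "(g has_derivative (\<lambda>v. \<Sum>i\<in>UNIV. v $ i *\<^sub>R g' i)) (at x)"
    and \<phi>: "GDERIV \<phi> x :> d"
  shows "((\<lambda>x. of_real (\<phi> x) * g x) has_derivative
    (\<lambda>v. \<Sum>i\<in>UNIV. v $ i *\<^sub>R (of_real (\<phi> x) * g' i + of_real (d $ i) * g x))) (at x)"
proof -
  have "((\<lambda>x. complex_of_real (\<phi> x)) has_derivative (\<lambda>v. complex_of_real (v \<bullet> d))) (at x)"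
    using \<phi> bounded_linear.has_derivative[OF bounded_linear_of_real] unfolding gderiv_def by blast
  from has_derivative_mult[OF this g]
  show ?thesis
  proof (rule has_derivative_eq_rhs)
    show "(\<lambda>v. of_real (\<phi> x) * (\<Sum>i\<in>UNIV. v $ i *\<^sub>R g' i) + of_real (v \<bullet> d) * g x) =
      (\<lambda>v. \<Sum>i\<in>UNIV. v $ i *\<^sub>R (of_real (\<phi> x) * g' i + of_real (d $ i) * g x))"
      by (rule ext) (simp add: inner_vec_def sum_distrib_left sum_distrib_right sum.distrib scaleR_conv_of_real algebra_simps)
  qed
qed

text \<open>Homogeneity is encoded by Euler's identities, the form in which it is used, and the
  derivatives are explicit data so that linear combinations inherit them. The degree
  \<open>of_nat l - 1\<close> of \<open>h1\<close> is formed in the complex numbers, where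
  \<open>l = 0\<close> causes no truncation.\<close>

definition solid_harmonic :: "nat \<Rightarrow> (real^3 \<Rightarrow> complex) \<Rightarrow> (3 \<Rightarrow> real^3 \<Rightarrow> complex) \<Rightarrow> (3 \<Rightarrow> 3 \<Rightarrow> real^3 \<Rightarrow> complex) \<Rightarrow> bool" where
  "solid_harmonic l h h1 h2 \<longleftrightarrow>
     (\<forall>x. (h has_derivative (\<lambda>v. \<Sum>i\<in>UNIV. v $ i *\<^sub>R h1 i x)) (at x)) \<and>
     (\<forall>i x. (h1 i has_derivative (\<lambda>v. \<Sum>j\<in>UNIV. v $ j *\<^sub>R h2 i j x)) (at x)) \<and>
     (\<forall>i j. continuous_on UNIV (h2 i j)) \<and>
     (\<forall>x. (\<Sum>i\<in>UNIV. h2 i i x) = 0) \<and>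
     (\<forall>x. (\<Sum>i\<in>UNIV. x $ i *\<^sub>R h1 i x) = of_nat l * h x) \<and>
     (\<forall>i x. (\<Sum>j\<in>UNIV. x $ j *\<^sub>R h2 i j x) = (of_nat l - 1) * h1 i x) \<and>
     (\<forall>i j x. h2 i j x = h2 j i x)"

context
  fixes l :: nat and h :: "real^3 \<Rightarrow> complex" and h1 :: "3 \<Rightarrow> real^3 \<Rightarrow> complex" and h2 :: "3 \<Rightarrow> 3 \<Rightarrow> real^3 \<Rightarrow> complex"
  assumes sh: "solid_harmonic l h h1 h2"
begin

lemma solid_harmonic_props:
  shows Dh: "\<And>x. (h has_derivative (\<lambda>v. \<Sum>i\<in>UNIV. v $ i *\<^sub>R h1 i x)) (at x)"
    and Dh1: "\<And>i x. (h1 i has_derivative (\<lambda>v. \<Sum>j\<in>UNIV. v $ j *\<^sub>R h2 i j x)) (at x)"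
    and ch2: "\<And>i j. continuous_on UNIV (h2 i j)"
    and harm: "\<And>x. (\<Sum>i\<in>UNIV. h2 i i x) = 0"
    and euler: "\<And>x. (\<Sum>i\<in>UNIV. x $ i *\<^sub>R h1 i x) = of_nat l * h x"
    and euler1: "\<And>i x. (\<Sum>j\<in>UNIV. x $ j *\<^sub>R h2 i j x) = (of_nat l - 1) * h1 i x"
    and sym2: "\<And>i j x. h2 i j x = h2 j i x"
  using sh unfolding solid_harmonic_def by blast+

lemma ch1: "continuous_on UNIV (h1 i)"
  by (intro continuous_at_imp_continuous_on ballI has_derivative_continuous[OF Dh1])

lemma ch: "continuous_on UNIV h"
  by (intro continuous_at_imp_continuous_on ballI has_derivative_continuous[OF Dh])

definition angular_deriv :: "3 \<Rightarrow> 3 \<Rightarrow> real^3 \<Rightarrow> complex" where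
  "angular_deriv p q x = x $ p *\<^sub>R h1 q x - x $ q *\<^sub>R h1 p x"

definition angular_deriv2 :: "3 \<Rightarrow> 3 \<Rightarrow> real^3 \<Rightarrow> complex" where
  "angular_deriv2 p q x = - (x $ q *\<^sub>R h1 q x) - x $ p *\<^sub>R h1 p x
     + x $ p *\<^sub>R (x $ p *\<^sub>R h2 q q x - x $ q *\<^sub>R h2 q p x) - x $ q *\<^sub>R (x $ p *\<^sub>R h2 p q x - x $ q *\<^sub>R h2 p p x)"

text \<open>
  With \<open>L\<^sub>p\<^sub>q = x\<^sub>p \<partial>\<^sub>q - x\<^sub>q \<partial>\<^sub>p\<close>, which annihilates radial functions, \<open>angular_deriv p q\<close> is \<open>L\<^sub>p\<^sub>q h\<close> and \<open>angular_deriv2 p q\<close> is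
  \<open>L\<^sub>p\<^sub>q L\<^sub>p\<^sub>q h\<close>. The sum of the squares has eigenvalue \<open>-l(l+1)\<close> by the Laplace equation and Euler's
  identities for \<open>h\<close> and its gradient.
\<close>

lemma angular_deriv2_sum: "angular_deriv2 1 2 x + angular_deriv2 1 3 x + angular_deriv2 2 3 x = - (of_nat l * (of_nat l + 1)) * h x"
proof -
  have e: "x $ 1 *\<^sub>R h1 1 x + x $ 2 *\<^sub>R h1 2 x + x $ 3 *\<^sub>R h1 3 x = of_nat l * h x"
    using euler[of x] by (simp add: sum_3)
  have e1: "x $ 1 *\<^sub>R h2 i 1 x + x $ 2 *\<^sub>R h2 i 2 x + x $ 3 *\<^sub>R h2 i 3 x = (of_nat l - 1) * h1 i x" for i
    using euler1[of x i] by (simp add: sum_3)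
  have hm: "h2 1 1 x + h2 2 2 x + h2 3 3 x = 0"
    using harm[of x] by (simp add: sum_3)
  have s: "h2 2 1 x = h2 1 2 x" "h2 3 1 x = h2 1 3 x" "h2 3 2 x = h2 2 3 x" by (simp_all add: sym2)
  have "angular_deriv2 1 2 x + angular_deriv2 1 3 x + angular_deriv2 2 3 x =
      - 2 * (x $ 1 *\<^sub>R h1 1 x + x $ 2 *\<^sub>R h1 2 x + x $ 3 *\<^sub>R h1 3 x)
      + ((x $ 1)\<^sup>2 + (x $ 2)\<^sup>2 + (x $ 3)\<^sup>2) *\<^sub>R (h2 1 1 x + h2 2 2 x + h2 3 3 x)
      - (x $ 1 *\<^sub>R (x $ 1 *\<^sub>R h2 1 1 x + x $ 2 *\<^sub>R h2 1 2 x + x $ 3 *\<^sub>R h2 1 3 x)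
       + x $ 2 *\<^sub>R (x $ 1 *\<^sub>R h2 2 1 x + x $ 2 *\<^sub>R h2 2 2 x + x $ 3 *\<^sub>R h2 2 3 x)
       + x $ 3 *\<^sub>R (x $ 1 *\<^sub>R h2 3 1 x + x $ 2 *\<^sub>R h2 3 2 x + x $ 3 *\<^sub>R h2 3 3 x))"
    unfolding angular_deriv2_def s by (simp add: scaleR_conv_of_real power2_eq_square algebra_simps)
  also have "\<dots> = - 2 * (of_nat l * h x) - (of_nat l - 1) * (x $ 1 *\<^sub>R h1 1 x + x $ 2 *\<^sub>R h1 2 x + x $ 3 *\<^sub>R h1 3 x)"
    unfolding e e1 hm by (simp add: scaleR_conv_of_real algebra_simps flip: e)
  also have "\<dots> = - (of_nat l * (of_nat l + 1)) * h x"
    unfolding e by (simp add: algebra_simps)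
  finally show ?thesis .
qed

text \<open>Lagrange's identity for the cross products of \<open>x\<close> with \<open>d\<close> and
  with the gradient of \<open>h\<close>; Euler's identity turns \<open>x\<close> times the gradient
  into \<open>l * h\<close>. This isolates the tangential part of the product of two
  gradients.\<close>

lemma angular_deriv_lagrange:
  "(x $ 1 * d $ 2 - x $ 2 * d $ 1) *\<^sub>R angular_deriv 1 2 x + (x $ 1 * d $ 3 - x $ 3 * d $ 1) *\<^sub>R angular_deriv 1 3 x
   + (x $ 2 * d $ 3 - x $ 3 * d $ 2) *\<^sub>R angular_deriv 2 3 x
   = ((norm x)\<^sup>2) *\<^sub>R (\<Sum>i\<in>UNIV. d $ i *\<^sub>R h1 i x) - (x \<bullet> d) *\<^sub>R (of_nat l * h x)"
  unfolding euler[symmetric] power2_norm_eq_inner angular_deriv_def inner_vec_def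
  by (simp add: sum_3 scaleR_conv_of_real algebra_simps)

lemma has_derivative_angular_deriv:
  "(angular_deriv p q has_derivative (\<lambda>v. \<Sum>i\<in>UNIV. v $ i *\<^sub>R
     ((if i = p then h1 q x else 0) + x $ p *\<^sub>R h2 q i x - (if i = q then h1 p x else 0) - x $ q *\<^sub>R h2 p i x))) (at x)"
proof -
  have n: "((\<lambda>x::real^3. x $ p) has_derivative (\<lambda>v. v $ p)) (at x)" for p
    by (rule bounded_linear.has_derivative[OF bounded_linear_vec_nth has_derivative_ident])
  have "(angular_deriv p q has_derivative (\<lambda>v. (x $ p *\<^sub>R (\<Sum>j\<in>UNIV. v $ j *\<^sub>R h2 q j x) + v $ p *\<^sub>R h1 q x)
       - (x $ q *\<^sub>R (\<Sum>j\<in>UNIV. v $ j *\<^sub>R h2 p j x) + v $ q *\<^sub>R h1 p x))) (at x)"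
    unfolding angular_deriv_def[abs_def]
    by (intro has_derivative_diff has_derivative_scaleR n Dh1)
  then show ?thesis
  proof (rule has_derivative_eq_rhs)
    have if1: "(\<Sum>i\<in>UNIV. v $ i *\<^sub>R (if i = p then z else 0)) = v $ p *\<^sub>R z" for v :: "real^3" and p and z :: complex
      by (simp add: if_distrib cong: if_cong)
    show "(\<lambda>v. (x $ p *\<^sub>R (\<Sum>j\<in>UNIV. v $ j *\<^sub>R h2 q j x) + v $ p *\<^sub>R h1 q x)
       - (x $ q *\<^sub>R (\<Sum>j\<in>UNIV. v $ j *\<^sub>R h2 p j x) + v $ q *\<^sub>R h1 p x)) = (\<lambda>v. \<Sum>i\<in>UNIV. v $ i *\<^sub>R
     ((if i = p then h1 q x else 0) + x $ p *\<^sub>R h2 q i x - (if i = q then h1 p x else 0) - x $ q *\<^sub>R h2 p i x))"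
      by (rule ext) (simp add: scaleR_diff_right scaleR_add_right sum.distrib sum_subtractf if1 scaleR_sum_right mult.commute)
  qed
qed

text \<open>The velocity of the rotation in the plane of \<open>p\<close> and \<open>q\<close> is
  the vector field of the angular derivative; the product rule for \<open>\<phi>\<close> times
  \<open>angular_deriv p q\<close> gives the two terms.\<close>

lemma angular_integration_by_parts:
  assumes pq: "p \<noteq> q" and t: "test_function unit_ball \<phi> d"
    and k: "k \<in> borel_measurable borel" "\<And>s. \<bar>k s\<bar> \<le> B"
  shows "has_bochner_integral lborel (\<lambda>x. k (norm x) *\<^sub>R
     ((x $ p * d x $ q - x $ q * d x $ p) *\<^sub>R angular_deriv p q x + \<phi> x *\<^sub>R angular_deriv2 p q x)) 0"
proof -
  note T = test_functionD[OF t]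
  let ?g = "\<lambda>i x. (if i = p then h1 q x else 0) + x $ p *\<^sub>R h2 q i x - (if i = q then h1 p x else 0) - x $ q *\<^sub>R h2 p i x"
  let ?\<psi>' = "\<lambda>i x. of_real (\<phi> x) * ?g i x + of_real (d x $ i) * angular_deriv p q x"
  have D: "((\<lambda>x. of_real (\<phi> x) * angular_deriv p q x) has_derivative (\<lambda>v. \<Sum>i\<in>UNIV. v $ i *\<^sub>R ?\<psi>' i x)) (at x)" for x
    by (rule has_derivative_mult_test[OF has_derivative_angular_deriv T(1)])
  have ca: "continuous_on UNIV (angular_deriv p q)"
    unfolding angular_deriv_def[abs_def] by (intro continuous_intros ch1)
  have cg: "continuous_on UNIV (?g i)" for i
  proof -
    have "continuous_on UNIV (\<lambda>x. if P then h1 r x else 0)" for P r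
      by (cases P) (auto intro: ch1)
    then show ?thesis by (intro continuous_on_add continuous_on_diff continuous_on_scaleR ch2 continuous_intros)
  qed
  have c': "continuous_on UNIV (?\<psi>' i)" for i
    by (intro continuous_on_add continuous_on_mult cg ca continuous_on_of_real T continuous_intros)
  have val: "(\<Sum>i\<in>UNIV. (axis q (x $ p) - axis p (x $ q) :: real^3) $ i *\<^sub>R ?\<psi>' i x)
      = (x $ p * d x $ q - x $ q * d x $ p) *\<^sub>R angular_deriv p q x + \<phi> x *\<^sub>R angular_deriv2 p q x" for x
  proof -
    have S: "(\<Sum>i\<in>UNIV. (axis q a - axis p b :: real^3) $ i *\<^sub>R f i) = a *\<^sub>R f q - b *\<^sub>R f p" for a b and f :: "3 \<Rightarrow> complex"
      by (simp add: scaleR_diff_left sum_subtractf sum_axis_scaleR)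
    show ?thesis
      unfolding S angular_deriv2_def using pq by (simp add: scaleR_conv_of_real algebra_simps)
  qed
  have "has_bochner_integral lborel (\<lambda>x. k (norm x) *\<^sub>R (\<Sum>i\<in>UNIV. (axis q (x $ p) - axis p (x $ q) :: real^3) $ i *\<^sub>R ?\<psi>' i x)) 0"
  proof (rule integral_rotation_derivative_zero[where \<psi> = "\<lambda>x. of_real (\<phi> x) * angular_deriv p q x" and R = 1 and B = B, OF pq _ _ D k])
    show "lipschitz_on_bounded (\<lambda>x. of_real (\<phi> x) * angular_deriv p q x)"
      by (rule lipschitz_on_bounded_partials[OF D c'])
    show "complex_of_real (\<phi> x) * angular_deriv p q x = 0" if "norm x > 1" for x
      using T(4)[of x] that by simp
    show "(\<lambda>x. \<Sum>i\<in>UNIV. (axis q (x $ p) - axis p (x $ q) :: real^3) $ i *\<^sub>R ?\<psi>' i x) \<in> borel_measurable borel"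
      unfolding val angular_deriv2_def
      by (intro borel_measurable_continuous_onI continuous_intros T(2,3) ca ch1 ch2)
  qed
  then show ?thesis by (simp only: val)
qed

end

section \<open>The weak equation for a radial factor times a solid harmonic\<close>

lemma lipschitz_on_bounded_inverse_max:
  assumes "0 < (\<delta>::real)"
  shows "lipschitz_on_bounded (\<lambda>s. 1 / max \<delta> s)"
proof (rule lipschitz_on_boundedI)
  fix R :: real
  have "norm (1 / max \<delta> x - 1 / max \<delta> y) \<le> (1 / \<delta>\<^sup>2) * norm (x - y)" for x y
  proof -
    have p: "max \<delta> x \<ge> \<delta>" "max \<delta> y \<ge> \<delta>" "max \<delta> x > 0" "max \<delta> y > 0" using assms by auto
    have "1 / max \<delta> x - 1 / max \<delta> y = (max \<delta> y - max \<delta> x) / (max \<delta> x * max \<delta> y)"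
      using p by (simp add: field_simps)
    then have "norm (1 / max \<delta> x - 1 / max \<delta> y) = \<bar>max \<delta> y - max \<delta> x\<bar> / (max \<delta> x * max \<delta> y)"
      using p by (simp add: abs_mult)
    also have "\<dots> \<le> \<bar>x - y\<bar> / (\<delta> * \<delta>)"
      using p assms by (intro frac_le mult_mono) auto
    finally show ?thesis by (simp add: power2_eq_square)
  qed
  then show "\<exists>L. \<forall>x y. norm x \<le> R \<longrightarrow> norm y \<le> R \<longrightarrow> norm (1 / max \<delta> x - 1 / max \<delta> y) \<le> L * norm (x - y)"
    by blast
qed

text \<open>\<open>dQ\<close> is the definition of the flux solved for the derivative of
  \<open>Q\<close>, and \<open>dP\<close> is the radial equation; neither differentiates
  \<open>\<kappa>\<close>. \<open>near\<close> describes the innermost layer, where the singular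
  part is absent, and makes the divisions by \<open>s\<close> harmless at the origin.\<close>

locale radial_profile =
  fixes l :: nat and \<kappa> Q P :: "real \<Rightarrow> real" and F :: "real set" and \<delta> m B :: real
    and h :: "real^3 \<Rightarrow> complex" and h1 :: "3 \<Rightarrow> real^3 \<Rightarrow> complex" and h2 :: "3 \<Rightarrow> 3 \<Rightarrow> real^3 \<Rightarrow> complex"
  assumes \<kappa>: "\<kappa> \<in> borel_measurable borel" "\<And>s. \<bar>\<kappa> s\<bar> \<le> B" "0 < m" "\<And>s. 0 \<le> s \<Longrightarrow> s < 1 \<Longrightarrow> m \<le> \<kappa> s"
    and lip: "lipschitz_on_bounded Q" "lipschitz_on_bounded P"
    and F: "finite F" and \<delta>: "0 < \<delta>" "\<delta> \<le> 1"
    and near: "\<And>s. 0 \<le> s \<Longrightarrow> s < \<delta> \<Longrightarrow> Q s = Q 0 \<and> \<kappa> s = \<kappa> 0 \<and> P s = real l * \<kappa> 0 * Q 0"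
    and dQ: "\<And>s. 0 < s \<Longrightarrow> s < 1 \<Longrightarrow> s \<notin> F \<Longrightarrow> (Q has_real_derivative (P s / \<kappa> s - real l * Q s) / s) (at s)"
    and dP: "\<And>s. 0 < s \<Longrightarrow> s < 1 \<Longrightarrow> s \<notin> F \<Longrightarrow>
       (P has_real_derivative (real l * (real l + 1) * \<kappa> s * Q s - (real l + 1) * P s) / s) (at s)"
    and sh: "solid_harmonic l h h1 h2"
begin

definition qd :: "real \<Rightarrow> real" where
  "qd s = (P s / \<kappa> s - real l * Q s) / s"

definition G :: "3 \<Rightarrow> real^3 \<Rightarrow> complex" where
  "G i x = of_real (qd (norm x) * (x $ i / norm x)) * h x + of_real (Q (norm x)) * h1 i x"

text \<open>
  The profile of the innermost layer is subtracted, since the integrands of the two integrations by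
  parts below contain \<open>1/\<bar>x\<bar>\<^sup>2\<close>; the subtracted part satisfies the equation because \<open>h\<close> is harmonic.
\<close>

definition Pt :: "real \<Rightarrow> real" where "Pt s = P s - real l * \<kappa> 0 * Q 0"
definition Kt :: "real \<Rightarrow> real" where "Kt s = \<kappa> s * Q s - \<kappa> 0 * Q 0"

lemma \<kappa>_pos: "0 \<le> s \<Longrightarrow> s < 1 \<Longrightarrow> 0 < \<kappa> s"
  using \<kappa>(3) \<kappa>(4)[of s] by simp

lemma Q_cont: "continuous_on UNIV Q" and P_cont: "continuous_on UNIV P"
  by (intro lipschitz_on_bounded_continuous lip)+

lemma Q_meas: "Q \<in> borel_measurable borel" and P_meas: "P \<in> borel_measurable borel"
  by (intro borel_measurable_continuous_onI Q_cont P_cont)+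

lemma qd_meas: "qd \<in> borel_measurable borel"
  unfolding qd_def[abs_def] using Q_meas P_meas \<kappa>(1) by auto

lemma G_meas: "G i \<in> borel_measurable borel"
proof -
  have "(\<lambda>x::real^3. x $ i) \<in> borel_measurable borel"
    by (intro borel_measurable_continuous_onI continuous_intros)
  moreover have "h \<in> borel_measurable borel" "h1 i \<in> borel_measurable borel"
    by (intro borel_measurable_continuous_onI ch[OF sh] ch1[OF sh])+
  ultimately show ?thesis
    unfolding G_def[abs_def] using qd_meas Q_meas by measurable
qed

lemma qd_bounded: obtains C where "C \<ge> 0" "\<And>s. 0 \<le> s \<Longrightarrow> s < 1 \<Longrightarrow> \<bar>qd s\<bar> \<le> C"
proof -
  obtain b1 where b1: "b1 > 0" "\<And>s. \<bar>s\<bar> \<le> 1 \<Longrightarrow> \<bar>Q s\<bar> \<le> b1"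
    using lipschitz_on_bounded_bound[OF lip(1), of 1] by (metis real_norm_def)
  obtain b2 where b2: "b2 > 0" "\<And>s. \<bar>s\<bar> \<le> 1 \<Longrightarrow> \<bar>P s\<bar> \<le> b2"
    using lipschitz_on_bounded_bound[OF lip(2), of 1] by (metis real_norm_def)
  show ?thesis
  proof (rule that[of "(b2 / m + real l * b1) / \<delta>"])
    show "0 \<le> (b2 / m + real l * b1) / \<delta>" using b1 b2 \<kappa>(3) \<delta> by simp
    fix s :: real assume s: "0 \<le> s" "s < 1"
    show "\<bar>qd s\<bar> \<le> (b2 / m + real l * b1) / \<delta>"
    proof (cases "s < \<delta>")
      case True
      \<comment> \<open>In the innermost layer \<open>P = l * \<kappa> * Q\<close>, so the numerator
        is zero; elsewhere \<open>s\<close> is at least \<open>\<delta>\<close>.\<close>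
      then have "qd s = 0"
        using near[of s] s \<kappa>_pos[of s] by (simp add: qd_def)
      then show ?thesis using b1 b2 \<kappa>(3) \<delta> by simp
    next
      case False
      have "\<bar>P s / \<kappa> s\<bar> \<le> b2 / m"
        unfolding abs_divide using s b2 \<kappa>(3) \<kappa>(4)[of s] by (intro frac_le) auto
      moreover have "\<bar>real l * Q s\<bar> \<le> real l * b1"
        using s b1 by (auto simp: abs_mult intro!: mult_left_mono)
      ultimately have "\<bar>P s / \<kappa> s - real l * Q s\<bar> \<le> b2 / m + real l * b1" by linarith
      then show ?thesis
        unfolding qd_def abs_divide using False \<delta> b1 b2 \<kappa>(3) by (intro frac_le) auto
    qed
  qed
qed

lemma weak_gradient_radial:
  assumes t: "test_function unit_ball \<phi> d"
  shows "(LINT x|lborel. of_real (Q (norm x)) * h x * of_real (d x $ i)) = - (LINT x|lborel. G i x * of_real (\<phi> x))"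
proof -
  note T = test_functionD[OF t]
  have "has_bochner_integral lborel (\<lambda>x. of_real (qd (norm x) * (x $ i / norm x)) * (of_real (\<phi> x) * h x)
     + of_real (Q (norm x)) * (of_real (\<phi> x) * h1 i x + of_real (d x $ i) * h x)) 0"
  proof (rule radial_integration_by_parts[where \<psi>' = "\<lambda>i x. of_real (\<phi> x) * h1 i x + of_real (d x $ i) * h x", OF lip(1) qd_meas F])
    show "(Q has_real_derivative qd s) (at s)" if "0 < s" "s < 1" "s \<notin> F" for s
      unfolding qd_def by (rule dQ[OF that])
    show "((\<lambda>x. of_real (\<phi> x) * h x) has_derivative (\<lambda>v. \<Sum>i\<in>UNIV. v $ i *\<^sub>R (of_real (\<phi> x) * h1 i x + of_real (d x $ i) * h x))) (at x)" for x
      by (rule has_derivative_mult_test[OF Dh[OF sh] T(1)])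
    show "continuous_on UNIV (\<lambda>x. of_real (\<phi> x) * h1 i x + of_real (d x $ i) * h x)" for i
      by (intro continuous_intros T(2,3) ch[OF sh] ch1[OF sh])
  qed (use T in auto)
  then have hb: "has_bochner_integral lborel (\<lambda>x. G i x * of_real (\<phi> x) + of_real (Q (norm x)) * h x * of_real (d x $ i)) 0"
    by (rule has_bochner_integral_cong[THEN iffD1, rotated -1]) (auto simp: G_def algebra_simps)
  have i2: "integrable lborel (\<lambda>x. of_real (Q (norm x)) * h x * of_real (d x $ i))"
  proof (rule integrable_continuous_bounded_support[where R = 1])
    show "continuous_on UNIV (\<lambda>x. of_real (Q (norm x)) * h x * of_real (d x $ i))"
      by (intro continuous_intros continuous_on_compose2[OF Q_cont] T(2) ch[OF sh]) auto
  qed (use T in auto)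
  have "integrable lborel (\<lambda>x. G i x * of_real (\<phi> x))"
    using Bochner_Integration.integrable_diff[OF integrable.intros[OF hb] i2] by simp
  then show ?thesis
    using has_bochner_integral_integral_eq[OF hb] i2 by (simp add: add_eq_0_iff)
qed

lemma weak_equation_radial:
  assumes t: "test_function unit_ball \<phi> d"
  shows "(LINT x|lborel. of_real (\<kappa> (norm x)) * (\<Sum>i\<in>UNIV. G i x * of_real (d x $ i))) = 0"
proof -
  note T = test_functionD[OF t]
  have Pt0: "0 \<le> s \<Longrightarrow> s < \<delta> \<Longrightarrow> Pt s = 0" and Kt0: "0 \<le> s \<Longrightarrow> s < \<delta> \<Longrightarrow> Kt s = 0" for s
    using near[of s] by (simp_all add: Pt_def Kt_def)
  \<comment> \<open>\<open>max \<delta> s\<close> replaces \<open>s\<close> in the denominator to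
    make \<open>A\<close> Lipschitz across the origin; for \<open>s > 0\<close> the value is still
    \<open>Pt s / s\<^sup>2\<close>, because \<open>Pt\<close> vanishes below
    \<open>\<delta>\<close>.\<close>
  define A where "A s = Pt s * (1 / max \<delta> s)\<^sup>2" for s
  \<comment> \<open>The equation for \<open>P\<close> also holds for \<open>Pt\<close> with
    \<open>Kt\<close> in place of \<open>\<kappa> * Q\<close>, since the subtracted constants
    satisfy it; the factor \<open>1 / s\<^sup>2\<close> then raises \<open>l + 1\<close> to
    \<open>l + 3\<close>.\<close>
  define A' where "A' s = (real l * (real l + 1) * Kt s - (real l + 3) * Pt s) / s ^ 3" for s
  \<comment> \<open>Restricting to \<open>{0..1}\<close> makes the weight bounded on the whole
    line.\<close>
  define k where "k s = (if 0 \<le> s \<and> s \<le> 1 then Kt s * (1 / max \<delta> s)\<^sup>2 else 0)" for s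
  have Aeq: "A s = Pt s / s\<^sup>2" if "s > 0" for s
    using that Pt0[of s] \<delta> by (cases "s < \<delta>") (auto simp: A_def power_divide max_def)
  have keq: "k s = Kt s / s\<^sup>2" if "s > 0" "s \<le> 1" for s
    using that Kt0[of s] \<delta> by (cases "s < \<delta>") (auto simp: k_def power_divide max_def)
  have lipA: "lipschitz_on_bounded A"
    unfolding A_def[abs_def] Pt_def
    by (intro lipschitz_on_bounded_mult lipschitz_on_bounded_diff lip lipschitz_on_bounded_const
        lipschitz_on_bounded_power lipschitz_on_bounded_inverse_max \<delta>)
  have Ktm: "Kt \<in> borel_measurable borel" and Ptm: "Pt \<in> borel_measurable borel"
    unfolding Kt_def[abs_def] Pt_def[abs_def] using Q_meas P_meas \<kappa>(1) by auto
  have A'm: "A' \<in> borel_measurable borel"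
    unfolding A'_def[abs_def] using Ktm Ptm by auto
  have dA: "(A has_real_derivative A' s) (at s)" if s: "0 < s" "s < 1" "s \<notin> F" for s
  proof -
    have "(Pt has_real_derivative (real l * (real l + 1) * \<kappa> s * Q s - (real l + 1) * P s) / s) (at s)"
      unfolding Pt_def[abs_def] using dP[OF s] by (auto intro!: derivative_eq_intros)
    then have "((\<lambda>s. Pt s / s\<^sup>2) has_real_derivative
        ((real l * (real l + 1) * \<kappa> s * Q s - (real l + 1) * P s) / s * s\<^sup>2 - Pt s * (2 * s)) / (s\<^sup>2 * s\<^sup>2)) (at s)"
      using s by (auto intro!: derivative_eq_intros)
    also have "((real l * (real l + 1) * \<kappa> s * Q s - (real l + 1) * P s) / s * s\<^sup>2 - Pt s * (2 * s)) / (s\<^sup>2 * s\<^sup>2) = A' s"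
      using s unfolding A'_def Pt_def Kt_def by (simp add: field_simps power2_eq_square power3_eq_cube)
    finally show ?thesis
    proof (rule has_field_derivative_transform_within_open)
      show "open {0::real<..}" by simp
    qed (use s Aeq in auto)
  qed
  have km: "k \<in> borel_measurable borel"
  proof -
    have "continuous_on UNIV (\<lambda>s. (1 / max \<delta> s)\<^sup>2)"
      by (rule lipschitz_on_bounded_continuous) (intro lipschitz_on_bounded_power lipschitz_on_bounded_inverse_max \<delta>)
    then have "(\<lambda>s. (1 / max \<delta> s)\<^sup>2) \<in> borel_measurable borel"
      by (rule borel_measurable_continuous_onI)
    then show ?thesis
      unfolding k_def[abs_def] using Ktm by (intro measurable_If) auto
  qed
  obtain b1 where b1: "b1 > 0" "\<And>s. \<bar>s\<bar> \<le> 1 \<Longrightarrow> \<bar>Q s\<bar> \<le> b1"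
    using lipschitz_on_bounded_bound[OF lip(1), of 1] by (metis real_norm_def)
  have kb: "\<bar>k s\<bar> \<le> (B * b1 + B * b1) * (1 / \<delta>)\<^sup>2" for s
  proof (cases "0 \<le> s \<and> s \<le> 1")
    case True
    have B: "B \<ge> 0" using \<kappa>(2)[of 0] by simp
    have "\<bar>\<kappa> s * Q s\<bar> \<le> B * b1" "\<bar>\<kappa> 0 * Q 0\<bar> \<le> B * b1"
      unfolding abs_mult using True B b1 \<kappa>(2) by (auto intro!: mult_mono)
    then have "\<bar>Kt s\<bar> \<le> B * b1 + B * b1" unfolding Kt_def by linarith
    moreover have "1 / max \<delta> s \<le> 1 / \<delta>" using \<delta> by (intro divide_left_mono) auto
    then have "(1 / max \<delta> s)\<^sup>2 \<le> (1 / \<delta>)\<^sup>2" using \<delta> by (intro power_mono) auto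
    ultimately have "\<bar>Kt s\<bar> * (1 / max \<delta> s)\<^sup>2 \<le> (B * b1 + B * b1) * (1 / \<delta>)\<^sup>2"
      using B b1 by (intro mult_mono) auto
    then show ?thesis using True by (simp add: k_def abs_mult)
  next
    case False
    have B: "B \<ge> 0" using \<kappa>(2)[of 0] by simp
    then show ?thesis using False b1 \<delta> by (auto simp: k_def)
  qed
  \<comment> \<open>The divergence of \<open>\<phi>\<close> times the gradient of \<open>h\<close>,
    one coordinate at a time; summed over \<open>i\<close>, the Hessian terms give the Laplacian of
    \<open>h\<close>, which is zero.\<close>
  have T1: "has_bochner_integral lborel (\<lambda>x. of_real (d x $ i) * h1 i x + of_real (\<phi> x) * h2 i i x) 0" for i
  proof -
    have "has_bochner_integral lborel (\<lambda>x. of_real (0 * (x $ i / norm x)) * (of_real (\<phi> x) * h1 i x)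
       + of_real 1 * (of_real (\<phi> x) * h2 i i x + of_real (d x $ i) * h1 i x)) 0"
    proof (rule radial_integration_by_parts[where A = "\<lambda>_. 1" and A' = "\<lambda>_. 0" and F = "{}" and
          \<psi>' = "\<lambda>j x. of_real (\<phi> x) * h2 i j x + of_real (d x $ j) * h1 i x"])
      show "((\<lambda>x. of_real (\<phi> x) * h1 i x) has_derivative (\<lambda>v. \<Sum>j\<in>UNIV. v $ j *\<^sub>R (of_real (\<phi> x) * h2 i j x + of_real (d x $ j) * h1 i x))) (at x)" for x
        by (rule has_derivative_mult_test[OF Dh1[OF sh] T(1)])
      show "continuous_on UNIV (\<lambda>x. of_real (\<phi> x) * h2 i j x + of_real (d x $ j) * h1 i x)" for j
        by (intro continuous_intros T(2,3) ch2[OF sh] ch1[OF sh])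
    qed (use T in \<open>auto intro: lipschitz_on_bounded_const\<close>)
    then show ?thesis
      by (rule has_bochner_integral_cong[THEN iffD1, rotated -1]) (auto simp: algebra_simps)
  qed
  \<comment> \<open>The divergence of the radial field \<open>\<phi> * A * h * x\<close>, one
    coordinate at a time.\<close>
  have T2: "has_bochner_integral lborel (\<lambda>x. of_real (A' (norm x) * (x $ i / norm x)) * (of_real (\<phi> x) * (x $ i *\<^sub>R h x))
       + of_real (A (norm x)) * (of_real (\<phi> x) * (h x + x $ i *\<^sub>R h1 i x) + of_real (d x $ i) * (x $ i *\<^sub>R h x))) 0" for i
  proof -
    let ?\<psi>' = "\<lambda>j x. of_real (\<phi> x) * ((if j = i then h x else 0) + x $ i *\<^sub>R h1 j x) + of_real (d x $ j) * (x $ i *\<^sub>R h x)"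
    have "has_bochner_integral lborel (\<lambda>x. of_real (A' (norm x) * (x $ i / norm x)) * (of_real (\<phi> x) * (x $ i *\<^sub>R h x))
       + of_real (A (norm x)) * ?\<psi>' i x) 0"
    proof (rule radial_integration_by_parts[where \<psi>' = ?\<psi>', OF lipA A'm F dA])
      show "((\<lambda>x. of_real (\<phi> x) * (x $ i *\<^sub>R h x)) has_derivative (\<lambda>v. \<Sum>j\<in>UNIV. v $ j *\<^sub>R ?\<psi>' j x)) (at x)" for x
      proof (rule has_derivative_mult_test[OF _ T(1)])
        have "((\<lambda>x::real^3. x $ i) has_derivative (\<lambda>v. v $ i)) (at x)"
          by (rule bounded_linear.has_derivative[OF bounded_linear_vec_nth has_derivative_ident])
        from has_derivative_scaleR[OF this Dh[OF sh]]
        show "((\<lambda>x. x $ i *\<^sub>R h x) has_derivative (\<lambda>v. \<Sum>j\<in>UNIV. v $ j *\<^sub>R ((if j = i then h x else 0) + x $ i *\<^sub>R h1 j x))) (at x)"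
        proof (rule has_derivative_eq_rhs)
          have if1: "(\<Sum>j\<in>UNIV. v $ j *\<^sub>R (if j = i then z else 0)) = v $ i *\<^sub>R z" for v :: "real^3" and z :: complex
            by (simp add: if_distrib cong: if_cong)
          show "(\<lambda>v. x $ i *\<^sub>R (\<Sum>i\<in>UNIV. v $ i *\<^sub>R h1 i x) + v $ i *\<^sub>R h x) =
            (\<lambda>v. \<Sum>j\<in>UNIV. v $ j *\<^sub>R ((if j = i then h x else 0) + x $ i *\<^sub>R h1 j x))"
            by (rule ext) (simp add: scaleR_add_right sum.distrib if1 scaleR_sum_right mult.commute)
        qed
      qed
      have "continuous_on UNIV (\<lambda>x. if j = i then h x else 0)" for j
        by (cases "j = i") (auto intro: ch[OF sh])
      then show "continuous_on UNIV (?\<psi>' j)" for j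
        by (intro continuous_on_add continuous_on_mult continuous_on_scaleR continuous_on_of_real T(2,3) ch[OF sh] ch1[OF sh] continuous_intros)
    qed (use T in auto)
    then show ?thesis by simp
  qed
  have T3: "has_bochner_integral lborel (\<lambda>x. k (norm x) *\<^sub>R
     ((x $ p * d x $ q - x $ q * d x $ p) *\<^sub>R angular_deriv h1 p q x + \<phi> x *\<^sub>R angular_deriv2 h1 h2 p q x)) 0" if "p \<noteq> q" for p q
    by (rule angular_integration_by_parts[OF sh that t km kb])
  define S1 where "S1 x = (\<Sum>i\<in>UNIV. of_real (d x $ i) * h1 i x + of_real (\<phi> x) * h2 i i x)" for x
  define S2 where "S2 x = (\<Sum>i\<in>UNIV. of_real (A' (norm x) * (x $ i / norm x)) * (of_real (\<phi> x) * (x $ i *\<^sub>R h x))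
       + of_real (A (norm x)) * (of_real (\<phi> x) * (h x + x $ i *\<^sub>R h1 i x) + of_real (d x $ i) * (x $ i *\<^sub>R h x)))" for x
  define S3 where "S3 p q x = k (norm x) *\<^sub>R
     ((x $ p * d x $ q - x $ q * d x $ p) *\<^sub>R angular_deriv h1 p q x + \<phi> x *\<^sub>R angular_deriv2 h1 h2 p q x)" for p q x
  have "has_bochner_integral lborel S1 (\<Sum>i\<in>(UNIV::3 set). 0)"
    unfolding S1_def[abs_def] by (intro has_bochner_integral_sum T1)
  then have hb1: "has_bochner_integral lborel (\<lambda>x. of_real (\<kappa> 0 * Q 0) * S1 x) 0"
    using has_bochner_integral_mult_right[of "of_real (\<kappa> 0 * Q 0)" lborel S1 0] by simp
  have "has_bochner_integral lborel S2 (\<Sum>i\<in>(UNIV::3 set). 0)"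
    unfolding S2_def[abs_def] by (intro has_bochner_integral_sum T2)
  then have hb2: "has_bochner_integral lborel S2 0" by simp
  have hb3: "has_bochner_integral lborel (\<lambda>x. S3 1 2 x + S3 1 3 x + S3 2 3 x) (0 + 0 + 0)"
    unfolding S3_def by (intro has_bochner_integral_add T3) auto
  have hb: "has_bochner_integral lborel (\<lambda>x. of_real (\<kappa> 0 * Q 0) * S1 x + S2 x + (S3 1 2 x + S3 1 3 x + S3 2 3 x)) 0"
    using has_bochner_integral_add[OF has_bochner_integral_add[OF hb1 hb2] hb3] by simp
  have pt: "of_real (\<kappa> 0 * Q 0) * S1 x + S2 x + (S3 1 2 x + S3 1 3 x + S3 2 3 x) =
      of_real (\<kappa> (norm x)) * (\<Sum>i\<in>UNIV. G i x * of_real (d x $ i))" if x0: "x \<noteq> 0" for x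
  proof (cases "norm x < 1")
    case False
    then show ?thesis
      using T(4)[of x] T(5)[of x] by (simp add: S1_def S2_def S3_def)
  next
    case True
    define r where "r = norm x"
    have r: "0 < r" "r < 1" using True x0 by (auto simp: r_def)
    define \<Sigma> where "\<Sigma> = (\<Sum>i\<in>UNIV. of_real (d x $ i) * h1 i x)"
    have \<kappa>r: "\<kappa> r \<noteq> 0" using \<kappa>_pos[of r] r by simp
    have xx: "x $ 1 * x $ 1 + x $ 2 * x $ 2 + x $ 3 * x $ 3 = r\<^sup>2"
      unfolding r_def power2_norm_eq_inner inner_vec_def by (simp add: sum_3)
    have xd: "x \<bullet> d x = x $ 1 * d x $ 1 + x $ 2 * d x $ 2 + x $ 3 * d x $ 3"
      unfolding inner_vec_def by (simp add: sum_3)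
    have eu: "of_real (x $ 1) * h1 1 x + of_real (x $ 2) * h1 2 x + of_real (x $ 3) * h1 3 x = of_nat l * h x"
      using euler[OF sh, of x] by (simp add: sum_3 scaleR_conv_of_real)
    have s1: "S1 x = \<Sigma>"
      using harm[OF sh, of x] by (simp add: S1_def \<Sigma>_def sum.distrib flip: sum_distrib_left)
    have s2: "S2 x = of_real (A' r / r * r\<^sup>2 + (real l + 3) * A r) * (of_real (\<phi> x) * h x) + of_real (A r * (x \<bullet> d x)) * h x"
    proof -
      have "S2 x = of_real (A' r / r * (x $ 1 * x $ 1 + x $ 2 * x $ 2 + x $ 3 * x $ 3)) * (of_real (\<phi> x) * h x)
        + of_real (A r) * (of_real (\<phi> x) * (3 * h x + (of_real (x $ 1) * h1 1 x + of_real (x $ 2) * h1 2 x + of_real (x $ 3) * h1 3 x)))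
        + of_real (A r * (x $ 1 * d x $ 1 + x $ 2 * d x $ 2 + x $ 3 * d x $ 3)) * h x"
        unfolding S2_def r_def[symmetric] by (simp add: sum_3 scaleR_conv_of_real add_divide_distrib algebra_simps)
      then show ?thesis
        unfolding xx eu xd by (simp add: algebra_simps)
    qed
    have s3: "S3 1 2 x + S3 1 3 x + S3 2 3 x = of_real (k r) * (of_real (r\<^sup>2) * \<Sigma> - of_real (x \<bullet> d x) * (of_nat l * h x)
        - of_real (\<phi> x) * (of_nat l * (of_nat l + 1) * h x))"
    proof -
      have "S3 1 2 x + S3 1 3 x + S3 2 3 x = k r *\<^sub>R (((x $ 1 * d x $ 2 - x $ 2 * d x $ 1) *\<^sub>R angular_deriv h1 1 2 x + (x $ 1 * d x $ 3 - x $ 3 * d x $ 1) *\<^sub>R angular_deriv h1 1 3 x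
          + (x $ 2 * d x $ 3 - x $ 3 * d x $ 2) *\<^sub>R angular_deriv h1 2 3 x) + \<phi> x *\<^sub>R (angular_deriv2 h1 h2 1 2 x + angular_deriv2 h1 h2 1 3 x + angular_deriv2 h1 h2 2 3 x))"
        unfolding S3_def r_def by (simp add: scaleR_add_right)
      then show ?thesis
        unfolding angular_deriv_lagrange[OF sh] angular_deriv2_sum[OF sh] \<Sigma>_def r_def
        by (simp add: scaleR_conv_of_real algebra_simps)
    qed
    have g: "(\<Sum>i\<in>UNIV. G i x * of_real (d x $ i)) = of_real (qd r / r * (x \<bullet> d x)) * h x + of_real (Q r) * \<Sigma>"
      unfolding G_def \<Sigma>_def xd r_def[symmetric] by (simp add: sum_3 add_divide_distrib algebra_simps)
    \<comment> \<open>The terms of \<open>S2\<close> and \<open>S3\<close> that contain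
      \<open>\<phi>\<close> itself cancel: this is the equation for \<open>P\<close>.\<close>
    have a2: "A' r / r * r\<^sup>2 + (real l + 3) * A r = real l * (real l + 1) * k r"
      unfolding A'_def Aeq[OF r(1)] keq[OF r(1) less_imp_le[OF r(2)]] using r
      by (simp add: field_simps power2_eq_square power3_eq_cube)
    \<comment> \<open>The coefficient of \<open>x \<bullet> d x\<close>. The constants in
      \<open>Pt - l * Kt\<close> cancel, which leaves \<open>P - l * \<kappa> * Q\<close>, that is,
      \<open>\<kappa> r * (r * qd r)\<close>.\<close>
    have c1: "A r - real l * k r = \<kappa> r * (qd r / r)"
      unfolding Aeq[OF r(1)] keq[OF r(1) less_imp_le[OF r(2)]] qd_def Pt_def Kt_def using r \<kappa>r
      by (simp add: field_simps power2_eq_square)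
    \<comment> \<open>The coefficient of \<open>\<Sigma>\<close>: the tangential part restores what
      was subtracted from \<open>\<kappa> * Q\<close>.\<close>
    have c2: "\<kappa> 0 * Q 0 + k r * r\<^sup>2 = \<kappa> r * Q r"
      unfolding keq[OF r(1) less_imp_le[OF r(2)]] Kt_def using r by (simp add: field_simps)
    have "of_real (\<kappa> 0 * Q 0) * S1 x + S2 x + (S3 1 2 x + S3 1 3 x + S3 2 3 x) =
       of_real (\<kappa> 0 * Q 0 + k r * r\<^sup>2) * \<Sigma> + of_real ((A r - real l * k r) * (x \<bullet> d x)) * h x"
      unfolding s1 s2 s3 a2 by (simp add: algebra_simps)
    also have "\<dots> = of_real (\<kappa> r) * (\<Sum>i\<in>UNIV. G i x * of_real (d x $ i))"
      unfolding c1 c2 g by (simp add: algebra_simps)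
    finally show ?thesis by (simp add: r_def)
  qed
  have "(LINT x|lborel. of_real (\<kappa> (norm x)) * (\<Sum>i\<in>UNIV. G i x * of_real (d x $ i))) =
    (LINT x|lborel. of_real (\<kappa> 0 * Q 0) * S1 x + S2 x + (S3 1 2 x + S3 1 3 x + S3 2 3 x))"
  proof (rule integral_cong_AE)
    show "(\<lambda>x. of_real (\<kappa> 0 * Q 0) * S1 x + S2 x + (S3 1 2 x + S3 1 3 x + S3 2 3 x)) \<in> borel_measurable lborel"
      using borel_measurable_has_bochner_integral[OF hb] .
    have "(\<lambda>x::real^3. complex_of_real (\<kappa> (norm x))) \<in> borel_measurable borel" using \<kappa>(1) by auto
    moreover have "(\<lambda>x. complex_of_real (d x $ i)) \<in> borel_measurable borel" for i
      by (intro borel_measurable_continuous_onI continuous_intros T)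
    ultimately show "(\<lambda>x. of_real (\<kappa> (norm x)) * (\<Sum>i\<in>UNIV. G i x * of_real (d x $ i))) \<in> borel_measurable lborel"
      using G_meas by auto
    have "AE x in lborel. norm (x::real^3) \<notin> {0}" by (rule AE_norm_notin_finite) simp
    then show "AE x in lborel. of_real (\<kappa> (norm x)) * (\<Sum>i\<in>UNIV. G i x * of_real (d x $ i)) =
        of_real (\<kappa> 0 * Q 0) * S1 x + S2 x + (S3 1 2 x + S3 1 3 x + S3 2 3 x)"
      by eventually_elim (use pt in auto)
  qed
  also have "\<dots> = 0" by (rule has_bochner_integral_integral_eq[OF hb])
  finally show ?thesis .
qed

lemma square_integrable_G: "square_integrable_on unit_ball (\<lambda>x. \<chi> i. G i x)"
proof -
  have bl: "f \<in> borel_measurable (lebesgue_on unit_ball)" if "f \<in> borel_measurable borel" for f :: "real^3 \<Rightarrow> 'b::topological_space"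
    using that by (simp add: measurable_completion measurable_restrict_space1)
  have "(\<lambda>x. \<chi> i. G i x) \<in> borel_measurable borel"
  proof (subst borel_measurable_euclidean_space, rule ballI)
    fix b :: "complex^3" assume "b \<in> Basis"
    then obtain i u where "b = axis i u" unfolding Basis_vec_def by auto
    then show "(\<lambda>x. (\<chi> i. G i x) \<bullet> b) \<in> borel_measurable borel"
      using G_meas[of i] by (simp add: inner_axis)
  qed
  then have Gm: "(\<lambda>x. \<chi> i. G i x) \<in> borel_measurable (lebesgue_on unit_ball)"
    by (rule bl)
  obtain C where C: "C \<ge> 0" "\<And>s. 0 \<le> s \<Longrightarrow> s < 1 \<Longrightarrow> \<bar>qd s\<bar> \<le> C" by (rule qd_bounded) blast
  obtain b1 where b1: "b1 > 0" "\<And>s. \<bar>s\<bar> \<le> 1 \<Longrightarrow> \<bar>Q s\<bar> \<le> b1"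
    using lipschitz_on_bounded_bound[OF lip(1), of 1] by (metis real_norm_def)
  have bdd: "\<exists>H. \<forall>x. norm x \<le> 1 \<longrightarrow> norm (f x) \<le> H" if "continuous_on UNIV f" for f :: "real^3 \<Rightarrow> complex"
  proof -
    have "bounded (f ` cball 0 1)"
      by (intro compact_imp_bounded compact_continuous_image continuous_on_subset[OF that]) auto
    then show ?thesis unfolding bounded_iff by (metis imageI mem_cball_0)
  qed
  obtain H where H: "\<And>x. norm x \<le> 1 \<Longrightarrow> norm (h x) \<le> H"
    using bdd[OF ch[OF sh]] by blast
  have "\<forall>i. \<exists>H. \<forall>x. norm x \<le> 1 \<longrightarrow> norm (h1 i x) \<le> H"
    using bdd[OF ch1[OF sh]] by blast
  then obtain H1 where H1: "\<And>i x. norm x \<le> 1 \<Longrightarrow> norm (h1 i x) \<le> H1 i"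
    by metis
  have Gi: "norm (G i x) \<le> C * 1 * H + b1 * H1 i" if x: "norm x < 1" for i x
  proof -
    have "\<bar>qd (norm x)\<bar> \<le> C" using C(2) x by simp
    moreover have "\<bar>x $ i / norm x\<bar> \<le> 1"
      using component_le_norm_cart[of x i] by (auto simp: divide_le_eq)
    moreover have "norm (h x) \<le> H" "norm (h1 i x) \<le> H1 i" "\<bar>Q (norm x)\<bar> \<le> b1" using H H1 b1 x by auto
    ultimately show ?thesis
      unfolding G_def using C(1) b1(1)
      by (intro norm_triangle_le add_mono; unfold norm_mult norm_of_real abs_mult; intro mult_mono) auto
  qed
  define M where "M = (\<Sum>i\<in>UNIV. C * 1 * H + b1 * H1 i)"
  have "norm (\<chi> i. G i x) \<le> M" if "norm x < 1" for x
  proof -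
    have "norm (\<chi> i. G i x) \<le> (\<Sum>i\<in>UNIV. norm (G i x))"
      unfolding norm_vec_def by (simp add: L2_set_le_sum)
    also have "\<dots> \<le> M" unfolding M_def using Gi[OF that] by (intro sum_mono)
    finally show ?thesis .
  qed
  then have "norm ((norm (\<chi> i. G i x))\<^sup>2) \<le> M\<^sup>2" if "norm x < 1" for x
    using that by (simp add: power_mono)
  moreover have "finite_measure (lebesgue_on unit_ball)"
    by (rule finite_measure_lebesgue_on) simp
  ultimately have "integrable (lebesgue_on unit_ball) (\<lambda>x. (norm (\<chi> i. G i x))\<^sup>2)"
    using Gm by (intro finite_measure.integrable_const_bound[of _ _ "M\<^sup>2"]) auto
  then show ?thesis
    using Gm by (simp add: square_integrable_on_def)
qed

lemma dirichlet_solution_radial: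
  assumes Q1: "Q 1 = 1" and \<gamma>: "\<And>x. norm x < 1 \<Longrightarrow> \<gamma> x = \<kappa> (norm x)"
    and f: "\<And>x. norm x = 1 \<Longrightarrow> f x = h x"
  shows "dirichlet_solution \<gamma> f (\<lambda>x. of_real (Q (norm x)) * h x)"
  unfolding dirichlet_solution_def
proof (intro conjI exI)
  have bl: "f \<in> borel_measurable (lebesgue_on unit_ball)" if "f \<in> borel_measurable borel" for f :: "real^3 \<Rightarrow> complex"
    using that by (simp add: measurable_completion measurable_restrict_space1)
  have cu: "continuous_on S (\<lambda>x. complex_of_real (Q (norm x)) * h x)" for S
    by (intro continuous_intros continuous_on_compose2[OF Q_cont] continuous_on_subset[OF ch[OF sh]]) auto
  show "continuous_on (cball 0 1) (\<lambda>x. complex_of_real (Q (norm x)) * h x)" by (rule cu)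
  show "\<forall>x\<in>sphere 0 1. complex_of_real (Q (norm x)) * h x = f x"
    using f Q1 by auto
  show "square_integrable_on unit_ball (\<lambda>x. \<chi> i. G i x)" by (rule square_integrable_G)
  show "weak_gradient unit_ball (\<lambda>x. complex_of_real (Q (norm x)) * h x) (\<lambda>x. \<chi> i. G i x)"
    unfolding weak_gradient_def
  proof (intro allI impI)
    fix \<phi> d i assume t: "test_function unit_ball \<phi> d"
    note T = test_functionD[OF t]
    have m1: "(\<lambda>x. complex_of_real (Q (norm x)) * h x * of_real (d x $ i)) \<in> borel_measurable borel"
      by (intro borel_measurable_continuous_onI continuous_on_mult cu continuous_on_of_real continuous_intros T(2))
    have m2: "(\<lambda>x. G i x * complex_of_real (\<phi> x)) \<in> borel_measurable borel"
      by (intro borel_measurable_times G_meas borel_measurable_continuous_onI continuous_on_of_real T(3))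
    have "(LINT x|lebesgue_on unit_ball. complex_of_real (Q (norm x)) * h x * of_real (d x $ i)) =
        (LINT x|lborel. complex_of_real (Q (norm x)) * h x * of_real (d x $ i))"
      by (rule integral_lebesgue_on_ball_eq_lborel[OF bl[OF m1] m1]) (use T in auto)
    moreover have "(LINT x|lebesgue_on unit_ball. G i x * complex_of_real (\<phi> x)) =
        (LINT x|lborel. G i x * complex_of_real (\<phi> x))"
      by (rule integral_lebesgue_on_ball_eq_lborel[OF bl[OF m2] m2]) (use T in auto)
    ultimately show "(LINT x|lebesgue_on unit_ball. complex_of_real (Q (norm x)) * h x * of_real (d x $ i)) =
        - (LINT x|lebesgue_on unit_ball. (\<chi> i. G i x) $ i * complex_of_real (\<phi> x))"
      using weak_gradient_radial[OF t, of i] by simp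
  qed
  show "\<forall>\<phi> d. test_function unit_ball \<phi> d \<longrightarrow>
     (LINT x|lebesgue_on unit_ball. complex_of_real (\<gamma> x) * (\<Sum>i\<in>UNIV. (\<chi> i. G i x) $ i * complex_of_real (d x $ i))) = 0"
  proof (intro allI impI)
    fix \<phi> d assume t: "test_function unit_ball \<phi> d"
    note T = test_functionD[OF t]
    have "(\<lambda>x::real^3. complex_of_real (\<kappa> (norm x))) \<in> borel_measurable borel" using \<kappa>(1) by auto
    moreover have "(\<lambda>x. complex_of_real (d x $ i)) \<in> borel_measurable borel" for i
      by (intro borel_measurable_continuous_onI continuous_intros T)
    ultimately have m: "(\<lambda>x. of_real (\<kappa> (norm x)) * (\<Sum>i\<in>UNIV. G i x * of_real (d x $ i))) \<in> borel_measurable borel"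
      using G_meas by auto
    have "(LINT x|lebesgue_on unit_ball. complex_of_real (\<gamma> x) * (\<Sum>i\<in>UNIV. (\<chi> i. G i x) $ i * complex_of_real (d x $ i))) =
      (LINT x|lebesgue_on unit_ball. of_real (\<kappa> (norm x)) * (\<Sum>i\<in>UNIV. G i x * of_real (d x $ i)))"
      by (intro Bochner_Integration.integral_cong refl) (simp add: \<gamma>)
    also have "\<dots> = (LINT x|lborel. of_real (\<kappa> (norm x)) * (\<Sum>i\<in>UNIV. G i x * of_real (d x $ i)))"
      by (rule integral_lebesgue_on_ball_eq_lborel[OF bl[OF m] m]) (use T in auto)
    finally show "(LINT x|lebesgue_on unit_ball. complex_of_real (\<gamma> x) * (\<Sum>i\<in>UNIV. (\<chi> i. G i x) $ i * complex_of_real (d x $ i))) = 0"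
      using weak_equation_radial[OF t] by simp
  qed
qed

end

section \<open>Spherical harmonics as sums of powers of null forms\<close>

definition lin_form :: "(3 \<Rightarrow> complex) \<Rightarrow> real^3 \<Rightarrow> complex" where
  "lin_form a x = (\<Sum>i\<in>UNIV. a i * of_real (x $ i))"

lemma has_derivative_lin_form_power:
  "((\<lambda>x. c * lin_form a x ^ n) has_derivative
     (\<lambda>v. \<Sum>i\<in>UNIV. v $ i *\<^sub>R (c * of_nat n * a i * lin_form a x ^ (n - 1)))) (at x)"
proof -
  have n: "((\<lambda>x::real^3. x $ i) has_derivative (\<lambda>v. v $ i)) (at x)" for i
    by (rule bounded_linear.has_derivative[OF bounded_linear_vec_nth has_derivative_ident])
  have "(lin_form a has_derivative (\<lambda>v. \<Sum>i\<in>UNIV. a i * of_real (v $ i))) (at x)"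
    unfolding lin_form_def[abs_def]
    by (intro has_derivative_sum has_derivative_mult_right has_derivative_of_real n)
  from has_derivative_mult_right[OF has_derivative_power[OF this, of n], of c]
  show ?thesis
    by (rule has_derivative_eq_rhs)
      (auto simp: fun_eq_iff sum_distrib_left scaleR_conv_of_real mult_ac intro!: sum.cong)
qed

lemma continuous_lin_form: "continuous_on S (lin_form a)"
  unfolding lin_form_def[abs_def] by (intro continuous_intros)

text \<open>The Laplacian of the power is \<open>l * (l - 1)\<close> times the sum of the
  \<open>(a i)\<^sup>2\<close> times a lower power, so it vanishes for a null vector.\<close>

lemma solid_harmonic_null_power:
  assumes null: "(\<Sum>i\<in>UNIV. (a i)\<^sup>2) = 0"
  shows "solid_harmonic l (\<lambda>x. lin_form a x ^ l) (\<lambda>i x. of_nat l * a i * lin_form a x ^ (l - 1))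
     (\<lambda>i j x. of_nat l * of_nat (l - 1) * a i * a j * lin_form a x ^ (l - 2))"
  unfolding solid_harmonic_def
proof (intro conjI allI)
  fix x :: "real^3" and i j :: 3
  show "((\<lambda>x. lin_form a x ^ l) has_derivative (\<lambda>v. \<Sum>i\<in>UNIV. v $ i *\<^sub>R (of_nat l * a i * lin_form a x ^ (l - 1)))) (at x)"
    using has_derivative_lin_form_power[of 1 a l x] by simp
  show "((\<lambda>x. of_nat l * a i * lin_form a x ^ (l - 1)) has_derivative
     (\<lambda>v. \<Sum>j\<in>UNIV. v $ j *\<^sub>R (of_nat l * of_nat (l - 1) * a i * a j * lin_form a x ^ (l - 2)))) (at x)"
    using has_derivative_lin_form_power[of "of_nat l * a i" a "l - 1" x]
    by (simp add: mult_ac numeral_2_eq_2)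
  show "continuous_on UNIV (\<lambda>x. of_nat l * of_nat (l - 1) * a i * a j * lin_form a x ^ (l - 2))"
    by (intro continuous_intros continuous_lin_form)
  have "(\<Sum>i\<in>UNIV. of_nat l * of_nat (l - 1) * a i * a i * lin_form a x ^ (l - 2)) =
      of_nat l * of_nat (l - 1) * lin_form a x ^ (l - 2) * (\<Sum>i\<in>UNIV. (a i)\<^sup>2)"
    by (simp add: sum_distrib_left sum_distrib_right power2_eq_square mult_ac)
  then show "(\<Sum>i\<in>UNIV. of_nat l * of_nat (l - 1) * a i * a i * lin_form a x ^ (l - 2)) = 0"
    using null by simp
  have p1: "lin_form a x * lin_form a x ^ (l - 1) = lin_form a x ^ l" if "l > 0"
    using that by (cases l) auto
  have "(\<Sum>i\<in>UNIV. x $ i *\<^sub>R (of_nat l * a i * lin_form a x ^ (l - 1))) = of_nat l * (lin_form a x * lin_form a x ^ (l - 1))"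
    unfolding lin_form_def by (simp add: sum_distrib_left sum_distrib_right scaleR_conv_of_real mult_ac)
  then show "(\<Sum>i\<in>UNIV. x $ i *\<^sub>R (of_nat l * a i * lin_form a x ^ (l - 1))) = of_nat l * lin_form a x ^ l"
    using p1 by (cases "l > 0") auto
  have "(\<Sum>j\<in>UNIV. x $ j *\<^sub>R (of_nat l * of_nat (l - 1) * a i * a j * lin_form a x ^ (l - 2)))
      = of_nat l * of_nat (l - 1) * a i * (lin_form a x * lin_form a x ^ (l - 2))"
    unfolding lin_form_def by (simp add: sum_distrib_left sum_distrib_right scaleR_conv_of_real mult_ac)
  also have "\<dots> = (of_nat l - 1) * (of_nat l * a i * lin_form a x ^ (l - 1))"
  proof -
    \<comment> \<open>For \<open>l < 2\<close> the exponents are truncated natural number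
      differences, but a factor \<open>l\<close> or \<open>l - 1\<close> is then zero.\<close>
    consider "l = 0" | "l = 1" | k where "l = Suc (Suc k)" by (metis One_nat_def old.nat.exhaust)
    then show ?thesis by cases (auto simp: mult_ac)
  qed
  finally show "(\<Sum>j\<in>UNIV. x $ j *\<^sub>R (of_nat l * of_nat (l - 1) * a i * a j * lin_form a x ^ (l - 2)))
      = (of_nat l - 1) * (of_nat l * a i * lin_form a x ^ (l - 1))" .
  show "of_nat l * of_nat (l - 1) * a i * a j * lin_form a x ^ (l - 2) = of_nat l * of_nat (l - 1) * a j * a i * lin_form a x ^ (l - 2)"
    by simp
qed

lemma solid_harmonic_sum:
  assumes fin: "finite K" and sh: "\<And>k. k \<in> K \<Longrightarrow> solid_harmonic l (h k) (h1 k) (h2 k)"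
  shows "solid_harmonic l (\<lambda>x. \<Sum>k\<in>K. c k * h k x) (\<lambda>i x. \<Sum>k\<in>K. c k * h1 k i x) (\<lambda>i j x. \<Sum>k\<in>K. c k * h2 k i j x)"
  unfolding solid_harmonic_def
proof (intro conjI allI)
  fix x :: "real^3" and i j :: 3
  note S = solid_harmonic_props[OF sh]
  have ds: "((\<lambda>x. \<Sum>k\<in>K. c k * f k x) has_derivative (\<lambda>v. \<Sum>i\<in>UNIV. v $ i *\<^sub>R (\<Sum>k\<in>K. c k * f' k i x))) (at x)"
    if f: "\<And>k. k \<in> K \<Longrightarrow> (f k has_derivative (\<lambda>v. \<Sum>i\<in>UNIV. v $ i *\<^sub>R f' k i x)) (at x)"
    for f :: "'a \<Rightarrow> real^3 \<Rightarrow> complex" and f' :: "'a \<Rightarrow> 3 \<Rightarrow> real^3 \<Rightarrow> complex"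
  proof -
    have "((\<lambda>x. \<Sum>k\<in>K. c k * f k x) has_derivative (\<lambda>v. \<Sum>k\<in>K. c k * (\<Sum>i\<in>UNIV. v $ i *\<^sub>R f' k i x))) (at x)"
      by (intro has_derivative_sum has_derivative_mult_right f)
    moreover have "(\<Sum>k\<in>K. c k * (\<Sum>i\<in>UNIV. v $ i *\<^sub>R f' k i x)) = (\<Sum>i\<in>UNIV. v $ i *\<^sub>R (\<Sum>k\<in>K. c k * f' k i x))" for v :: "real^3"
      by (simp add: sum_distrib_left scaleR_sum_right sum.swap[of _ K])
    ultimately show ?thesis by simp
  qed
  show "((\<lambda>x. \<Sum>k\<in>K. c k * h k x) has_derivative (\<lambda>v. \<Sum>i\<in>UNIV. v $ i *\<^sub>R (\<Sum>k\<in>K. c k * h1 k i x))) (at x)"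
    by (rule ds) (rule S(1))
  show "((\<lambda>x. \<Sum>k\<in>K. c k * h1 k i x) has_derivative (\<lambda>v. \<Sum>j\<in>UNIV. v $ j *\<^sub>R (\<Sum>k\<in>K. c k * h2 k i j x))) (at x)"
    by (rule ds[where f' = "\<lambda>k. h2 k i"]) (rule S(2))
  show "continuous_on UNIV (\<lambda>x. \<Sum>k\<in>K. c k * h2 k i j x)"
    by (intro continuous_intros S(3))
  have "(\<Sum>i\<in>UNIV. \<Sum>k\<in>K. c k * h2 k i i x) = (\<Sum>k\<in>K. c k * (\<Sum>i\<in>UNIV. h2 k i i x))"
    by (subst sum.swap) (simp add: sum_distrib_left)
  also have "\<dots> = 0" using S(4) by simp
  finally show "(\<Sum>i\<in>UNIV. \<Sum>k\<in>K. c k * h2 k i i x) = 0" .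
  have e: "(\<Sum>i\<in>UNIV. x $ i *\<^sub>R (\<Sum>k\<in>K. c k * f k i)) = (\<Sum>k\<in>K. c k * (\<Sum>i\<in>UNIV. x $ i *\<^sub>R f k i))" for f :: "'a \<Rightarrow> 3 \<Rightarrow> complex"
    by (simp add: scaleR_sum_right sum_distrib_left sum.swap[of _ K])
  show "(\<Sum>i\<in>UNIV. x $ i *\<^sub>R (\<Sum>k\<in>K. c k * h1 k i x)) = of_nat l * (\<Sum>k\<in>K. c k * h k x)"
    unfolding e using S(5) by (simp add: sum_distrib_left mult_ac)
  show "(\<Sum>j\<in>UNIV. x $ j *\<^sub>R (\<Sum>k\<in>K. c k * h2 k i j x)) = (of_nat l - 1) * (\<Sum>k\<in>K. c k * h1 k i x)"
    unfolding e using S(6) by (simp add: sum_distrib_left mult_ac)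
  show "(\<Sum>k\<in>K. c k * h2 k i j x) = (\<Sum>k\<in>K. c k * h2 k j i x)"
    using S(7) by (intro sum.cong) auto
qed

section \<open>Taylor's formula for polynomials and averages over roots of unity\<close>

lemma higher_pderiv_pCons:
  "(pderiv ^^ Suc k) (pCons a p) = pCons 0 ((pderiv ^^ Suc k) p) + smult (of_nat (Suc k)) ((pderiv ^^ k) p)"
  for p :: "'a::idom poly"
proof (induction k)
  case 0
  show ?case by (simp add: pderiv_pCons add.commute)
next
  case (Suc k)
  let ?q = "(pderiv ^^ Suc k) p"
  have "(pderiv ^^ Suc (Suc k)) (pCons a p) = pderiv (pCons 0 ?q + smult (of_nat (Suc k)) ((pderiv ^^ k) p))"
    using Suc by simp
  also have "\<dots> = pCons 0 (pderiv ?q) + (smult 1 ?q + smult (of_nat (Suc k)) ?q)"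
    by (simp add: pderiv_add pderiv_smult pderiv_pCons)
  also have "smult 1 ?q + smult (of_nat (Suc k)) ?q = smult (of_nat (Suc (Suc k))) ?q"
    by (simp only: of_nat_Suc[of "Suc k"] smult_add_left)
  finally show ?case by simp
qed

lemma poly_taylor_expansion:
  fixes p :: "'a::field_char_0 poly"
  assumes "degree p \<le> n"
  shows "poly p (z + t) = (\<Sum>k\<le>n. poly ((pderiv ^^ k) p) z / fact k * t ^ k)"
  using assms
proof (induction p arbitrary: n)
  case 0
  then show ?case by simp
next
  case (pCons a p)
  show ?case
  proof (cases n)
    case 0
    then have "p = 0" using pCons.prems by (auto split: if_splits)
    then show ?thesis using 0 by simp
  next
    case (Suc m)
    have dp: "degree p \<le> m" using pCons.prems Suc by (auto split: if_splits)
    \<comment> \<open>The term of order \<open>Suc m\<close> vanishes, so the expansion of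
      \<open>p\<close> is available with either number of terms; multiplication by \<open>z\<close>
      needs the longer one and multiplication by \<open>t\<close> the shorter one.\<close>
    have "(pderiv ^^ Suc m) p = 0"
    proof (rule poly_eqI)
      show "coeff ((pderiv ^^ Suc m) p) i = coeff 0 i" for i
        using dp by (subst coeff_higher_pderiv) (simp add: coeff_eq_0)
    qed
    then have T: "poly p (z + t) = (\<Sum>k\<le>Suc m. poly ((pderiv ^^ k) p) z / fact k * t ^ k)"
      using pCons.IH[OF dp] by simp
    have "(\<Sum>k\<le>Suc m. poly ((pderiv ^^ k) (pCons a p)) z / fact k * t ^ k) =
        poly (pCons a p) z + (\<Sum>k\<le>m. poly ((pderiv ^^ Suc k) (pCons a p)) z / fact (Suc k) * t ^ Suc k)"
      by (subst sum.atMost_Suc_shift) simp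
    also have "(\<Sum>k\<le>m. poly ((pderiv ^^ Suc k) (pCons a p)) z / fact (Suc k) * t ^ Suc k) =
        (\<Sum>k\<le>m. z * (poly ((pderiv ^^ Suc k) p) z / fact (Suc k) * t ^ Suc k) + t * (poly ((pderiv ^^ k) p) z / fact k * t ^ k))"
    proof (intro sum.cong refl)
      fix k
      have f: "fact (Suc k) = (of_nat (Suc k) * fact k :: 'a)" by (simp add: fact_Suc)
      have nz: "(of_nat (Suc k) :: 'a) \<noteq> 0" "(fact k :: 'a) \<noteq> 0" by (auto simp del: of_nat_Suc)
      show "poly ((pderiv ^^ Suc k) (pCons a p)) z / fact (Suc k) * t ^ Suc k =
        z * (poly ((pderiv ^^ Suc k) p) z / fact (Suc k) * t ^ Suc k) + t * (poly ((pderiv ^^ k) p) z / fact k * t ^ k)"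
        unfolding higher_pderiv_pCons f using nz
        by (simp del: of_nat_Suc funpow.simps add: field_simps)
    qed
    also have "poly (pCons a p) z + \<dots> = a + z * (\<Sum>k\<le>Suc m. poly ((pderiv ^^ k) p) z / fact k * t ^ k) + t * (\<Sum>k\<le>m. poly ((pderiv ^^ k) p) z / fact k * t ^ k)"
      by (subst sum.atMost_Suc_shift) (simp add: sum.distrib sum_distrib_left algebra_simps del: funpow.simps)
    also have "\<dots> = poly (pCons a p) (z + t)"
      by (simp only: T[symmetric] pCons.IH[OF dp, symmetric]) (simp add: algebra_simps)
    finally show ?thesis by (simp add: Suc)
  qed
qed

text \<open>Rodrigues' formula has real coefficients, while Taylor's formula is evaluated at a
  complex point \<open>z + \<tau>\<close>; this passes between the two.\<close>

lemma higher_pderiv_of_real: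
  fixes p :: "real poly" and q :: "complex poly"
  assumes "\<And>n. coeff q n = of_real (coeff p n)"
  shows "poly ((pderiv ^^ k) q) (of_real z) = of_real (poly ((pderiv ^^ k) p) z)"
proof -
  have c: "coeff ((pderiv ^^ k) q) n = of_real (coeff ((pderiv ^^ k) p) n)" for n
  proof -
    have "pochhammer (of_real (real (Suc n)) :: complex) k = of_real (pochhammer (real (Suc n)) k)"
      by (rule pochhammer_of_real)
    then show ?thesis by (simp add: coeff_higher_pderiv assms del: of_nat_Suc)
  qed
  have "degree ((pderiv ^^ k) q) = degree ((pderiv ^^ k) p)"
    unfolding degree_def c by simp
  then show ?thesis by (simp add: poly_altdef c)
qed

lemma coeff_quad_power_of_real:
  "coeff ([:-1, 0, 1:] ^ l :: complex poly) n = of_real (coeff ([:-1, 0, 1:] ^ l) n)"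
proof (induction l arbitrary: n)
  case 0
  show ?case by (simp add: one_pCons coeff_pCons split: nat.split)
next
  case (Suc l)
  have "coeff ([:-1, 0, 1:] :: complex poly) i = of_real (coeff [:-1, 0, 1:] i)" for i
    by (simp add: coeff_pCons split: nat.splits)
  then show ?case by (simp add: coeff_mult Suc del: mult_pCons_left)
qed

text \<open>The sum is geometric, and its ratio \<open>u\<close> is an \<open>M\<close>-th root of
  unity. As \<open>a\<close> and \<open>b\<close> differ by less than \<open>M\<close>, the ratio is
  1 only for \<open>a = b\<close>.\<close>

lemma sum_roots_orthogonal:
  assumes M: "0 < M" and ab: "a < b + M" "b < a + M"
  shows "(\<Sum>j<M. cis (2 * pi * real j / real M) ^ a * cnj (cis (2 * pi * real j / real M)) ^ b) = (if a = b then of_nat M else 0)"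
proof -
  define u where "u = cis (2 * pi * (real a - real b) / real M)"
  have e: "cis (2 * pi * real j / real M) ^ a * cnj (cis (2 * pi * real j / real M)) ^ b = u ^ j" for j
    by (simp add: u_def cis_cnj Complex.DeMoivre cis_mult diff_divide_distrib algebra_simps)
  show ?thesis
  proof (cases "a = b")
    case True
    then show ?thesis unfolding e by (simp add: u_def)
  next
    case False
    have uM: "u ^ M = 1"
    proof -
      have "u ^ M = cis (2 * pi * of_int (int a - int b))"
        using M by (simp add: u_def Complex.DeMoivre)
      also have "\<dots> = 1" by (rule cis_multiple_2pi) (rule Ints_of_int)
      finally show ?thesis .
    qed
    have u1: "u \<noteq> 1"
    proof
      assume "u = 1"
      then have "cos (2 * pi * (real a - real b) / real M) = 1"
        by (simp add: u_def complex_eq_iff)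
      then obtain n :: int where "2 * pi * (real a - real b) / real M = real_of_int n * 2 * pi"
        using cos_one_2pi_int by blast
      then have "(2 * pi) * (real a - real b) = (2 * pi) * (real_of_int n * real M)"
        using M by (simp add: field_simps)
      then have "real a - real b = real_of_int n * real M"
        by (rule mult_left_cancel[THEN iffD1, rotated]) simp
      then have "int a - int b = n * int M"
        by (metis of_int_diff of_int_eq_iff of_int_mult of_int_of_nat_eq)
      moreover from this have "n \<noteq> 0" using False by auto
      then have "\<bar>n\<bar> * int M \<ge> int M" using M by (simp add: mult_le_cancel_right1)
      ultimately have "\<bar>int a - int b\<bar> \<ge> int M" by (simp add: abs_mult)
      then show False using ab by linarith
    qed
    have "(u - 1) * (\<Sum>j<M. u ^ j) = 0"
      using power_diff_1_eq[of u M] uM by simp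
    then show ?thesis unfolding e using u1 False by simp
  qed
qed

text \<open>
  With \<open>\<tau> = i cnj(\<omega>) s\<close> and \<open>s s' = 1 - z\<^sup>2\<close> one has
  \<open>z + (i/2) (cnj(\<omega>) s + \<omega> s') = ((z + \<tau>)\<^sup>2 - 1) / (2 \<tau>)\<close>, so that Taylor's formula for \<open>(z\<^sup>2 - 1)\<^sup>l\<close> turns
  the \<open>l\<close>-th power into a Laurent polynomial in \<open>\<omega>\<close> whose coefficients are those of Rodrigues' formula. They are
  extracted by averaging over roots of unity.
\<close>

definition unity :: "nat \<Rightarrow> nat \<Rightarrow> complex" where
  "unity l j = cis (2 * pi * real j / real (2 * l + 1))"

lemma rodrigues_average_nonzero:
  fixes z s s' :: complex
  assumes ss: "s * s' = 1 - z\<^sup>2" and s: "s \<noteq> 0" and m: "m \<le> l"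
  shows "(\<Sum>j<2*l+1. unity l j ^ m * (z + \<i> / 2 * (cnj (unity l j) * s + unity l j * s')) ^ l)
    = of_nat (2*l+1) * (\<i> * s) ^ m * (poly ((pderiv ^^ (l + m)) ([:-1, 0, 1:] ^ l)) z / fact (l + m) / 2 ^ l)"
proof -
  define q where "q k = poly ((pderiv ^^ k) ([:-1, 0, 1:] ^ l)) z / fact k" for k
  have dg: "degree ([:-1, 0, 1:] ^ l :: complex poly) \<le> 2 * l"
    by (simp add: degree_power_eq)
  have w: "unity l j * cnj (unity l j) = 1" for j
    by (simp add: unity_def cis_cnj cis_mult)
  \<comment> \<open>Multiplying by \<open>(2 * \<i> * s) ^ l\<close> clears the denominator
    \<open>2 * \<tau>\<close> and, as \<open>2 * \<i> * s = \<omega> * (2 * \<tau>)\<close>, raises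
    the power of \<open>\<omega>\<close> from \<open>m\<close> to \<open>l + m\<close>.\<close>
  have key: "(2 * \<i> * s) ^ l * (unity l j ^ m * (z + \<i> / 2 * (cnj (unity l j) * s + unity l j * s')) ^ l)
      = (\<Sum>k\<le>2*l. q k * (\<i> * s) ^ k * (unity l j ^ (l + m) * cnj (unity l j) ^ k))" for j
  proof -
    define \<omega> where "\<omega> = unity l j"
    define \<tau> where "\<tau> = \<i> * cnj \<omega> * s"
    have w1: "\<omega> * cnj \<omega> = 1" using w by (simp add: \<omega>_def)
    have "2 * \<tau> * (z + \<i> / 2 * (cnj \<omega> * s + \<omega> * s')) = 2 * z * \<tau> + \<tau>\<^sup>2 - (\<omega> * cnj \<omega>) * (s * s')"
      by (simp add: \<tau>_def power2_eq_square algebra_simps)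
    also have "\<dots> = (z + \<tau>)\<^sup>2 - 1"
      unfolding w1 ss by (simp add: power2_eq_square algebra_simps)
    finally have "(2 * \<tau> * (z + \<i> / 2 * (cnj \<omega> * s + \<omega> * s'))) ^ l = ((z + \<tau>)\<^sup>2 - 1) ^ l"
      by simp
    then have "(2 * \<tau>) ^ l * (z + \<i> / 2 * (cnj \<omega> * s + \<omega> * s')) ^ l = ((z + \<tau>)\<^sup>2 - 1) ^ l"
      by (simp only: power_mult_distrib)
    also have "\<dots> = poly ([:-1, 0, 1:] ^ l) (z + \<tau>)"
      by (simp add: poly_power power2_eq_square algebra_simps)
    also have "\<dots> = (\<Sum>k\<le>2*l. q k * \<tau> ^ k)"
      unfolding q_def by (rule poly_taylor_expansion[OF dg])
    finally have E: "(2 * \<tau>) ^ l * (z + \<i> / 2 * (cnj \<omega> * s + \<omega> * s')) ^ l = (\<Sum>k\<le>2*l. q k * \<tau> ^ k)" .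
    have "2 * \<i> * s = \<omega> * (2 * \<tau>)"
      unfolding \<tau>_def using w1 by (simp add: algebra_simps)
    then have pw: "(2 * \<i> * s) ^ l = \<omega> ^ l * (2 * \<tau>) ^ l"
      by (simp only: power_mult_distrib)
    have "(2 * \<i> * s) ^ l * (\<omega> ^ m * (z + \<i> / 2 * (cnj \<omega> * s + \<omega> * s')) ^ l) =
        \<omega> ^ (l + m) * ((2 * \<tau>) ^ l * (z + \<i> / 2 * (cnj \<omega> * s + \<omega> * s')) ^ l)"
      unfolding pw by (simp only: power_add mult_ac)
    also have "\<dots> = (\<Sum>k\<le>2*l. q k * (\<i> * s) ^ k * (\<omega> ^ (l + m) * cnj \<omega> ^ k))"
      unfolding E unfolding sum_distrib_left unfolding \<tau>_def by (intro sum.cong refl) (simp add: power_mult_distrib)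
    finally show ?thesis by (simp add: \<omega>_def)
  qed
  have "(2 * \<i> * s) ^ l * (\<Sum>j<2*l+1. unity l j ^ m * (z + \<i> / 2 * (cnj (unity l j) * s + unity l j * s')) ^ l)
      = (\<Sum>j<2*l+1. \<Sum>k\<le>2*l. q k * (\<i> * s) ^ k * (unity l j ^ (l + m) * cnj (unity l j) ^ k))"
    unfolding sum_distrib_left key ..
  also have "\<dots> = (\<Sum>k\<le>2*l. q k * (\<i> * s) ^ k * (\<Sum>j<2*l+1. unity l j ^ (l + m) * cnj (unity l j) ^ k))"
    by (subst sum.swap) (simp only: sum_distrib_left)
  \<comment> \<open>The exponents \<open>l + m\<close> and \<open>k\<close> both lie between 0 and
    \<open>2 * l\<close>, so \<open>2 * l + 1\<close> points separate them; only the Taylor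
    coefficient of order \<open>l + m\<close> survives.\<close>
  also have "\<dots> = (\<Sum>k\<le>2*l. q k * (\<i> * s) ^ k * (if l + m = k then of_nat (2*l+1) else 0))"
    unfolding unity_def using m by (intro sum.cong refl arg_cong2[of _ _ _ _ "(*)"] sum_roots_orthogonal) auto
  also have "\<dots> = q (l + m) * (\<i> * s) ^ (l + m) * of_nat (2*l+1)"
  proof -
    have "(\<Sum>k\<le>2*l. q k * (\<i> * s) ^ k * (if l + m = k then of_nat (2*l+1) else 0))
        = (\<Sum>k\<le>2*l. if k = l + m then q (l + m) * (\<i> * s) ^ (l + m) * of_nat (2*l+1) else 0)"
      by (intro sum.cong refl) auto
    then show ?thesis using m by simp
  qed
  also have "\<dots> = (2 * \<i> * s) ^ l * (of_nat (2*l+1) * (\<i> * s) ^ m * (q (l + m) / 2 ^ l))"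
    by (simp add: power_add power_mult_distrib mult_ac)
  finally have "(2 * \<i> * s) ^ l * (\<Sum>j<2*l+1. unity l j ^ m * (z + \<i> / 2 * (cnj (unity l j) * s + unity l j * s')) ^ l)
    = (2 * \<i> * s) ^ l * (of_nat (2*l+1) * (\<i> * s) ^ m * (q (l + m) / 2 ^ l))" .
  moreover have "(2 * \<i> * s) ^ l \<noteq> 0" using s by simp
  ultimately show ?thesis unfolding q_def by (rule mult_left_cancel[THEN iffD1, rotated])
qed

text \<open>At the poles of the sphere \<open>s = 0\<close>, and one cannot divide by
  \<open>s\<close>. There \<open>z\<^sup>2 = 1\<close>, so the identity holds for every nonzero
  \<open>s\<close> with \<open>s' = 0\<close>, and both sides are continuous in
  \<open>s\<close>.\<close>

lemma rodrigues_average: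
  fixes z s s' :: complex
  assumes ss: "s * s' = 1 - z\<^sup>2" and ss': "s = 0 \<Longrightarrow> s' = 0" and m: "m \<le> l"
  shows "(\<Sum>j<2*l+1. unity l j ^ m * (z + \<i> / 2 * (cnj (unity l j) * s + unity l j * s')) ^ l)
    = of_nat (2*l+1) * (\<i> * s) ^ m * (poly ((pderiv ^^ (l + m)) ([:-1, 0, 1:] ^ l)) z / fact (l + m) / 2 ^ l)"
proof (cases "s = 0")
  case False
  then show ?thesis using rodrigues_average_nonzero[OF ss _ m] by simp
next
  case True
  let ?L = "\<lambda>s::complex. (\<Sum>j<2*l+1. unity l j ^ m * (z + \<i> / 2 * (cnj (unity l j) * s + unity l j * 0)) ^ l)"
  let ?R = "\<lambda>s::complex. of_nat (2*l+1) * (\<i> * s) ^ m * (poly ((pderiv ^^ (l + m)) ([:-1, 0, 1:] ^ l)) z / fact (l + m) / 2 ^ l)"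
  have z: "1 - z\<^sup>2 = 0" using ss True by simp
  have eq: "?L s = ?R s" if "s \<noteq> 0" for s
    using rodrigues_average_nonzero[of s 0 z m l] that m z by simp
  have "?L \<midarrow>0\<rightarrow> ?L 0"
    by (intro tendsto_intros)
  moreover have "?R \<midarrow>0\<rightarrow> ?R 0"
    by (intro tendsto_intros)
  moreover have "(?L \<longlongrightarrow> ?R 0) (at 0) = (?R \<longlongrightarrow> ?R 0) (at 0)"
    by (rule filterlim_cong[OF refl refl]) (use eq in \<open>auto simp: eventually_at_filter\<close>)
  ultimately have "?L 0 = ?R 0"
    using tendsto_unique[of "at (0::complex)" ?L] by auto
  then show ?thesis using True ss' by simp
qed

text \<open>A discrete form of Laplace's integral for the associated Legendre functions: each linear
  form is \<open>x $ 3\<close> plus \<open>\<i>\<close> times the component of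
  \<open>(x $ 1, x $ 2)\<close> in the direction \<open>unity l k\<close>.\<close>

lemma sph_harm_nonneg_eq_null_powers:
  assumes m: "m \<le> l"
  obtains c a where "\<And>k::nat. (\<Sum>i\<in>UNIV. (a k i)\<^sup>2) = 0"
    "\<And>x. norm x = 1 \<Longrightarrow> sph_harm_nonneg l m x = (\<Sum>k<2*l+1. c k * lin_form (a k) x ^ l)"
proof -
  define a where "a k i = (if i = 3 then 1 else if i = 1 then \<i> * Re (unity l k) else \<i> * Im (unity l k))" for k and i :: 3
  \<comment> \<open>The last two factors convert the average to the normalisation of
    \<open>legendre\<close>: it has \<open>fact (l + m)\<close> in place of \<open>fact l\<close>
    and a surplus factor \<open>of_nat (2*l+1) * \<i> ^ m\<close>.\<close>
  define C where "C = of_real (sqrt ((2 * real l + 1) / (4 * pi) * (fact (l - m) / fact (l + m))) * (-1) ^ m)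
     * (fact (l + m) / fact l) / (of_nat (2*l+1) * \<i> ^ m)"
  show ?thesis
  proof (rule that[of a "\<lambda>k. C * unity l k ^ m"])
    fix k
    have "(Re (unity l k))\<^sup>2 + (Im (unity l k))\<^sup>2 = 1"
      by (simp add: unity_def)
    then have "complex_of_real ((Re (unity l k))\<^sup>2 + (Im (unity l k))\<^sup>2) = of_real 1"
      by (simp only:)
    moreover have "(\<Sum>i\<in>UNIV. (a k i)\<^sup>2) = 1 - complex_of_real ((Re (unity l k))\<^sup>2 + (Im (unity l k))\<^sup>2)"
      by (simp add: sum_3 a_def power_mult_distrib)
    ultimately show "(\<Sum>i\<in>UNIV. (a k i)\<^sup>2) = 0" by simp
  next
    fix x :: "real^3" assume x: "norm x = 1"
    define s where "s = Complex (x $ 1) (x $ 2)"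
    define z where "z = complex_of_real (x $ 3)"
    have n1: "(x $ 1)\<^sup>2 + (x $ 2)\<^sup>2 + (x $ 3)\<^sup>2 = 1"
      using x by (simp add: norm_eq_1 inner_vec_def sum_3 power2_eq_square)
    have "s * cnj s = of_real ((x $ 1)\<^sup>2 + (x $ 2)\<^sup>2)"
      by (simp add: s_def complex_mult_cnj)
    also have "(x $ 1)\<^sup>2 + (x $ 2)\<^sup>2 = 1 - (x $ 3)\<^sup>2" using n1 by linarith
    finally have ss: "s * cnj s = 1 - z\<^sup>2" by (simp add: z_def)
    have L: "lin_form (a k) x = z + \<i> / 2 * (cnj (unity l k) * s + unity l k * cnj s)" for k
      by (simp add: lin_form_def sum_3 a_def s_def z_def complex_eq_iff)
    have avg: "(\<Sum>k<2*l+1. unity l k ^ m * lin_form (a k) x ^ l)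
      = of_nat (2*l+1) * (\<i> * s) ^ m * (poly ((pderiv ^^ (l + m)) ([:-1, 0, 1:] ^ l)) z / fact (l + m) / 2 ^ l)"
      unfolding L by (rule rodrigues_average[OF ss _ m]) simp
    have pz: "poly ((pderiv ^^ (l + m)) ([:-1, 0, 1:] ^ l)) z = of_real (poly ((pderiv ^^ (l + m)) ([:-1, 0, 1:] ^ l)) (x $ 3))"
      unfolding z_def by (rule higher_pderiv_of_real[OF coeff_quad_power_of_real])
    have leg: "poly ((pderiv ^^ m) (legendre l)) (x $ 3) = poly ((pderiv ^^ (l + m)) ([:-1, 0, 1:] ^ l)) (x $ 3) / (2 ^ l * fact l)"
      unfolding legendre_def higher_pderiv_smult by (simp add: funpow_add add.commute[of l m])
    have "(\<Sum>k<2*l+1. (C * unity l k ^ m) * lin_form (a k) x ^ l) = C * (\<Sum>k<2*l+1. unity l k ^ m * lin_form (a k) x ^ l)"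
      unfolding sum_distrib_left by (simp only: mult.assoc)
    also have "\<dots> = sph_harm_nonneg l m x"
      unfolding avg pz sph_harm_nonneg_def leg C_def s_def[symmetric]
      by (simp add: power_mult_distrib field_simps del: of_nat_Suc of_nat_add)
    finally show "sph_harm_nonneg l m x = (\<Sum>k<2*l+1. (C * unity l k ^ m) * lin_form (a k) x ^ l)" by simp
  qed
qed

lemma sph_harm_solid_extension:
  assumes m: "\<bar>m\<bar> \<le> int l"
  obtains h h1 h2 where "solid_harmonic l h h1 h2" "\<And>x. norm x = 1 \<Longrightarrow> sph_harm l m x = h x"
    "\<And>s x. h (s *\<^sub>R x) = of_real s ^ l * h x"
proof -
  obtain c a where a: "\<And>k::nat. (\<Sum>i\<in>UNIV. (a k i)\<^sup>2) = 0"
    and c: "\<And>x. norm x = 1 \<Longrightarrow> sph_harm l m x = (\<Sum>k<2*l+1. c k * lin_form (a k) x ^ l)"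
  proof (cases "0 \<le> m")
    case True
    then have "nat m \<le> l" using m by simp
    then obtain c a where "\<And>k::nat. (\<Sum>i\<in>UNIV. (a k i)\<^sup>2) = 0"
      "\<And>x. norm x = 1 \<Longrightarrow> sph_harm_nonneg l (nat m) x = (\<Sum>k<2*l+1. c k * lin_form (a k) x ^ l)"
      by (rule sph_harm_nonneg_eq_null_powers) blast
    then show ?thesis
      using True by (intro that[of a c]) (simp_all only: sph_harm_def if_True)
  next
    case False
    then have "nat (- m) \<le> l" using m by simp
    then obtain c a where a: "\<And>k::nat. (\<Sum>i\<in>UNIV. (a k i)\<^sup>2) = 0"
      and c: "\<And>x. norm x = 1 \<Longrightarrow> sph_harm_nonneg l (nat (- m)) x = (\<Sum>k<2*l+1. c k * lin_form (a k) x ^ l)"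
      by (rule sph_harm_nonneg_eq_null_powers) blast
    show ?thesis
    \<comment> \<open>For negative \<open>m\<close> the harmonic is a conjugate up to sign, and the
      conjugate of a null vector is null.\<close>
    proof (rule that[of "\<lambda>k i. cnj (a k i)" "\<lambda>k. (-1) ^ nat (- m) * cnj (c k)"])
      show "(\<Sum>i\<in>UNIV. (cnj (a k i))\<^sup>2) = 0" for k
        using arg_cong[OF a[of k], of cnj] by (simp flip: complex_cnj_power)
      have "cnj (lin_form (a k) x) = lin_form (\<lambda>i. cnj (a k i)) x" for k x
        by (simp add: lin_form_def)
      then show "sph_harm l m x = (\<Sum>k<2*l+1. ((-1) ^ nat (- m) * cnj (c k)) * lin_form (\<lambda>i. cnj (a k i)) x ^ l)"
        if "norm x = 1" for x
        using False c[OF that] by (simp add: sph_harm_def sum_distrib_left mult.assoc distrib_left)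
    qed
  qed
  have lf: "lin_form b (s *\<^sub>R x) = of_real s * lin_form b x" for b s x
    by (simp add: lin_form_def sum_distrib_left mult_ac)
  show ?thesis
    by (rule that[OF solid_harmonic_sum[OF _ solid_harmonic_null_power[OF a], of "{..<2*l+1}" l c]])
      (auto simp: c lf power_mult_distrib sum_distrib_left mult_ac simp del: sum.lessThan_Suc intro!: sum.cong)
qed

text \<open>As \<open>l + k \<le> 2 * l\<close>, the derivative in Rodrigues' formula does not kill
  the leading term, so only finitely many heights \<open>z\<close> are zeros. At any other height
  with \<open>x $ 2 = 0\<close> the azimuthal factor is \<open>sqrt (1 - z\<^sup>2) ^ k\<close>,
  which is nonzero inside the interval.\<close>

lemma sph_harm_nonzero:
  assumes m: "\<bar>m\<bar> \<le> int l"
  shows "\<exists>x\<in>sphere 0 1. sph_harm l m x \<noteq> 0"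
proof -
  define k where "k = nat \<bar>m\<bar>"
  have k: "k \<le> l" using m by (simp add: k_def)
  have "coeff ((pderiv ^^ (l + k)) ([:-1, 0, 1:] ^ l :: real poly)) (l - k) \<noteq> 0"
  proof -
    have "degree ([:-1, 0, 1:] ^ l :: real poly) = 2 * l" by (simp add: degree_power_eq)
    moreover have "l - k + (l + k) = 2 * l" using k by simp
    ultimately have "coeff ([:-1, 0, 1:] ^ l :: real poly) (l - k + (l + k)) \<noteq> 0"
      by (metis leading_coeff_0_iff pCons_eq_0_iff power_not_zero zero_neq_one)
    moreover have "pochhammer (real (Suc (l - k))) (l + k) > 0"
      by (intro pochhammer_pos) simp
    ultimately show ?thesis by (simp add: coeff_higher_pderiv del: of_nat_Suc)
  qed
  then have "(pderiv ^^ (l + k)) ([:-1, 0, 1:] ^ l :: real poly) \<noteq> 0" by auto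
  moreover have "(pderiv ^^ k) (legendre l) = smult (1 / (2 ^ l * fact l)) ((pderiv ^^ (l + k)) ([:-1, 0, 1:] ^ l))"
    unfolding legendre_def higher_pderiv_smult by (simp add: funpow_add add.commute[of l k])
  ultimately have "(pderiv ^^ k) (legendre l) \<noteq> 0" by simp
  then have fin: "finite {z. poly ((pderiv ^^ k) (legendre l)) z = 0}" by (rule poly_roots_finite)
  have "\<not> {-1<..<1::real} \<subseteq> {z. poly ((pderiv ^^ k) (legendre l)) z = 0}"
  proof
    assume "{-1<..<1::real} \<subseteq> {z. poly ((pderiv ^^ k) (legendre l)) z = 0}"
    then have "finite {-1<..<1::real}" using fin by (rule finite_subset)
    then show False using infinite_Ioo[of "-1" "1::real"] by simp
  qed
  then have "\<exists>z\<in>{-1<..<1::real}. poly ((pderiv ^^ k) (legendre l)) z \<noteq> 0"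
    by blast
  then obtain z :: real where z: "-1 < z" "z < 1" "poly ((pderiv ^^ k) (legendre l)) z \<noteq> 0"
    by (auto simp only: greaterThanLessThan_iff)
  define x :: "real^3" where "x = vector [sqrt (1 - z\<^sup>2), 0, z]"
  have z2: "z\<^sup>2 < 1" using z(1,2) by (simp add: abs_square_less_1)
  have x3: "x $ 1 = sqrt (1 - z\<^sup>2)" "x $ 2 = 0" "x $ 3 = z" by (simp_all add: x_def)
  have "norm x = 1"
    using z2 by (simp add: norm_eq_1 inner_vec_def sum_3 x3) (simp add: power2_eq_square)
  moreover have "sph_harm_nonneg l k x \<noteq> 0"
    using z z2 by (simp add: sph_harm_nonneg_def x3 complex_eq_iff)
  then have "sph_harm l m x \<noteq> 0"
    by (cases "0 \<le> m") (simp_all add: sph_harm_def k_def)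
  ultimately show ?thesis by auto
qed

section \<open>Transmission coefficients of the layers\<close>

text \<open>
  The \<open>k\<close>-th pair belongs to the layer \<open>k + 1\<close>, between \<open>r\<^sub>k\<close> and \<open>r\<^sub>k\<^sub>+\<^sub>1\<close>: the radial part of the solution is
  \<open>a s\<^sup>l + b s\<^bsup>-(l+1)\<^esup>\<close> there, up to one common factor that is fixed only by the boundary value. \<open>V\<close> and \<open>W\<close> carry
  the value and the flux across the interface.
\<close>

fun layer_coeffs :: "(nat \<Rightarrow> real) \<Rightarrow> (nat \<Rightarrow> real) \<Rightarrow> nat \<Rightarrow> nat \<Rightarrow> real \<times> real" where
  "layer_coeffs r c l 0 = (1, 0)"
| "layer_coeffs r c l (Suc k) =
     (let (a, b) = layer_coeffs r c l k; w = w_coeff r l (Suc k);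
          V = a + b * w; W = c (Suc k) / c (Suc (Suc k)) * (real l * a - (real l + 1) * b * w)
      in (((real l + 1) * V + W) / (2 * real l + 1), (real l * V - W) / ((2 * real l + 1) * w)))"

locale layered_ball =
  fixes N :: nat and r c :: "nat \<Rightarrow> real" and l :: nat
  assumes N: "N \<ge> 1" and r0: "r 0 = 0" and r_less: "\<And>j. j < N \<Longrightarrow> r j < r (Suc j)" and rN: "r N = 1"
    and c_pos: "\<And>j. 1 \<le> j \<Longrightarrow> j \<le> N \<Longrightarrow> c j > 0"
begin

lemma r_mono: "i \<le> j \<Longrightarrow> j \<le> N \<Longrightarrow> r i \<le> r j"
proof (induction j)
  case (Suc j)
  then show ?case using r_less[of j] by (cases "i = Suc j") auto
qed simp

lemma r_strict: "i < j \<Longrightarrow> j \<le> N \<Longrightarrow> r i < r j"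
  using r_less[of i] r_mono[of "Suc i" j] by auto

lemma r_pos: "1 \<le> j \<Longrightarrow> j \<le> N \<Longrightarrow> 0 < r j"
  using r_strict[of 0 j] r0 by auto

text \<open>The ratio of the singular radial solution \<open>s^-(l+1)\<close> to the regular one
  \<open>s^l\<close>; a natural power of the reciprocal fits the Lipschitz and derivative
  rules.\<close>

definition g :: "real \<Rightarrow> real" where "g s = (1 / s) ^ (2 * l + 1)"

abbreviation w :: "nat \<Rightarrow> real" where "w j \<equiv> w_coeff r l j"

lemma w_eq: "w j = g (r j)"
proof -
  have "(- (2 * int l + 1)) = - int (2 * l + 1)" by simp
  then show ?thesis
    unfolding w_coeff_def g_def by (simp only: power_int_minus power_int_of_nat) (simp add: power_one_over inverse_eq_divide)
qed

lemma w_pos: "1 \<le> j \<Longrightarrow> j \<le> N \<Longrightarrow> 0 < w j"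
  using r_pos[of j] by (simp add: w_eq g_def)

lemma w_antimono: "1 \<le> i \<Longrightarrow> i < j \<Longrightarrow> j \<le> N \<Longrightarrow> w j \<le> w i"
  unfolding w_eq g_def using r_pos[of i] r_strict[of i j]
  by (intro power_mono divide_left_mono) auto

lemma wN: "w N = 1"
  by (simp add: w_eq g_def rN)

definition a :: "nat \<Rightarrow> real" where "a k = fst (layer_coeffs r c l k)"
definition b :: "nat \<Rightarrow> real" where "b k = snd (layer_coeffs r c l k)"

lemma a_0: "a 0 = 1" and b_0: "b 0 = 0"
  by (simp_all add: a_def b_def)

text \<open>Value and flux at the outer radius \<open>r (Suc k)\<close> of the layer
  \<open>Suc k\<close>, both divided by \<open>r (Suc k) ^ l\<close>; the flux \<open>Fl\<close> is
  taken without its conductivity \<open>c (Suc k)\<close>.\<close>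

abbreviation V :: "nat \<Rightarrow> real" where "V k \<equiv> a k + b k * w (Suc k)"
abbreviation Fl :: "nat \<Rightarrow> real" where "Fl k \<equiv> real l * a k - (real l + 1) * b k * w (Suc k)"

lemma a_Suc: "a (Suc k) = ((real l + 1) * V k + c (Suc k) / c (Suc (Suc k)) * Fl k) / (2 * real l + 1)"
  and b_Suc: "b (Suc k) = (real l * V k - c (Suc k) / c (Suc (Suc k)) * Fl k) / ((2 * real l + 1) * w (Suc k))"
  by (simp_all add: a_def b_def Let_def split: prod.splits)

lemma l_nz: "2 * real l + 1 \<noteq> 0" by (metis of_nat_0_le_iff add_nonneg_eq_0_iff mult_nonneg_nonneg zero_le_numeral zero_le_one zero_neq_one)

text \<open>\<open>layer_coeffs\<close> is the solution of these two linear equations, continuity of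
  value and flux at \<open>r (Suc k)\<close>, for the coefficients of the next layer.\<close>

lemma transmission:
  assumes "Suc k < N"
  shows "a (Suc k) + b (Suc k) * w (Suc k) = V k"
    and "c (Suc (Suc k)) * (real l * a (Suc k) - (real l + 1) * b (Suc k) * w (Suc k)) = c (Suc k) * Fl k"
proof -
  have w0: "w (Suc k) \<noteq> 0" using w_pos[of "Suc k"] assms by simp
  have c0: "c (Suc (Suc k)) \<noteq> 0" using c_pos[of "Suc (Suc k)"] assms by simp
  define W where "W = c (Suc k) / c (Suc (Suc k)) * Fl k"
  have bw: "b (Suc k) * w (Suc k) = (real l * V k - W) / (2 * real l + 1)"
    unfolding b_Suc W_def using w0 l_nz by simp
  have "a (Suc k) + b (Suc k) * w (Suc k) = ((2 * real l + 1) * V k) / (2 * real l + 1)"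
    unfolding bw a_Suc W_def[symmetric] by (simp add: algebra_simps flip: add_divide_distrib)
  then show "a (Suc k) + b (Suc k) * w (Suc k) = V k" using l_nz by simp
  have "real l * a (Suc k) - (real l + 1) * b (Suc k) * w (Suc k) = real l * a (Suc k) - (real l + 1) * (b (Suc k) * w (Suc k))"
    by simp
  also have "\<dots> = ((2 * real l + 1) * W) / (2 * real l + 1)"
    unfolding bw a_Suc W_def[symmetric] by (simp add: algebra_simps flip: add_divide_distrib diff_divide_distrib)
  also have "\<dots> = W" using l_nz by simp
  finally show "c (Suc (Suc k)) * (real l * a (Suc k) - (real l + 1) * b (Suc k) * w (Suc k)) = c (Suc k) * Fl k"
    using c0 by (simp add: W_def)
qed

text \<open>Across a layer, \<open>V\<close> and \<open>Fl\<close> pass from their values at the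
  inner radius, positive by induction, to convex combinations of these with \<open>a\<close> and
  \<open>l * a\<close>. For \<open>l = 0\<close> the flux is only nonnegative.\<close>

lemma positivity:
  assumes "k < N"
  shows "0 < a k \<and> 0 < V k \<and> 0 \<le> Fl k \<and> (0 < l \<longrightarrow> 0 < Fl k)"
  using assms
proof (induction k)
  case 0
  then show ?case by (simp add: a_0 b_0)
next
  case (Suc k)
  then have IH: "0 < a k" "0 < V k" "0 \<le> Fl k" "0 < l \<Longrightarrow> 0 < Fl k" by auto
  have c0: "0 < c (Suc k)" "0 < c (Suc (Suc k))" using c_pos Suc.prems by auto
  define W where "W = c (Suc k) / c (Suc (Suc k)) * Fl k"
  have W: "0 \<le> W" "0 < l \<Longrightarrow> 0 < W" using IH c0 by (auto simp: W_def)
  have a: "0 < a (Suc k)"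
  proof -
    have "0 < (real l + 1) * V k" by (rule mult_pos_pos) (use IH(2) in simp_all)
    then show ?thesis
      unfolding a_Suc W_def[symmetric] using W(1) by (intro divide_pos_pos) linarith+
  qed
  have t1: "a (Suc k) + b (Suc k) * w (Suc k) = V k" by (rule transmission(1)[OF Suc.prems])
  have t2: "real l * a (Suc k) - (real l + 1) * b (Suc k) * w (Suc k) = W"
    using transmission(2)[OF Suc.prems] c0 by (simp add: W_def field_simps)
  have ww: "0 < w (Suc (Suc k))" "w (Suc (Suc k)) \<le> w (Suc k)" "0 < w (Suc k)"
    using w_pos[of "Suc (Suc k)"] w_antimono[of "Suc k" "Suc (Suc k)"] w_pos[of "Suc k"] Suc.prems by auto
  \<comment> \<open>The weight of the convex combination; \<open>w\<close> decreases outwards, so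
    \<open>t\<close> is at most 1.\<close>
  define t where "t = w (Suc (Suc k)) / w (Suc k)"
  have t: "0 < t" "t \<le> 1" using ww by (auto simp: t_def)
  have tw: "w (Suc (Suc k)) = t * w (Suc k)" using ww by (simp add: t_def)
  have V: "V (Suc k) = (1 - t) * a (Suc k) + t * V k"
    unfolding t1[symmetric] tw by (simp add: algebra_simps)
  have F: "Fl (Suc k) = (1 - t) * (real l * a (Suc k)) + t * W"
    unfolding t2[symmetric] tw by (simp add: algebra_simps)
  have "0 \<le> (1 - t) * a (Suc k)" using t a by simp
  moreover have "0 < t * V k" using t(1) IH(2) by (rule mult_pos_pos)
  ultimately have "0 < V (Suc k)" unfolding V by linarith
  moreover have "0 \<le> Fl (Suc k)"
    unfolding F using t a W by (intro add_nonneg_nonneg mult_nonneg_nonneg) auto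
  moreover have "0 < Fl (Suc k)" if "0 < l"
    unfolding F using t a W(2)[OF that] by (intro add_nonneg_pos mult_pos_pos mult_nonneg_nonneg) auto
  ultimately show ?case using a by simp
qed

text \<open>Up to the factor \<open>l\<close>, the number \<open>\<rho>\<close> is the quotient of
  value and flux at the outer radius of a layer. It starts with 1 because the innermost layer has no
  singular part, which is also the meaning of an infinite \<open>C_coeff\<close>.\<close>

lemma rho_C_coeff:
  assumes l: "0 < l" and k: "k < N"
  shows "rho_coeff r c l (Suc k) = real l * V k / Fl k \<and> C_coeff r c l k = (if b k = 0 then \<infinity> else ereal (a k / b k))"
  using k
proof (induction k)
  case 0
  then show ?case using l by (simp add: a_0 b_0)
next
  case (Suc k)
  then have IH: "rho_coeff r c l (Suc k) = real l * V k / Fl k" by simp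
  have pos: "0 < V k" "0 < Fl k" using positivity[of k] Suc.prems l by auto
  have pos': "0 < a (Suc k)" "0 < V (Suc k)" "0 < Fl (Suc k)" using positivity[of "Suc k"] Suc.prems l by auto
  have c0: "0 < c (Suc k)" "0 < c (Suc (Suc k))" using c_pos Suc.prems by auto
  have w0: "0 < w (Suc k)" using w_pos[of "Suc k"] Suc.prems by simp
  have lp: "0 < real l" using l by simp
  define v where "v = V k"
  define f where "f = Fl k"
  have vf: "0 < v" "0 < f" using pos by (simp_all add: v_def f_def)
  define rho where "rho = rho_coeff r c l (Suc k)"
  have rho: "rho = real l * v / f" using IH by (simp add: rho_def v_def f_def)
  \<comment> \<open>The denominator of the recursion vanishes exactly when the next layer has no
    singular part.\<close>
  have "b (Suc k) = 0 \<longleftrightarrow> real l * v = c (Suc k) / c (Suc (Suc k)) * f"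
    unfolding b_Suc v_def[symmetric] f_def[symmetric] using l_nz w0 by simp
  also have "\<dots> \<longleftrightarrow> c (Suc (Suc k)) * rho = c (Suc k)"
    unfolding rho using c0 vf by (auto simp: field_simps)
  finally have cond: "c (Suc (Suc k)) * rho = c (Suc k) \<longleftrightarrow> b (Suc k) = 0" by simp
  have C: "C_coeff r c l (Suc k) = (if b (Suc k) = 0 then \<infinity> else ereal (a (Suc k) / b (Suc k)))"
  proof (cases "b (Suc k) = 0")
    case True
    then show ?thesis using cond by (simp add: Let_def rho_def)
  next
    case False
    define W where "W = c (Suc k) / c (Suc (Suc k)) * f"
    have ab: "a (Suc k) / b (Suc k) = w (Suc k) * (((real l + 1) * v + W) / (real l * v - W))"
      unfolding a_Suc b_Suc v_def[symmetric] f_def[symmetric] W_def[symmetric] using l_nz by simp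
    \<comment> \<open>Scaling numerator and denominator of the quotient by
      \<open>c (Suc (Suc k)) / f\<close> produces those of the recursion, as
      \<open>rho = l * v / f\<close>.\<close>
    have s: "c (Suc (Suc k)) / f \<noteq> 0" using c0 vf by simp
    have "((real l + 1) * v + W) / (real l * v - W) =
       ((c (Suc (Suc k)) / f) * ((real l + 1) * v + W)) / ((c (Suc (Suc k)) / f) * (real l * v - W))"
      using s by (rule mult_divide_mult_cancel_left[symmetric])
    also have "(c (Suc (Suc k)) / f) * ((real l + 1) * v + W) = beta l * c (Suc (Suc k)) * rho + c (Suc k)"
      unfolding beta_def rho W_def using c0 vf lp by (simp add: field_simps)
    also have "(c (Suc (Suc k)) / f) * (real l * v - W) = c (Suc (Suc k)) * rho - c (Suc k)"
      unfolding rho W_def using c0 vf by (simp add: field_simps)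
    finally have "a (Suc k) / b (Suc k) = w (Suc k) * ((beta l * c (Suc (Suc k)) * rho + c (Suc k)) / (c (Suc (Suc k)) * rho - c (Suc k)))"
      unfolding ab by simp
    then show ?thesis using False cond by (simp add: Let_def rho_def)
  qed
  have "rho_coeff r c l (Suc (Suc k)) = real l * V (Suc k) / Fl (Suc k)"
  proof (cases "b (Suc k) = 0")
    case True
    then show ?thesis using C pos'(1) lp by simp
  next
    case False
    have "rho_coeff r c l (Suc (Suc k)) = (a (Suc k) / b (Suc k) + w (Suc (Suc k))) / (a (Suc k) / b (Suc k) - beta l * w (Suc (Suc k)))"
      using C False by (simp del: C_coeff.simps)
    also have "\<dots> = (real l * b (Suc k) * (a (Suc k) / b (Suc k) + w (Suc (Suc k)))) / (real l * b (Suc k) * (a (Suc k) / b (Suc k) - beta l * w (Suc (Suc k))))"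
      using False lp by (intro mult_divide_mult_cancel_left[symmetric]) simp
    also have "real l * b (Suc k) * (a (Suc k) / b (Suc k) + w (Suc (Suc k))) = real l * V (Suc k)"
      using False by (simp add: field_simps)
    also have "real l * b (Suc k) * (a (Suc k) / b (Suc k) - beta l * w (Suc (Suc k))) = Fl (Suc k)"
      using False lp by (simp add: beta_def field_simps)
    finally show ?thesis .
  qed
  then show ?case using C by simp
qed

text \<open>The boundary value of the unnormalised radial solution, because
  \<open>w N = 1\<close>.\<close>

definition D :: real where "D = a (N - 1) + b (N - 1)"

lemma D_pos: "0 < D"
  using positivity[of "N - 1"] N wN by (simp add: D_def)

lemma DN_eigenvalue_eq: "DN_eigenvalue N r c l = (real l * a (N - 1) - (real l + 1) * b (N - 1)) / D"
proof (cases "l = 0")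
  case True
  \<comment> \<open>For \<open>l = 0\<close> the solution is constant: the first layer has zero
    flux, and transmission keeps it zero.\<close>
  have "b k = 0" if "k < N" for k
    using that
  proof (induction k)
    case (Suc k)
    then show ?case unfolding b_Suc using True by simp
  qed (simp add: b_0)
  then have "b (N - 1) = 0" using N by simp
  then show ?thesis using True by (simp add: DN_eigenvalue_def)
next
  case False
  then have C: "C_coeff r c l (N - 1) = (if b (N - 1) = 0 then \<infinity> else ereal (a (N - 1) / b (N - 1)))"
    using rho_C_coeff[of "N - 1"] N by simp
  show ?thesis
  proof (cases "b (N - 1) = 0")
    case True
    \<comment> \<open>Without singular part in the outermost layer \<open>C_coeff\<close> is
      infinite, the fraction is zero and the eigenvalue is \<open>l\<close>.\<close>
    then show ?thesis using False C D_pos by (simp add: DN_eigenvalue_def D_def)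
  next
    case b: False
    have e: "1 + a (N - 1) / b (N - 1) = D / b (N - 1)"
      using b by (simp add: D_def field_simps)
    have C2: "1 + C_coeff r c l (N - 1) = ereal (D / b (N - 1))"
      unfolding C e[symmetric] using b by (simp add: one_ereal_def)
    have "DN_eigenvalue N r c l = real l - real_of_ereal (ereal (2 * real l + 1) / ereal (D / b (N - 1)))"
      unfolding DN_eigenvalue_def C2 using False by simp
    also have "\<dots> = real l - (2 * real l + 1) / (D / b (N - 1))"
      using b D_pos by simp
    also have "\<dots> = (real l * a (N - 1) - (real l + 1) * b (N - 1)) / D"
      using b D_pos by (simp add: field_simps) (simp add: D_def algebra_simps)
    finally show ?thesis .
  qed
qed

section \<open>The radial factor and the flux as Lipschitz functions across all layers\<close>

definition clip :: "nat \<Rightarrow> real \<Rightarrow> real" where "clip k s = max (r k) (min s (r (Suc k)))"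

text \<open>
  Under the transmission conditions this is \<open>X k + Y k * g s\<close> for \<open>r k \<le> s \<le> r (Suc k)\<close>, written
  so that Lipschitz continuity is evident.
\<close>

definition profile :: "(nat \<Rightarrow> real) \<Rightarrow> (nat \<Rightarrow> real) \<Rightarrow> real \<Rightarrow> real" where
  "profile X Y s = X 0 + (\<Sum>k\<in>{1..<N}. Y k * (g (clip k s) - g (r k)))"

lemma lipschitz_profile: "lipschitz_on_bounded (profile X Y)"
proof -
  have mn: "lipschitz_on_bounded (\<lambda>s::real. min s t)" for t
    by (rule lipschitz_on_boundedI) (auto intro!: exI[of _ 1])
  \<comment> \<open>For \<open>k \<ge> 1\<close> the clipped argument is at least
    \<open>r k > 0\<close>, so the negative power is Lipschitz.\<close>
  have gc: "lipschitz_on_bounded (\<lambda>s. g (clip k s))" if "k \<in> {1..<N}" for k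
    unfolding g_def clip_def using that
    by (intro lipschitz_on_bounded_power lipschitz_on_bounded_compose[OF mn lipschitz_on_bounded_inverse_max] r_pos) auto
  have sm: "lipschitz_on_bounded (\<lambda>s. \<Sum>k\<in>K. f k s)"
    if "finite K" "\<And>k. k \<in> K \<Longrightarrow> lipschitz_on_bounded (f k)" for K and f :: "nat \<Rightarrow> real \<Rightarrow> real"
    using that by (induction K rule: finite_induct) (auto intro!: lipschitz_on_bounded_const lipschitz_on_bounded_add)
  show ?thesis
    unfolding profile_def[abs_def]
    by (intro lipschitz_on_bounded_add lipschitz_on_bounded_const sm lipschitz_on_bounded_mult lipschitz_on_bounded_diff gc) auto
qed

lemma profile_eq:
  assumes Y0: "Y 0 = 0" and XY: "\<And>k. Suc k < N \<Longrightarrow> X (Suc k) + Y (Suc k) * g (r (Suc k)) = X k + Y k * g (r (Suc k))"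
    and j: "j < N" and s: "r j \<le> s" "s \<le> r (Suc j)"
  shows "profile X Y s = X j + Y j * g s"
proof -
  \<comment> \<open>Completed layers contribute their full increments, which telescope by the
    matching conditions \<open>XY\<close>.\<close>
  have S: "X 0 + (\<Sum>k\<in>{1..<i}. Y k * (g (r (Suc k)) - g (r k))) = X i + Y i * g (r i)" if "1 \<le> i" "i < N" for i
    using that
  proof (induction i)
    case (Suc i)
    show ?case
    proof (cases "i = 0")
      case True
      then show ?thesis using XY[of 0] Suc.prems Y0 by simp
    next
      case False
      then have "X 0 + (\<Sum>k\<in>{1..<i}. Y k * (g (r (Suc k)) - g (r k))) = X i + Y i * g (r i)"
        using Suc by simp
      then show ?thesis using False XY[of i] Suc.prems by (simp add: algebra_simps)
    qed
  qed simp
  have lt: "clip k s = r (Suc k)" if "k < j" for k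
    using r_mono[of "Suc k" j] r_less[of k] that j s by (auto simp: clip_def)
  have gt: "clip k s = r k" if "j < k" "k < N" for k
    using r_mono[of "Suc j" k] that s by (auto simp: clip_def)
  have eqj: "clip j s = s" using s by (auto simp: clip_def)
  have "(\<Sum>k\<in>{1..<N}. Y k * (g (clip k s) - g (r k))) = (\<Sum>k\<in>{1..<Suc j}. Y k * (g (clip k s) - g (r k)))"
    using j gt by (intro sum.mono_neutral_right) auto
  also have "X 0 + \<dots> = X j + Y j * g s"
  proof (cases "j = 0")
    case True
    then show ?thesis by (simp add: Y0)
  next
    case False
    have "(\<Sum>k\<in>{1..<Suc j}. Y k * (g (clip k s) - g (r k))) =
        (\<Sum>k\<in>{1..<j}. Y k * (g (r (Suc k)) - g (r k))) + Y j * (g s - g (r j))"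
      using False lt eqj by simp
    then show ?thesis using S[of j] False j by (simp add: algebra_simps)
  qed
  finally show ?thesis by (simp add: profile_def)
qed

text \<open>Zero outside \<open>{0..<1}\<close>, hence Borel and bounded on the whole line, whereas
  the conductivity of the theorem is arbitrary outside the closed ball.\<close>

definition \<kappa> :: "real \<Rightarrow> real" where
  "\<kappa> s = (\<Sum>k<N. c (Suc k) * indicat_real {r k..<r (Suc k)} s)"

lemma \<kappa>_eq:
  assumes j: "j < N" and s: "r j \<le> s" "s < r (Suc j)"
  shows "\<kappa> s = c (Suc j)"
proof -
  have z: "indicat_real {r k..<r (Suc k)} s = (if k = j then 1 else 0)" if "k < N" for k
  proof -
    consider "k < j" | "k = j" | "j < k" by linarith
    then show ?thesis
    proof cases
      case 1
      then show ?thesis using r_mono[of "Suc k" j] j s by auto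
    next
      case 3
      then show ?thesis using r_mono[of "Suc j" k] that s by auto
    qed (use s in auto)
  qed
  have "\<kappa> s = (\<Sum>k<N. if k = j then c (Suc k) else 0)"
    unfolding \<kappa>_def by (intro sum.cong refl) (simp add: z)
  also have "\<dots> = c (Suc j)" using j by simp
  finally show ?thesis .
qed

lemma layer_exists:
  assumes "0 \<le> s" "s < 1"
  obtains j where "j < N" "r j \<le> s" "s < r (Suc j)"
proof -
  define k where "k = (LEAST k. s < r k)"
  have "s < r N" using assms rN by simp
  then have k: "s < r k" "k \<le> N"
    unfolding k_def by (auto intro: LeastI Least_le)
  have "k \<noteq> 0" using k(1) assms(1) r0 by (metis not_less)
  then obtain j where j: "k = Suc j" by (cases k) auto
  have "\<not> s < r j"
    using not_less_Least[of j "\<lambda>k. s < r k"] j by (simp add: k_def)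
  then show ?thesis using k j by (intro that[of j]) auto
qed

definition A :: "nat \<Rightarrow> real" where "A k = a k / D"
definition B :: "nat \<Rightarrow> real" where "B k = b k / D"

definition Q :: "real \<Rightarrow> real" where "Q = profile A B"
definition P :: "real \<Rightarrow> real" where
  "P = profile (\<lambda>k. c (Suc k) * (real l * A k)) (\<lambda>k. - (c (Suc k) * ((real l + 1) * B k)))"

lemma Q_eq: "j < N \<Longrightarrow> r j \<le> s \<Longrightarrow> s \<le> r (Suc j) \<Longrightarrow> Q s = A j + B j * g s"
  unfolding Q_def
proof (rule profile_eq)
  show "B 0 = 0" by (simp add: B_def b_0)
  show "A (Suc k) + B (Suc k) * g (r (Suc k)) = A k + B k * g (r (Suc k))" if "Suc k < N" for k
    using transmission(1)[OF that] unfolding A_def B_def w_eq by (simp flip: add_divide_distrib)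
qed

lemma P_eq: "j < N \<Longrightarrow> r j \<le> s \<Longrightarrow> s \<le> r (Suc j) \<Longrightarrow> P s = c (Suc j) * (real l * A j - (real l + 1) * B j * g s)"
proof -
  assume j: "j < N" "r j \<le> s" "s \<le> r (Suc j)"
  have "P s = c (Suc j) * (real l * A j) + - (c (Suc j) * ((real l + 1) * B j)) * g s"
    unfolding P_def
  proof (rule profile_eq[OF _ _ j])
    show "- (c (Suc 0) * ((real l + 1) * B 0)) = 0" by (simp add: B_def b_0)
    fix k assume k: "Suc k < N"
    have "c (Suc (Suc k)) * (real l * a (Suc k) - (real l + 1) * b (Suc k) * w (Suc k)) / D = c (Suc k) * Fl k / D"
      using transmission(2)[OF k] by simp
    then show "c (Suc (Suc k)) * (real l * A (Suc k)) + - (c (Suc (Suc k)) * ((real l + 1) * B (Suc k))) * g (r (Suc k)) =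
        c (Suc k) * (real l * A k) + - (c (Suc k) * ((real l + 1) * B k)) * g (r (Suc k))"
      unfolding A_def B_def w_eq by (simp add: diff_divide_distrib right_diff_distrib mult.assoc)
  qed
  then show ?thesis by (simp add: algebra_simps)
qed

lemma DERIV_g: "s > 0 \<Longrightarrow> (g has_real_derivative - (2 * real l + 1) * g s / s) (at s)"
proof -
  assume s: "s > 0"
  have d: "((\<lambda>s. 1 / s) has_real_derivative - (1 / s\<^sup>2)) (at s)"
    using s by (auto intro!: derivative_eq_intros simp: power2_eq_square)
  have "((\<lambda>s. (1 / s) ^ (2 * l + 1)) has_real_derivative of_nat (2 * l + 1) * (- (1 / s\<^sup>2) * (1 / s) ^ (2 * l + 1 - Suc 0))) (at s)"
    by (rule DERIV_power[OF d])
  also have "of_nat (2 * l + 1) * (- (1 / s\<^sup>2) * (1 / s) ^ (2 * l + 1 - Suc 0)) = - (2 * real l + 1) * g s / s"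
  proof -
    define X where "X = (1 / s) ^ (2 * l)"
    have gX: "g s = X / s" by (simp add: g_def X_def)
    have e: "(1 / s) ^ (2 * l + 1 - Suc 0) = X" by (simp add: X_def)
    show ?thesis unfolding e gX using s by (simp add: power2_eq_square field_simps)
  qed
  finally show ?thesis by (simp add: g_def[abs_def])
qed

lemma radial_profile_layers:
  assumes sh: "solid_harmonic l h h1 h2"
  shows "radial_profile l \<kappa> Q P (r ` {..N}) (r 1) (Min (c ` {1..N})) (\<Sum>k<N. c (Suc k)) h h1 h2"
proof
  have c': "0 < c (Suc k)" if "k < N" for k using c_pos[of "Suc k"] that by simp
  show "\<kappa> \<in> borel_measurable borel"
    unfolding \<kappa>_def[abs_def] by (intro borel_measurable_sum borel_measurable_times borel_measurable_indicator) auto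
  show "\<bar>\<kappa> s\<bar> \<le> (\<Sum>k<N. c (Suc k))" for s
  proof -
    have "\<bar>\<kappa> s\<bar> \<le> (\<Sum>k<N. \<bar>c (Suc k) * indicat_real {r k..<r (Suc k)} s\<bar>)"
      unfolding \<kappa>_def by (rule sum_abs)
    also have "\<dots> \<le> (\<Sum>k<N. c (Suc k))"
      using c' by (intro sum_mono) (auto simp: indicator_def less_imp_le)
    finally show ?thesis .
  qed
  show "0 < Min (c ` {1..N})" using N c_pos by (subst Min_gr_iff) auto
  show "Min (c ` {1..N}) \<le> \<kappa> s" if "0 \<le> s" "s < 1" for s
  proof -
    obtain j where "j < N" "r j \<le> s" "s < r (Suc j)" using layer_exists \<open>0 \<le> s\<close> \<open>s < 1\<close> by blast
    then show ?thesis by (simp add: \<kappa>_eq)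
  qed
  show "lipschitz_on_bounded Q" "lipschitz_on_bounded P"
    unfolding Q_def P_def by (rule lipschitz_profile)+
  show "finite (r ` {..N})" by simp
  show "0 < r 1" using r_pos[of 1] N by simp
  show "r 1 \<le> 1" using r_mono[of 1 N] N rN by simp
  show "Q s = Q 0 \<and> \<kappa> s = \<kappa> 0 \<and> P s = real l * \<kappa> 0 * Q 0" if s: "0 \<le> s" "s < r 1" for s
    using Q_eq[of 0 s] Q_eq[of 0 0] P_eq[of 0 s] \<kappa>_eq[of 0 s] \<kappa>_eq[of 0 0] s N r0 \<open>0 < r 1\<close>
    by (simp add: B_def b_0)
  show "solid_harmonic l h h1 h2" by (rule sh)
  fix s assume s: "0 < s" "s < 1" "s \<notin> r ` {..N}"
  obtain j where j: "j < N" "r j \<le> s" "s < r (Suc j)"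
    using layer_exists[of s] s by auto
  \<comment> \<open>Not being an interface, \<open>s\<close> lies in an open layer, on which the
    explicit formulas can be differentiated.\<close>
  then have j': "r j < s" using s(3) by (metis atMost_iff imageI less_imp_le order_le_less)
  have cj: "0 < c (Suc j)" using c' j by simp
  have Qs: "Q s = A j + B j * g s" and Ps: "P s = c (Suc j) * (real l * A j - (real l + 1) * B j * g s)" and ks: "\<kappa> s = c (Suc j)"
    using Q_eq P_eq \<kappa>_eq j by auto
  have "((\<lambda>s. A j + B j * g s) has_real_derivative (B j * (- (2 * real l + 1) * g s / s))) (at s)"
    using DERIV_add[OF DERIV_const[of "A j"] DERIV_cmult[OF DERIV_g[OF s(1)], of "B j"]] by simp
  then have "(Q has_real_derivative (B j * (- (2 * real l + 1) * g s / s))) (at s)"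
    by (rule has_field_derivative_transform_within_open[of _ _ _ "{r j<..<r (Suc j)}"]) (use j j' Q_eq in auto)
  also have "B j * (- (2 * real l + 1) * g s / s) = (P s / \<kappa> s - real l * Q s) / s"
  proof -
    have "P s / \<kappa> s = real l * A j - (real l + 1) * B j * g s" using cj by (simp add: Ps ks)
    then show ?thesis using s(1) by (simp add: Qs field_simps)
  qed
  finally show "(Q has_real_derivative (P s / \<kappa> s - real l * Q s) / s) (at s)" .
  have "((\<lambda>s. c (Suc j) * (real l * A j - (real l + 1) * B j * g s)) has_real_derivative
      (c (Suc j) * (- ((real l + 1) * B j * (- (2 * real l + 1) * g s / s))))) (at s)"
    using DERIV_g[OF s(1)] by (auto intro!: derivative_eq_intros)
  then have "(P has_real_derivative (c (Suc j) * (- ((real l + 1) * B j * (- (2 * real l + 1) * g s / s))))) (at s)"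
    by (rule has_field_derivative_transform_within_open[of _ _ _ "{r j<..<r (Suc j)}"]) (use j j' P_eq in auto)
  also have "c (Suc j) * (- ((real l + 1) * B j * (- (2 * real l + 1) * g s / s))) =
      (real l * (real l + 1) * \<kappa> s * Q s - (real l + 1) * P s) / s"
    unfolding Qs Ps ks using s(1) by (simp add: field_simps)
  finally show "(P has_real_derivative (real l * (real l + 1) * \<kappa> s * Q s - (real l + 1) * P s) / s) (at s)" .
qed

lemma AB_sum: "A (N - 1) + B (N - 1) = 1"
  using D_pos by (simp add: A_def B_def D_def flip: add_divide_distrib)

lemma Q_1: "Q 1 = 1"
  using Q_eq[of "N - 1" 1] N r_less[of "N - 1"] rN AB_sum by (simp add: g_def)

text \<open>Near the sphere the solution on the ray through \<open>x\<close> is an explicit function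
  of \<open>1 + t\<close> times \<open>h x\<close>; with \<open>A\<close> and \<open>B\<close> of
  the outermost layer its derivative at \<open>t = 0\<close> is
  \<open>l * (A + B) - (2 * l + 1) * B\<close>.\<close>

lemma normal_derivative_layers:
  assumes hom: "\<And>s x. h (s *\<^sub>R x) = of_real s ^ l * h x" and x: "norm x = 1"
  shows "has_normal_derivative (\<lambda>x. of_real (Q (norm x)) * h x) (of_real (DN_eigenvalue N r c l) * h x) x"
proof -
  let ?f = "\<lambda>t. (A (N - 1) + B (N - 1) * (1 / (1 + t)) ^ (2 * l + 1)) * (1 + t) ^ l :: real"
  have ev: "DN_eigenvalue N r c l = real l * A (N - 1) - (real l + 1) * B (N - 1)"
    unfolding DN_eigenvalue_eq A_def B_def by (simp add: diff_divide_distrib)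
  have "(?f has_real_derivative (B (N - 1) * (of_nat (2 * l + 1) * (- 1)) + (A (N - 1) + B (N - 1)) * real l)) (at 0)"
    by (auto intro!: derivative_eq_intros simp: algebra_simps)
  also have "B (N - 1) * (of_nat (2 * l + 1) * (- 1)) + (A (N - 1) + B (N - 1)) * real l = DN_eigenvalue N r c l"
    unfolding ev by (simp add: algebra_simps)
  finally have "(?f has_vector_derivative DN_eigenvalue N r c l) (at 0 within {-1..0})"
    by (simp add: has_real_derivative_iff_has_vector_derivative has_vector_derivative_at_within)
  then have "((\<lambda>t. complex_of_real (?f t) * h x) has_vector_derivative of_real (DN_eigenvalue N r c l) * h x) (at 0 within {-1..0})"
    by (intro has_vector_derivative_mult_left bounded_linear.has_vector_derivative[OF bounded_linear_of_real])
  then show ?thesis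
    unfolding has_normal_derivative_def
  proof (rule has_vector_derivative_transform_within)
    \<comment> \<open>The explicit formula is valid as long as the ray stays in the outermost
      layer.\<close>
    show "0 < 1 - r (N - 1)" using r_less[of "N - 1"] N rN by simp
    fix t :: real assume t: "t \<in> {-1..0}" "dist t 0 < 1 - r (N - 1)"
    have "x + t *\<^sub>R x = (1 + t) *\<^sub>R x" by (simp add: scaleR_left_distrib)
    then have nx: "norm (x + t *\<^sub>R x) = 1 + t"
      using t x by simp
    have hx: "h (x + t *\<^sub>R x) = of_real (1 + t) ^ l * h x"
      using hom[of "1 + t" x] by (simp add: scaleR_left_distrib)
    have "Q (1 + t) = A (N - 1) + B (N - 1) * g (1 + t)"
      using t N rN by (intro Q_eq) (auto simp: dist_real_def)
    then show "complex_of_real (?f t) * h x = complex_of_real (Q (norm (x + t *\<^sub>R x))) * h (x + t *\<^sub>R x)"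
      unfolding nx hx by (simp add: g_def)
  qed auto
qed

end

theorem proposition3p6:
  fixes N :: nat and r c :: "nat \<Rightarrow> real" and \<gamma> :: "real ^ 3 \<Rightarrow> real"
  assumes "N \<ge> 1"
    and "r 0 = 0" and "\<And>j. j < N \<Longrightarrow> r j < r (Suc j)" and "r N = 1"
    and "\<And>j. 1 \<le> j \<Longrightarrow> j \<le> N \<Longrightarrow> c j > 0" and "c N = 1"
    and "\<And>j x. 1 \<le> j \<Longrightarrow> j \<le> N \<Longrightarrow> r (j - 1) \<le> norm x \<Longrightarrow> norm x < r j \<Longrightarrow> \<gamma> x = c j"
    and "\<And>x. norm x = 1 \<Longrightarrow> \<gamma> x = c N"
  shows "\<forall>l m. \<bar>m\<bar> \<le> int l \<longrightarrow> DN_eigenpair \<gamma> (DN_eigenvalue N r c l) (sph_harm l m)"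
proof (intro allI impI)
  fix l :: nat and m :: int assume m: "\<bar>m\<bar> \<le> int l"
  interpret layered_ball N r c l
    using assms(1-5) by unfold_locales auto
  obtain h h1 h2 where sh: "solid_harmonic l h h1 h2"
    and hY: "\<And>x. norm x = 1 \<Longrightarrow> sph_harm l m x = h x" and hom: "\<And>s x. h (s *\<^sub>R x) = of_real s ^ l * h x"
    by (rule sph_harm_solid_extension[OF m]) blast
  interpret radial_profile l \<kappa> Q P "r ` {..N}" "r 1" "Min (c ` {1..N})" "\<Sum>k<N. c (Suc k)" h h1 h2
    by (rule radial_profile_layers[OF sh])
  have \<gamma>: "\<gamma> x = \<kappa> (norm x)" if x: "norm x < 1" for x
  proof -
    obtain j where "j < N" "r j \<le> norm x" "norm x < r (Suc j)"
      by (rule layer_exists[OF norm_ge_zero x])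
    then show ?thesis using assms(7)[of "Suc j" x] by (simp add: \<kappa>_eq)
  qed
  define u where "u x = of_real (Q (norm x)) * h x" for x
  have sol: "dirichlet_solution \<gamma> (sph_harm l m) u"
    unfolding u_def[abs_def] by (rule dirichlet_solution_radial[OF Q_1 \<gamma> hY])
  have "DN_map \<gamma> (sph_harm l m) (\<lambda>x. of_real (DN_eigenvalue N r c l) * sph_harm l m x)"
    unfolding DN_map_def
  proof (intro conjI allI impI ballI exI[of _ u] sol)
    fix v and x :: "real^3" assume v: "dirichlet_solution \<gamma> (sph_harm l m) v" and "x \<in> sphere 0 1"
    then have x: "norm x = 1" by simp
    \<comment> \<open>Every solution coincides with \<open>u\<close> on the closed ball and
      therefore inherits its one-sided normal derivative.\<close>
    have vu: "v y = u y" if "norm y \<le> 1" for y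
    proof (rule dirichlet_solution_unique[OF v sol _ \<gamma> _ _ that])
      show "(\<lambda>x::real^3. \<kappa> (norm x)) \<in> borel_measurable borel" using \<kappa>(1) by auto
      show "0 < \<kappa> (norm x)" if "norm x < 1" for x :: "real^3" using \<kappa>_pos that by simp
      show "\<bar>\<kappa> (norm x)\<bar> \<le> (\<Sum>k<N. c (Suc k))" for x :: "real^3" by (rule \<kappa>(2))
    qed
    have "has_normal_derivative u (of_real (DN_eigenvalue N r c l) * h x) x"
      unfolding u_def[abs_def] by (rule normal_derivative_layers[OF hom x])
    then have nd: "has_normal_derivative v (of_real (DN_eigenvalue N r c l) * h x) x"
      unfolding has_normal_derivative_def
    proof (rule has_vector_derivative_transform[rotated 2])
      fix t :: real assume t: "t \<in> {-1..0}"
      have "x + t *\<^sub>R x = (1 + t) *\<^sub>R x" by (simp add: scaleR_left_distrib)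
      then have "norm (x + t *\<^sub>R x) = \<bar>1 + t\<bar>"
        using x by simp
      then show "v (x + t *\<^sub>R x) = u (x + t *\<^sub>R x)"
        using t by (intro vu) auto
    qed auto
    \<comment> \<open>The normalisation \<open>c N = 1\<close> enters here: normal and conormal
      derivative agree on the sphere.\<close>
    show "\<exists>d. has_normal_derivative v d x \<and> of_real (DN_eigenvalue N r c l) * sph_harm l m x = of_real (\<gamma> x) * d"
      using nd assms(6) assms(8)[OF x] hY[OF x] by (intro exI[of _ "of_real (DN_eigenvalue N r c l) * h x"]) simp
  qed
  then show "DN_eigenpair \<gamma> (DN_eigenvalue N r c l) (sph_harm l m)"
    unfolding DN_eigenpair_def using sph_harm_nonzero[OF m] by blast
qed

end
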